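(* For each $\nu\in\mathbb{Z}_{\geq 0}$ there are only finitely many mutation-equivalence classes of Fano polygons $P$ with $\nu$ residual lattice points.
   Context: Let $N\cong\mathbb{Z}^2$, $N_{\mathbb{Q}}=N\otimes_{\mathbb{Z}}\mathbb{Q}$, $M=\operatorname{Hom}(N,\mathbb{Z})$. A Fano polygon is a convex polygon $P\subset N_{\mathbb{Q}}$ whose vertices are primitive lattice points of $N$ and which contains the origin in its strict interior; polygons are considered up to $GL_2(\mathbb{Z})$-equivalence. Residual lattice points. For an edge $E$ of $P$ with primitive inner normal $w_E\in M$, the height is $r_E=-w_E(E)>0$ and the width is $k_E=|E\cap N|-1$. Write $k_E=n_Er_E+k_0$ with $0\leq k_0<r_E$. The edge can be decomposed into $n_E$ lattice segments of width $r_E$ with primitive endpoints and, if $k_0\neq 0$, one additional lattice segment of width $k_0$ with primitive endpoints; the cone over this additional segment is called a residual cone. Fix such a decomposition for every edge. A lattice point of $P$ is residual if it lies in the strict interior of a residual cone. The number of residual lattice points does not depend on the chosen decomposition, and it is invariant under mutation. Mutation. Let $w\in M$ be the primitive inner normal vector of an edge $E$ of $P$, let $h_{\min}=\min_{v\in P}w(v)=-r_E<0$ and $h_{\max}=\max_{v\in P}w(v)>0$. For $h\in\mathbb{Z}$ let $w_h(P)$ be the (possibly empty) convex hull of $\{v\in P\cap N: w(v)=h\}$. Let $v_E\in N$ be primitive with $w(v_E)=0$ (unique up to sign) and $F=\operatorname{conv}\{0,v_E\}$. Suppose that for every integer $h$ with $h_{\min}\leq h<0$ there is a (possibly empty) lattice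 polytope $G_h\subset N_{\mathbb{Q}}$ with $\{v \text{ a vertex of } P: w(v)=h\}\subseteq G_h+|h|F\subseteq w_h(P)$ (Minkowski sum, with $\varnothing+Q=\varnothing$). Then the mutation of $P$ is $\operatorname{mut}_w(P,F)=\operatorname{conv}\big(\bigcup_{h=h_{\min}}^{-1}G_h\cup\bigcup_{h=0}^{h_{\max}}(w_h(P)+hF)\big)$. It is again a Fano polygon, is independent of the choice of $\{G_h\}$, and up to $GL_2(\mathbb{Z})$ is independent of the sign of $v_E$. Two Fano polygons are mutation-equivalent if, up to $GL_2(\mathbb{Z})$-equivalence, they are connected by a finite sequence of mutations. *)

theory Defs
  imports "HOL-Analysis.Analysis"
begin

(* N is the integer lattice, placed in the real plane instead of N tensor Q: the library's
   convexity theory needs real vector spaces, and all polytopes below have vertices in N.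
   M = Hom(N, Z) is identified with the same lattice, w acting on v as the inner product. *)
type_synonym plane = "real \<times> real"

definition lattice :: "plane set" where
  "lattice = \<int> \<times> \<int>"

definition primitive :: "plane \<Rightarrow> bool" where
  "primitive v \<longleftrightarrow> (\<exists>a b :: int. v = (of_int a, of_int b) \<and> coprime a b)"

definition lattice_polytope :: "plane set \<Rightarrow> bool" where
  "lattice_polytope G \<longleftrightarrow> (\<exists>V. finite V \<and> V \<subseteq> lattice \<and> G = convex hull V)"

definition fano_polygon :: "plane set \<Rightarrow> bool" where
  "fano_polygon P \<longleftrightarrow>
     polytope P \<and> (\<forall>v. v extreme_point_of P \<longrightarrow> primitive v) \<and> 0 \<in> interior P"

definition gl_equivalent :: "plane set \<Rightarrow> plane set \<Rightarrow> bool" where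
  "gl_equivalent P Q \<longleftrightarrow> (\<exists>f. linear f \<and> f ` lattice = lattice \<and> Q = f ` P)"

definition h_min :: "plane set \<Rightarrow> plane \<Rightarrow> real" where
  "h_min P w = (INF v\<in>P. w \<bullet> v)"

definition h_max :: "plane set \<Rightarrow> plane \<Rightarrow> real" where
  "h_max P w = (SUP v\<in>P. w \<bullet> v)"

definition inner_normal :: "plane set \<Rightarrow> plane set \<Rightarrow> plane \<Rightarrow> bool" where
  "inner_normal P E w \<longleftrightarrow> primitive w \<and> E = {v \<in> P. w \<bullet> v = h_min P w}"

definition edge_normal :: "plane set \<Rightarrow> plane set \<Rightarrow> plane" where
  "edge_normal P E = (THE w. inner_normal P E w)"

definition height :: "plane set \<Rightarrow> plane set \<Rightarrow> nat" where
  "height P E = (THE r. \<forall>v\<in>E. edge_normal P E \<bullet> v = - real r)"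

definition width :: "plane set \<Rightarrow> nat" where
  "width S = card (S \<inter> lattice) - 1"

definition primitive_segment :: "plane set \<Rightarrow> bool" where
  "primitive_segment S \<longleftrightarrow>
     (\<exists>a b. primitive a \<and> primitive b \<and> a \<noteq> b \<and> S = closed_segment a b)"

(* D is a set of non-overlapping segments with union E.  As k0 < r, the segments of width r and
   the residual one are told apart by their width; if k0 = 0 there is no residual segment. *)
definition edge_decomposition :: "plane set \<Rightarrow> plane set \<Rightarrow> plane set set \<Rightarrow> bool" where
  "edge_decomposition P E D \<longleftrightarrow>
     (let r = height P E; n = width E div r; k0 = width E mod r in
        finite D \<and> \<Union>D = E \<and>
        (\<forall>S\<in>D. primitive_segment S \<and> (width S = r \<or> width S = k0)) \<and>
        pairwise (\<lambda>S T. rel_interior S \<inter> rel_interior T = {}) D \<and>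
        card {S \<in> D. width S = r} = n \<and>
        card {S \<in> D. width S = k0} = (if k0 = 0 then 0 else 1))"

definition residual_points ::
    "plane set \<Rightarrow> (plane set \<Rightarrow> plane set set) \<Rightarrow> plane set" where
  "residual_points P D =
     {v \<in> P \<inter> lattice. \<exists>E S. E edge_of P \<and> S \<in> D E \<and>
        width S = width E mod height P E \<and> v \<in> interior (cone hull S)}"

(* The number does not depend on the family D of decompositions. *)
definition has_residual_points :: "plane set \<Rightarrow> nat \<Rightarrow> bool" where
  "has_residual_points P \<nu> \<longleftrightarrow>
     (\<exists>D. (\<forall>E. E edge_of P \<longrightarrow> edge_decomposition P E (D E)) \<and>
          card (residual_points P D) = \<nu>)"

definition slice :: "plane set \<Rightarrow> plane \<Rightarrow> int \<Rightarrow> plane set" where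
  "slice P w h = convex hull {v \<in> P \<inter> lattice. w \<bullet> v = of_int h}"

definition dilate :: "int \<Rightarrow> plane set \<Rightarrow> plane set" where
  "dilate c F = (*\<^sub>R) (of_int c) ` F"

(* Q = mut_w(P, F).  A relation, because mut_w(P, F) need not exist; where it exists it does not
   depend on G.  The sum of sets is the Minkowski sum. *)
definition is_mut :: "plane set \<Rightarrow> plane \<Rightarrow> plane set \<Rightarrow> plane set \<Rightarrow> bool" where
  "is_mut P w F Q \<longleftrightarrow>
     (\<exists>G :: int \<Rightarrow> plane set.
        (\<forall>h. h_min P w \<le> of_int h \<and> h < 0 \<longrightarrow>
           lattice_polytope (G h) \<and>
           {v. v extreme_point_of P \<and> w \<bullet> v = of_int h} \<subseteq> G h + dilate \<bar>h\<bar> F \<and>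
           G h + dilate \<bar>h\<bar> F \<subseteq> slice P w h) \<and>
        Q = convex hull
              ((\<Union>h \<in> {h. h_min P w \<le> of_int h \<and> h < 0}. G h) \<union>
               (\<Union>h \<in> {h. 0 \<le> h \<and> of_int h \<le> h_max P w}. slice P w h + dilate h F)))"

definition mutation :: "plane set \<Rightarrow> plane set \<Rightarrow> bool" where
  "mutation P Q \<longleftrightarrow>
     (\<exists>E w v\<^sub>E. E edge_of P \<and> inner_normal P E w \<and> primitive v\<^sub>E \<and> w \<bullet> v\<^sub>E = 0 \<and>
        is_mut P w (convex hull {0, v\<^sub>E}) Q)"

definition mutation_step :: "plane set \<Rightarrow> plane set \<Rightarrow> bool" where
  "mutation_step P Q \<longleftrightarrow>
     fano_polygon P \<and> fano_polygon Q \<and> (gl_equivalent P Q \<or> mutation P Q)"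

definition mutation_equivalence :: "(plane set \<times> plane set) set" where
  "mutation_equivalence =
     {(P, Q). fano_polygon P \<and> fano_polygon Q \<and> equivclp mutation_step P Q}"

end

theory Submission
  imports Defs
begin

text \<open>Take a polygon with an edge at height $-r$ of width at least $r$. Mutation leaves its left
  boundary chain unchanged and shears its right one by $(x, h) \mapsto (x + h, h)$. So residual segments survive, and
  the number of lattice points grows by at most $\sum_{-r}^{h_{\max}} h$, which is negative when $h_{\max} < r$. Hence
  each class contains a polygon with $h_{\max} \ge r$ for all such edges, and its residual cones
  still have height at most $2 \nu + 1$.

  Let $r$ be the largest height of an edge of such a minimal polygon. If $r$ is large then the edge
  has width $n r$, and a shear moves it to $[-\alpha, n r - \alpha] \times \{-r\}$ with $0 < \alpha < r$.
  As no height exceeds $r$, the two neighbouring edges lean inwards, while $h_{\max} \ge r$ limits their slopes.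
  The few remaining configurations contradict the primitivity of the vertices and the fact that
  heights divide widths.

  Once all heights are at most $C$, the primitive lattice points of the polygon span a complete smooth
  fan. It contains rays $v, b, c$ with $\det(v, b) = 1$ and $b + c = s v$, $s \le 0$, and in the
  basis $v, b$ the edge normals, hence also the vertices, are bounded in terms of $C$.\<close>

section \<open>Edges of finite sets of lattice points\<close>

text \<open>Edges are treated on finite sets of integer points, so that normals, starting points and
  lengths are integers; a Fano polygon enters as the set of its lattice points. One obstacle is that
  a mutated point set can miss lattice points of its hull, so edges have to be shown to depend on
  the hull alone.

  The constant 2 \<nu> + 1 comes from pairing the depths j and r - j inside a residual cone of
  height r: one depth of each pair carries a residual point, so r - 1 \<le> 2 \<nu>. The bound
  survives mutation because an edge changes its length, if at all, by exactly its own height.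

  With H = 2 \<nu> + 1, an edge higher than H has a length divisible by its height, and this is what
  makes large heights rigid. The largest height r is used in two opposite ways: a point at height r
  prevents the sides next to the edge from converging too fast, and heights at most r force them to
  converge. What remains is a short list of slopes. The value 8 H + 8 is a convenient bound; the
  cases ask for r > 6 H and r > 4 H + 8.\<close>

text \<open>The pair \<open>(a, b)\<close> is the primitive inner normal, and the edge runs counterclockwise from
  \<open>(x, y)\<close> in \<open>k\<close> steps \<open>(b, - a)\<close>; its height is \<open>- (a * x + b * y)\<close>.\<close>

definition lattice_edge :: "(int \<times> int) set \<Rightarrow> int \<Rightarrow> int \<Rightarrow> int \<Rightarrow> int \<Rightarrow> int \<Rightarrow> bool" where
  "lattice_edge L a b x y k \<longleftrightarrow>
     coprime a b \<and> 0 < k \<and> (x, y) \<in> L \<and> (x + k * b, y - k * a) \<in> L \<and>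
     (\<forall>X Y. (X, Y) \<in> L \<longrightarrow> a * x + b * y \<le> a * X + b * Y \<and>
        (a * X + b * Y = a * x + b * y \<longrightarrow>
           (\<exists>s. 0 \<le> s \<and> s \<le> k \<and> X = x + s * b \<and> Y = y - s * a)))"

lemma lattice_edgeD:
  assumes "lattice_edge L a b x y k"
  shows "coprime a b" "0 < k" "(x, y) \<in> L" "(x + k * b, y - k * a) \<in> L"
  using assms by (auto simp: lattice_edge_def)

lemma lattice_edge_ge:
  assumes "lattice_edge L a b x y k" "(X, Y) \<in> L"
  shows "a * x + b * y \<le> a * X + b * Y"
  using assms by (auto simp: lattice_edge_def)

lemma lattice_edge_eq:
  assumes "lattice_edge L a b x y k" "(X, Y) \<in> L" "a * X + b * Y = a * x + b * y"
  obtains s where "0 \<le> s" "s \<le> k" "X = x + s * b" "Y = y - s * a"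
  using assms unfolding lattice_edge_def by blast

lemma lattice_edgeI:
  assumes "coprime a b" "0 < k" "(x, y) \<in> L" "(x + k * b, y - k * a) \<in> L"
    and "\<And>X Y. (X, Y) \<in> L \<Longrightarrow> a * x + b * y \<le> a * X + b * Y"
    and "\<And>X Y. (X, Y) \<in> L \<Longrightarrow> a * X + b * Y = a * x + b * y \<Longrightarrow>
           \<exists>s. 0 \<le> s \<and> s \<le> k \<and> X = x + s * b \<and> Y = y - s * a"
  shows "lattice_edge L a b x y k"
  using assms unfolding lattice_edge_def by blast

lemma coprime_orthogonal_int:
  fixes a b X Y :: int
  assumes "coprime a b" "a * X + b * Y = 0"
  obtains s where "X = s * b" "Y = - s * a"
proof -
  have "b * (- Y) = a * X" using assms(2) by (simp add: algebra_simps)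
  then have "b dvd a * X" by (metis dvd_triv_left)
  then have "b dvd X" using assms(1) by (simp add: coprime_commute coprime_dvd_mult_right_iff)
  then obtain s where s: "X = b * s" ..
  show thesis
  proof (cases "b = 0")
    case True
    then have "a = 1 \<or> a = - 1" using assms(1) by auto
    moreover have "X = 0" using True assms s by auto
    ultimately show thesis using True that[of "- Y * a"] by auto
  next
    case False
    have "b * (a * s + Y) = 0" using assms(2) s by (simp add: algebra_simps)
    then have "a * s + Y = 0" using False by simp
    then have "Y = - s * a" by (simp add: algebra_simps add_eq_0_iff2)
    then show thesis using s that[of s] by (simp add: mult.commute)
  qed
qed

text \<open>Here \<open>(a0, b0)\<close> supports \<open>L\<close> at \<open>(x, y)\<close>, and no point of its face lies ahead of \<open>(x, y)\<close> in
  the counterclockwise direction \<open>(b0, - a0)\<close>. The next edge maximises the slope relative to this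
  frame.\<close>

lemma next_edge:
  fixes a0 b0 :: real
  assumes fin: "finite L" and u: "(x, y) \<in> L"
    and nn: "\<And>X Y. (X, Y) \<in> L \<Longrightarrow> a0 * (X - x) + b0 * (Y - y) \<ge> 0"
    and eq: "\<And>X Y. (X, Y) \<in> L \<Longrightarrow> a0 * (X - x) + b0 * (Y - y) = 0 \<Longrightarrow>
               b0 * (X - x) - a0 * (Y - y) \<le> 0"
    and ex: "\<exists>X Y. (X, Y) \<in> L \<and> a0 * (X - x) + b0 * (Y - y) > 0"
  obtains a b k where "lattice_edge L a b x y k" "a0 * b - b0 * a > 0"
proof -
  define D where "D = (\<lambda>(X, Y). a0 * (real_of_int X - x) + b0 * (real_of_int Y - y))"
  define N where "N = (\<lambda>(X, Y). b0 * (real_of_int X - x) - a0 * (real_of_int Y - y))"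
  define S where "S = {v \<in> L. D v > 0}"
  have finS: "finite S" and neS: "S \<noteq> {}" using fin ex by (auto simp: S_def D_def)
  define m where "m = Max ((\<lambda>v. N v / D v) ` S)"
  have "m \<in> (\<lambda>v. N v / D v) ` S" unfolding m_def using finS neS by (intro Max_in) auto
  then obtain v where v: "v \<in> S" "N v / D v = m" by auto
  have mx: "N v' / D v' \<le> N v / D v" if "v' \<in> S" for v'
    unfolding v(2) unfolding m_def using finS that by (intro Max_ge) auto
  obtain xv yv where xy: "v = (xv, yv)" by fastforce
  define dX where "dX = xv - x"
  define dY where "dY = yv - y"
  have Dv: "D v > 0" using v by (simp add: S_def)
  have Dv': "a0 * dX + b0 * dY > 0" using Dv by (simp add: D_def xy dX_def dY_def)
  define g where "g = gcd dX dY"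
  have g0: "g > 0" using Dv' unfolding g_def
    by (metis gcd_eq_0_iff gcd_ge_0_int less_le mult_zero_right of_int_0 add.right_neutral less_irrefl)
  define b where "b = dX div g"
  define a where "a = - (dY div g)"
  have bg: "dX = g * b" and ag: "dY = - g * a" by (auto simp: a_def b_def g_def)
  have cop: "coprime a b" unfolding a_def b_def g_def
    using g0 div_gcd_coprime[of dX dY] unfolding g_def by (simp add: coprime_commute)
  have n0: "a0\<^sup>2 + b0\<^sup>2 > 0" using Dv' by (metis add.left_neutral less_irrefl mult_zero_left sum_power2_gt_zero_iff)
  have key: "dX * (Y - y) - dY * (X - x) \<ge> 0" if XY: "(X, Y) \<in> L" for X Y
  proof -
    \<comment> \<open>Cross-multiplied, the comparison of two slopes is the orientation of the two
      difference vectors, up to the squared length of (a0, b0). Maximal slope therefore means that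
      all of \<open>L\<close> lies to the left of the new edge.\<close>
    have id: "N v * D (X, Y) - N (X, Y) * D v = (a0\<^sup>2 + b0\<^sup>2) * (dX * (Y - y) - dY * (X - x))"
      unfolding N_def D_def xy dX_def dY_def by (simp add: power2_eq_square) algebra
    have "N v * D (X, Y) - N (X, Y) * D v \<ge> 0"
    proof (cases "D (X, Y) > 0")
      case True
      then have "N (X, Y) / D (X, Y) \<le> N v / D v" using XY by (intro mx) (auto simp: S_def)
      then show ?thesis using True Dv by (simp add: field_simps)
    next
      case False
      then have D0: "D (X, Y) = 0" using nn[OF XY] by (simp add: D_def)
      then have "N (X, Y) \<le> 0" using eq[OF XY] by (simp add: D_def N_def)
      then show ?thesis using D0 Dv by (simp add: mult_nonpos_nonneg)
    qed
    then have "0 \<le> (a0\<^sup>2 + b0\<^sup>2) * real_of_int (dX * (Y - y) - dY * (X - x))" using id by simp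
    then have "0 \<le> real_of_int (dX * (Y - y) - dY * (X - x))" using n0 by (simp add: zero_le_mult_iff)
    then show ?thesis by linarith
  qed
  have ge: "a * x + b * y \<le> a * X + b * Y" if "(X, Y) \<in> L" for X Y
  proof -
    have "g * (a * (X - x) + b * (Y - y)) \<ge> 0" using key[OF that] unfolding bg ag by (simp add: algebra_simps)
    then have "a * (X - x) + b * (Y - y) \<ge> 0" using g0 by (simp add: zero_le_mult_iff)
    then show ?thesis by (simp add: algebra_simps)
  qed
  have gw: "g * (a0 * b - b0 * a) > 0" using Dv' unfolding bg ag by (simp add: algebra_simps)
  then have w: "a0 * b - b0 * a > 0" using g0 by (simp add: zero_less_mult_iff)
  \<comment> \<open>Several points can attain the maximal slope, so the length is taken from the
    farthest point of \<open>L\<close> on the line and not from \<open>v\<close>.\<close>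
  define K where "K = {s. (x + s * b, y - s * a) \<in> L}"
  have inj: "inj_on (\<lambda>s. (x + s * b, y - s * a)) K" using cop by (auto simp: inj_on_def)
  have "finite ((\<lambda>s. (x + s * b, y - s * a)) ` K)" by (rule finite_subset[OF _ fin]) (auto simp: K_def)
  then have finK: "finite K" using inj by (simp add: finite_image_iff)
  have "xv = x + g * b" "yv = y - g * a" using bg ag by (auto simp: dX_def dY_def)
  then have gK: "g \<in> K" using v(1) by (simp add: K_def S_def xy)
  define k where "k = Max K"
  have kK: "k \<in> K" unfolding k_def using finK gK by (intro Max_in) auto
  have kg: "g \<le> k" unfolding k_def using finK gK by simp
  have "lattice_edge L a b x y k"
  proof (rule lattice_edgeI[OF cop _ u _ ge])
    show "0 < k" using kg g0 by linarith
    show "(x + k * b, y - k * a) \<in> L" using kK by (simp add: K_def)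
    fix X Y assume XY: "(X, Y) \<in> L" and "a * X + b * Y = a * x + b * y"
    then have "a * (X - x) + b * (Y - y) = 0" by (simp add: algebra_simps)
    then obtain s where s: "X - x = s * b" "Y - y = - s * a" using coprime_orthogonal_int[OF cop] by metis
    then have s': "X = x + s * b" "Y = y - s * a" by (auto simp: algebra_simps)
    have "s \<in> K" using XY s' by (simp add: K_def)
    then have "s \<le> k" unfolding k_def using finK by simp
    have "real_of_int X - x = s * b" "real_of_int Y - y = - s * a" using s' by simp_all
    then have "a0 * (real_of_int X - x) + b0 * (real_of_int Y - y) = a0 * (s * b) + b0 * (- s * a)" by simp
    then have "real_of_int s * (a0 * b - b0 * a) = a0 * (X - x) + b0 * (Y - y)" by (simp add: algebra_simps)
    then have "real_of_int s * (a0 * b - b0 * a) \<ge> 0" using nn[OF XY] by simp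
    then have "s \<ge> 0" using w by (simp add: zero_le_mult_iff)
    then show "\<exists>s. 0 \<le> s \<and> s \<le> k \<and> X = x + s * b \<and> Y = y - s * a" using s' \<open>s \<le> k\<close> by blast
  qed
  then show thesis using w that by blast
qed

section \<open>Mirror images and the preceding edge\<close>

definition reflect :: "int \<times> int \<Rightarrow> int \<times> int" where "reflect = (\<lambda>(x, y). (- x, y))"

lemma reflect_iff [simp]: "(x, y) \<in> reflect ` L \<longleftrightarrow> (- x, y) \<in> L"
  by (force simp: reflect_def image_iff)

lemma reflect_reflect [simp]: "reflect ` reflect ` L = L"
  by (auto simp: set_eq_iff)

text \<open>A reflection reverses the orientation, so the image of the end point becomes the
  starting point.\<close>

lemma lattice_edge_reflect:
  assumes e: "lattice_edge L a b x y k"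
  shows "lattice_edge (reflect ` L) (- a) b (- (x + k * b)) (y - k * a) k"
proof (rule lattice_edgeI)
  note [simp] = lattice_edgeD[OF e]
  show "coprime (- a) b" "0 < k" by auto
  show "(- (x + k * b), y - k * a) \<in> reflect ` L" using lattice_edgeD(4)[OF e] by (simp add: add.commute)
  show "(- (x + k * b) + k * b, y - k * a - k * - a) \<in> reflect ` L"
    using lattice_edgeD(3)[OF e] by simp
  fix X Y assume XY: "(X, Y) \<in> reflect ` L"
  then have XY': "(- X, Y) \<in> L" by simp
  show "- a * - (x + k * b) + b * (y - k * a) \<le> - a * X + b * Y"
    using lattice_edge_ge[OF e XY'] by (simp add: algebra_simps)
  assume "- a * X + b * Y = - a * - (x + k * b) + b * (y - k * a)"
  then have "a * (- X) + b * Y = a * x + b * y" by (simp add: algebra_simps)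
  then obtain s where "0 \<le> s" "s \<le> k" "- X = x + s * b" "Y = y - s * a" by (rule lattice_edge_eq[OF e XY'])
  then show "\<exists>s. 0 \<le> s \<and> s \<le> k \<and> X = - (x + k * b) + s * b \<and> Y = y - k * a - s * - a"
    by (intro exI[of _ "k - s"]) (auto simp: algebra_simps)
qed

lemma next_edge_int:
  fixes a0 b0 :: int
  assumes fin: "finite L" and u: "(x, y) \<in> L"
    and nn: "\<And>X Y. (X, Y) \<in> L \<Longrightarrow> a0 * x + b0 * y \<le> a0 * X + b0 * Y"
    and eq: "\<And>X Y. (X, Y) \<in> L \<Longrightarrow> a0 * X + b0 * Y = a0 * x + b0 * y \<Longrightarrow> b0 * X - a0 * Y \<le> b0 * x - a0 * y"
    and ex: "(X0, Y0) \<in> L" "a0 * x + b0 * y < a0 * X0 + b0 * Y0"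
  obtains a b k where "lattice_edge L a b x y k" "0 < a0 * b - b0 * a"
proof -
  have r: "real_of_int a0 * (real_of_int X - real_of_int x) + real_of_int b0 * (real_of_int Y - real_of_int y)
      = real_of_int (a0 * X + b0 * Y - (a0 * x + b0 * y))"
    "real_of_int b0 * (real_of_int X - real_of_int x) - real_of_int a0 * (real_of_int Y - real_of_int y)
      = real_of_int (b0 * X - a0 * Y - (b0 * x - a0 * y))" for X Y
    by (simp_all add: algebra_simps)
  have "\<exists>a b k. lattice_edge L a b x y k \<and> 0 < real_of_int a0 * b - real_of_int b0 * a"
    by (rule next_edge[OF fin u, of "real_of_int a0" "real_of_int b0"], unfold r of_int_0_le_iff of_int_0_less_iff of_int_le_0_iff of_int_eq_0_iff)
      (use nn eq ex in \<open>auto simp del: of_int_add of_int_diff of_int_mult\<close>)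
  then obtain a b k where e: "lattice_edge L a b x y k" and d: "0 < real_of_int a0 * b - real_of_int b0 * a" by blast
  have "0 < real_of_int (a0 * b - b0 * a)" using d by simp
  then show thesis using that[OF e] by (simp only: of_int_0_less_iff)
qed

text \<open>The edge that ends at a point is the mirror image of the next edge in the mirrored
  set.\<close>

lemma prev_edge:
  fixes a0 b0 :: int
  assumes fin: "finite L" and u: "(x, y) \<in> L"
    and nn: "\<And>X Y. (X, Y) \<in> L \<Longrightarrow> a0 * x + b0 * y \<le> a0 * X + b0 * Y"
    and eq: "\<And>X Y. (X, Y) \<in> L \<Longrightarrow> a0 * X + b0 * Y = a0 * x + b0 * y \<Longrightarrow> b0 * x - a0 * y \<le> b0 * X - a0 * Y"
    and ex: "(X0, Y0) \<in> L" "a0 * x + b0 * y < a0 * X0 + b0 * Y0"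
  obtains a b x' y' k where "lattice_edge L a b x' y' k" "0 < a * b0 - b * a0"
    "x = x' + k * b" "y = y' - k * a"
proof -
  obtain a b k where e: "lattice_edge (reflect ` L) a b (- x) y k" and d: "0 < (- a0) * b - b0 * a"
  proof (rule next_edge_int[where L = "reflect ` L" and x = "- x" and y = y and ?a0.0 = "- a0" and ?b0.0 = b0
        and ?X0.0 = "- X0" and ?Y0.0 = Y0])
    fix X Y assume "(X, Y) \<in> reflect ` L"
    then have XY: "(- X, Y) \<in> L" by simp
    show "- a0 * - x + b0 * y \<le> - a0 * X + b0 * Y" using nn[OF XY] by simp
    show "b0 * X - - a0 * Y \<le> b0 * - x - - a0 * y" if "- a0 * X + b0 * Y = - a0 * - x + b0 * y"
      using eq[OF XY] that by simp
  qed (use fin u ex that in auto)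
  have "lattice_edge L (- a) b (x - k * b) (y - k * a) k"
    using lattice_edge_reflect[OF e] by (simp add: algebra_simps)
  then show thesis by (rule that) (use d in \<open>auto simp: algebra_simps\<close>)
qed

lemma lattice_edge_predecessor:
  assumes fin: "finite L" and e: "lattice_edge L a b x y k"
    and X0: "(X0, Y0) \<in> L" "a * x + b * y < a * X0 + b * Y0"
  obtains a' b' x' y' k' where "lattice_edge L a' b' x' y' k'" "0 < a' * b - b' * a"
    "x = x' + k' * b'" "y = y' - k' * a'"
proof (rule prev_edge[OF fin lattice_edgeD(3)[OF e] lattice_edge_ge[OF e] _ X0])
  fix X Y assume "(X, Y) \<in> L" "a * X + b * Y = a * x + b * y"
  then obtain s where s: "0 \<le> s" "s \<le> k" "X = x + s * b" "Y = y - s * a" by (rule lattice_edge_eq[OF e])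
  have "b * X - a * Y = b * x - a * y + s * (a * a + b * b)" by (simp add: s algebra_simps)
  then show "b * x - a * y \<le> b * X - a * Y" using s(1) by simp
qed (assumption, erule (3) that)

section \<open>Unimodular changes of coordinates\<close>

definition lmap :: "int \<Rightarrow> int \<Rightarrow> int \<Rightarrow> int \<Rightarrow> int \<times> int \<Rightarrow> int \<times> int" where
  "lmap a b c d = (\<lambda>(x, y). (a * x + b * y, c * x + d * y))"

lemma lmap_apply [simp]: "lmap a b c d (x, y) = (a * x + b * y, c * x + d * y)"
  by (simp add: lmap_def)

lemma lmap_inverse:
  assumes "a * d - b * c = 1"
  shows "lmap d (- b) (- c) a (lmap a b c d v) = v"
proof -
  have "d * (a * x + b * y) + - b * (c * x + d * y) = (a * d - b * c) * x"
    "- c * (a * x + b * y) + a * (c * x + d * y) = (a * d - b * c) * y" for x y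
    by (simp_all add: algebra_simps)
  then show ?thesis using assms by (cases v) simp
qed

lemma lmap_image_inverse:
  assumes "a * d - b * c = 1"
  shows "lmap d (- b) (- c) a ` lmap a b c d ` L = L"
  by (simp add: image_image lmap_inverse[OF assms])

lemma coprime_lmap:
  fixes a b c d x y :: int
  assumes "a * d - b * c = 1" "coprime x y"
  shows "coprime (a * x + b * y) (c * x + d * y)"
proof (rule coprimeI)
  fix e assume "e dvd a * x + b * y" "e dvd c * x + d * y"
  then have "e dvd d * (a * x + b * y) - b * (c * x + d * y)" "e dvd a * (c * x + d * y) - c * (a * x + b * y)"
    by (auto intro: dvd_diff)
  moreover have "d * (a * x + b * y) - b * (c * x + d * y) = (a * d - b * c) * x"
    "a * (c * x + d * y) - c * (a * x + b * y) = (a * d - b * c) * y" by (simp_all add: algebra_simps)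
  ultimately show "is_unit e" using assms by (metis coprime_common_divisor mult_1)
qed

text \<open>Normals transform by the inverse transpose, which preserves the values of the functional
  and hence the heights. Determinant 1 preserves the orientation, and with it the roles of the two
  end points.\<close>

lemma lattice_edge_lmap:
  assumes det: "m1 * m4 - m2 * m3 = 1" and e: "lattice_edge L a b x y k"
  shows "lattice_edge (lmap m1 m2 m3 m4 ` L) (m4 * a - m3 * b) (m1 * b - m2 * a)
           (m1 * x + m2 * y) (m3 * x + m4 * y) k"
proof (rule lattice_edgeI)
  have pair: "(m4 * a - m3 * b) * (m1 * X + m2 * Y) + (m1 * b - m2 * a) * (m3 * X + m4 * Y)
      = (m1 * m4 - m2 * m3) * (a * X + b * Y)" for X Y by (simp add: algebra_simps)
  have "coprime (m4 * a + (- m3) * b) (- m2 * a + m1 * b)"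
    by (rule coprime_lmap) (use det lattice_edgeD(1)[OF e] in \<open>auto simp: algebra_simps\<close>)
  then show "coprime (m4 * a - m3 * b) (m1 * b - m2 * a)" by (simp add: algebra_simps)
  show "0 < k" using lattice_edgeD[OF e] by simp
  show "(m1 * x + m2 * y, m3 * x + m4 * y) \<in> lmap m1 m2 m3 m4 ` L"
    by (rule image_eqI[OF _ lattice_edgeD(3)[OF e]]) simp
  show "(m1 * x + m2 * y + k * (m1 * b - m2 * a), m3 * x + m4 * y - k * (m4 * a - m3 * b)) \<in> lmap m1 m2 m3 m4 ` L"
    by (rule image_eqI[OF _ lattice_edgeD(4)[OF e]]) (simp add: algebra_simps)
  fix X Y assume "(X, Y) \<in> lmap m1 m2 m3 m4 ` L"
  then obtain X' Y' where XY: "(X', Y') \<in> L" "X = m1 * X' + m2 * Y'" "Y = m3 * X' + m4 * Y'"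
    by (force simp: lmap_def)
  show "(m4 * a - m3 * b) * (m1 * x + m2 * y) + (m1 * b - m2 * a) * (m3 * x + m4 * y)
      \<le> (m4 * a - m3 * b) * X + (m1 * b - m2 * a) * Y"
    unfolding XY(2,3) pair det using lattice_edge_ge[OF e XY(1)] by simp
  assume "(m4 * a - m3 * b) * X + (m1 * b - m2 * a) * Y =
     (m4 * a - m3 * b) * (m1 * x + m2 * y) + (m1 * b - m2 * a) * (m3 * x + m4 * y)"
  then have "a * X' + b * Y' = a * x + b * y" unfolding XY(2,3) pair det by simp
  then obtain s where "0 \<le> s" "s \<le> k" "X' = x + s * b" "Y' = y - s * a" by (rule lattice_edge_eq[OF e XY(1)])
  then show "\<exists>s. 0 \<le> s \<and> s \<le> k \<and> X = m1 * x + m2 * y + s * (m1 * b - m2 * a) \<and>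
      Y = m3 * x + m4 * y - s * (m4 * a - m3 * b)"
    by (intro exI[of _ s]) (auto simp: XY algebra_simps)
qed

lemma lattice_edge_lmapE:
  assumes det: "m1 * m4 - m2 * m3 = 1" and e: "lattice_edge (lmap m1 m2 m3 m4 ` L) a b x y k"
  obtains a' b' x' y' where "lattice_edge L a' b' x' y' k"
    "a = m4 * a' - m3 * b'" "b = m1 * b' - m2 * a'" "x = m1 * x' + m2 * y'" "y = m3 * x' + m4 * y'"
proof -
  have det': "m4 * m1 - (- m2) * (- m3) = 1" using det by (simp add: algebra_simps)
  have e': "lattice_edge L (m1 * a - - m3 * b) (m4 * b - - m2 * a) (m4 * x + - m2 * y) (- m3 * x + m1 * y) k"
    using lattice_edge_lmap[OF det' e] by (simp only: lmap_image_inverse[OF det])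
  have "m4 * (m1 * a - - m3 * b) - m3 * (m4 * b - - m2 * a) = (m1 * m4 - m2 * m3) * a"
    "m1 * (m4 * b - - m2 * a) - m2 * (m1 * a - - m3 * b) = (m1 * m4 - m2 * m3) * b"
    "m1 * (m4 * x + - m2 * y) + m2 * (- m3 * x + m1 * y) = (m1 * m4 - m2 * m3) * x"
    "m3 * (m4 * x + - m2 * y) + m4 * (- m3 * x + m1 * y) = (m1 * m4 - m2 * m3) * y"
    by (simp_all add: algebra_simps)
  then show thesis by (intro that[OF e']) (simp_all add: det)
qed

lemma lmap_height:
  fixes a b x y :: int
  assumes "m1 * m4 - m2 * m3 = 1"
  shows "(m4 * a - m3 * b) * (m1 * x + m2 * y) + (m1 * b - m2 * a) * (m3 * x + m4 * y) = a * x + b * y"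
proof -
  have "(m4 * a - m3 * b) * (m1 * x + m2 * y) + (m1 * b - m2 * a) * (m3 * x + m4 * y)
      = (m1 * m4 - m2 * m3) * (a * x + b * y)" by (simp add: algebra_simps)
  then show ?thesis using assms by simp
qed

section \<open>Minimal configurations and the neighbours of a bottom edge\<close>

text \<open>The properties of a polygon of largest height \<open>r\<close> on which the height bound
  rests. An edge higher than \<open>H\<close> has no residual segment, which is the divisibility
  condition; the last condition says that no mutation at an edge at least as long as high is known
  to lose lattice points.\<close>

definition minimal_config :: "int \<Rightarrow> int \<Rightarrow> (int \<times> int) set \<Rightarrow> bool" where
  "minimal_config H r L \<longleftrightarrow> finite L \<and>
     (\<forall>a b x y k. lattice_edge L a b x y k \<longrightarrow>
        coprime x y \<and> coprime (x + k * b) (y - k * a) \<and>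
        0 < - (a * x + b * y) \<and> - (a * x + b * y) \<le> r \<and>
        (- (a * x + b * y) \<le> H \<or> - (a * x + b * y) dvd k) \<and>
        (- (a * x + b * y) \<le> k \<longrightarrow> (\<exists>X Y. (X, Y) \<in> L \<and> - (a * x + b * y) \<le> a * X + b * Y)))"

lemma minimal_configD:
  assumes "minimal_config H r L" "lattice_edge L a b x y k"
  shows "coprime x y" "coprime (x + k * b) (y - k * a)"
    "0 < - (a * x + b * y)" "- (a * x + b * y) \<le> r"
    "- (a * x + b * y) \<le> H \<or> - (a * x + b * y) dvd k"
    "- (a * x + b * y) \<le> k \<Longrightarrow> \<exists>X Y. (X, Y) \<in> L \<and> - (a * x + b * y) \<le> a * X + b * Y"
  using assms(1)[unfolded minimal_config_def, THEN conjunct2, THEN spec, THEN spec, THEN spec, THEN spec,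
      THEN spec, THEN mp, OF assms(2)] by auto

lemma minimal_config_long:
  assumes "minimal_config H r L" "lattice_edge L a b x y k" "H < - (a * x + b * y)"
  shows "- (a * x + b * y) dvd k" "- (a * x + b * y) \<le> k"
    "\<exists>X Y. (X, Y) \<in> L \<and> - (a * x + b * y) \<le> a * X + b * Y"
proof -
  show 1: "- (a * x + b * y) dvd k" using minimal_configD(5)[OF assms(1,2)] assms(3) by linarith
  show "- (a * x + b * y) \<le> k" by (rule zdvd_imp_le[OF 1 lattice_edgeD(2)[OF assms(2)]])
  then show "\<exists>X Y. (X, Y) \<in> L \<and> - (a * x + b * y) \<le> a * X + b * Y" by (rule minimal_configD(6)[OF assms(1,2)])
qed

lemma minimal_config_reflect:
  assumes c: "minimal_config H r L"
  shows "minimal_config H r (reflect ` L)"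
  unfolding minimal_config_def
proof (intro conjI allI impI)
  show "finite (reflect ` L)" using c by (simp add: minimal_config_def)
  fix a b x y k assume e: "lattice_edge (reflect ` L) a b x y k"
  have e': "lattice_edge L (- a) b (- (x + k * b)) (y - k * a) k"
    using lattice_edge_reflect[OF e] by simp
  have h: "- (- a * - (x + k * b) + b * (y - k * a)) = - (a * x + b * y)" by (simp add: algebra_simps)
  note d = minimal_configD[OF c e', unfolded h]
  show "coprime x y" using d(2) by simp
  show "coprime (x + k * b) (y - k * a)" using d(1) by (simp only: coprime_minus_left_iff)
  show "0 < - (a * x + b * y)" "- (a * x + b * y) \<le> r" "- (a * x + b * y) \<le> H \<or> - (a * x + b * y) dvd k"
    by (fact d)+
  assume "- (a * x + b * y) \<le> k"
  then obtain X Y where "(X, Y) \<in> L" "- (a * x + b * y) \<le> - a * X + b * Y" using d(6) by blast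
  then show "\<exists>X Y. (X, Y) \<in> reflect ` L \<and> - (a * x + b * y) \<le> a * X + b * Y"
    by (intro exI[of _ "- X"] exI[of _ Y]) auto
qed

lemma minimal_config_lmap:
  assumes det: "m1 * m4 - m2 * m3 = 1" and c: "minimal_config H r L"
  shows "minimal_config H r (lmap m1 m2 m3 m4 ` L)"
  unfolding minimal_config_def
proof (intro conjI allI impI)
  show "finite (lmap m1 m2 m3 m4 ` L)" using c by (simp add: minimal_config_def)
  fix a b x y k assume "lattice_edge (lmap m1 m2 m3 m4 ` L) a b x y k"
  then obtain a' b' x' y' where e: "lattice_edge L a' b' x' y' k"
    and *: "a = m4 * a' - m3 * b'" "b = m1 * b' - m2 * a'" "x = m1 * x' + m2 * y'" "y = m3 * x' + m4 * y'"
    by (rule lattice_edge_lmapE[OF det])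
  note d = minimal_configD[OF c e]
  have h: "a * x + b * y = a' * x' + b' * y'" unfolding * by (rule lmap_height[OF det])
  show "coprime x y" using coprime_lmap[OF det d(1)] by (simp add: *)
  have "x + k * b = m1 * (x' + k * b') + m2 * (y' - k * a')" "y - k * a = m3 * (x' + k * b') + m4 * (y' - k * a')"
    by (simp_all add: * algebra_simps)
  then show "coprime (x + k * b) (y - k * a)" using coprime_lmap[OF det d(2)] by simp
  show "0 < - (a * x + b * y)" "- (a * x + b * y) \<le> r" "- (a * x + b * y) \<le> H \<or> - (a * x + b * y) dvd k"
    unfolding h by (fact d)+
  assume "- (a * x + b * y) \<le> k"
  then obtain X Y where XY: "(X, Y) \<in> L" "- (a * x + b * y) \<le> a' * X + b' * Y" using d(6) h by auto
  show "\<exists>X Y. (X, Y) \<in> lmap m1 m2 m3 m4 ` L \<and> - (a * x + b * y) \<le> a * X + b * Y"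
  proof (intro exI conjI)
    show "(m1 * X + m2 * Y, m3 * X + m4 * Y) \<in> lmap m1 m2 m3 m4 ` L" by (rule image_eqI[OF _ XY(1)]) simp
    show "- (a * x + b * y) \<le> a * (m1 * X + m2 * Y) + b * (m3 * X + m4 * Y)"
      using XY(2) unfolding *(1,2) lmap_height[OF det] .
  qed
qed

text \<open>Evaluated at the common vertex, the height of the preceding edge is
  \<open>i * \<alpha> - q * r\<close>. A negative \<open>q\<close> would make it exceed
  \<open>r\<close>, so the edge is vertical or leans inwards.\<close>

lemma left_edge:
  assumes c: "minimal_config H r L" and e: "lattice_edge L 0 1 (- \<alpha>) (- r) k" and \<alpha>: "0 < \<alpha>"
    and top: "(X0, Y0) \<in> L" "- r < Y0"
  obtains i q x y l where "lattice_edge L i (- q) x y l" "0 < i" "0 \<le> q" "coprime i q"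
    "x = - \<alpha> + l * q" "y = - r + l * i" "0 < i * \<alpha> - q * r" "i * \<alpha> - q * r \<le> r"
    "- (i * x + - q * y) = i * \<alpha> - q * r"
proof -
  have "finite L" using c by (simp add: minimal_config_def)
  moreover have "0 * - \<alpha> + 1 * - r < 0 * X0 + 1 * Y0" using top(2) by simp
  ultimately obtain a b x y l where f: "lattice_edge L a b x y l" and a': "0 < a * 1 - b * 0"
    and xy: "- \<alpha> = x + l * b" "- r = y - l * a"
    by (rule lattice_edge_predecessor[OF _ e top(1)])
  have a: "a > 0" using a' by simp
  define q where "q = - b"
  have h: "- (a * x + b * y) = a * \<alpha> - q * r"
  proof -
    have "a * x + b * y = a * (x + l * b) + b * (y - l * a)" by (simp add: algebra_simps)
    also have "\<dots> = a * - \<alpha> + b * - r" using xy by simp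
    finally show ?thesis by (simp add: q_def)
  qed
  note d = minimal_configD[OF c f, unfolded h]
  have q: "q \<ge> 0"
  proof (rule ccontr)
    assume "\<not> q \<ge> 0"
    then have "q \<le> - 1" by simp
    then have "q * r \<le> - 1 * r" using d(3,4) by (intro mult_right_mono) auto
    moreover have "0 < a * \<alpha>" using a \<alpha> by simp
    ultimately show False using d(4) by linarith
  qed
  show thesis
  proof (rule that[of a q x y l])
    show "lattice_edge L a (- q) x y l" using f by (simp add: q_def)
    show "coprime a q" using lattice_edgeD(1)[OF f] by (simp add: q_def)
    show "x = - \<alpha> + l * q" "y = - r + l * a" using xy by (simp_all add: q_def)
    show "- (a * x + - q * y) = a * \<alpha> - q * r" using h by (simp add: q_def)
  qed (use a q d in auto)
qed

lemma right_edge: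
  assumes c: "minimal_config H r L" and e: "lattice_edge L 0 1 (\<beta> - k) (- r) k" and \<beta>: "0 < \<beta>"
    and top: "(X0, Y0) \<in> L" "- r < Y0"
  obtains p t l where "lattice_edge L (- p) (- t) \<beta> (- r) l" "0 < p" "0 \<le> t" "coprime p t"
    "0 < p * \<beta> - t * r" "p * \<beta> - t * r \<le> r"
proof -
  have e': "lattice_edge (reflect ` L) 0 1 (- \<beta>) (- r) k"
    using lattice_edge_reflect[OF e] by simp
  have top': "(- X0, Y0) \<in> reflect ` L" using top by simp
  obtain p t x y l where f: "lattice_edge (reflect ` L) p (- t) x y l" and *: "0 < p" "0 \<le> t" "coprime p t"
    "x = - \<beta> + l * t" "y = - r + l * p" "0 < p * \<beta> - t * r" "p * \<beta> - t * r \<le> r"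
    by (rule left_edge[OF minimal_config_reflect[OF c] e' \<beta> top' top(2)])
  have "lattice_edge L (- p) (- t) \<beta> (- r) l"
    using lattice_edge_reflect[OF f] by (simp add: *(4,5))
  then show thesis using * that by blast
qed

section \<open>Heights of minimal configurations\<close>

lemma coprime_dvd_double:
  fixes d r :: int
  assumes "coprime d r" "d dvd 2 * r" "0 < d"
  shows "d \<le> 2"
proof -
  have "d dvd 2" using assms(1,2) coprime_dvd_mult_left_iff by blast
  then show ?thesis by (simp add: zdvd_imp_le)
qed

lemma coprime_double_le:
  fixes d r :: int
  assumes "coprime d r" "2 * d = r" "0 < d"
  shows "r \<le> 2"
proof -
  have "is_unit d" using assms(1,2) by (metis coprime_common_divisor dvd_refl dvd_triv_right)
  then show ?thesis using assms by auto
qed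

text \<open>The configuration that inequalities between slopes alone do not exclude. The right edge
  has height \<beta> = r - \<alpha>; if this exceeds \<open>H\<close>, minimality asks for a point
  equally far to the left of the origin, so \<beta> \<le> \<alpha>. Divisibility and primitivity
  then remove one type of left edge after the other.\<close>

lemma vertical_right_edge_False:
  assumes c: "minimal_config H r L" and H: "0 \<le> H" and r: "8 * H + 8 < r"
    and e: "lattice_edge L 0 1 (- \<alpha>) (- r) r" and \<alpha>: "0 < \<alpha>" "\<alpha> < r"
    and right: "lattice_edge L (- 1) 0 (r - \<alpha>) (- r) k"
  shows False
proof -
  define \<beta> where "\<beta> = r - \<alpha>"
  have \<beta>: "0 < \<beta>" "\<beta> < r" using \<alpha> by (auto simp: \<beta>_def)
  have right: "lattice_edge L (- 1) 0 \<beta> (- r) k" using right by (simp add: \<beta>_def)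
  have Xle: "X \<le> \<beta>" if "(X, Y) \<in> L" for X Y using lattice_edge_ge[OF right that] by simp
  have Yge: "- r \<le> Y" if "(X, Y) \<in> L" for X Y using lattice_edge_ge[OF e that] by simp
  obtain Xt Yt where top: "(Xt, Yt) \<in> L" "r \<le> Yt" using minimal_configD(6)[OF c e] by auto
  have cop\<alpha>: "coprime \<alpha> r" using minimal_configD(1)[OF c e] by simp
  have cop\<beta>: "coprime \<beta> r" using minimal_configD(1)[OF c right] by simp
  obtain i q x y l where left: "lattice_edge L i (- q) x y l" and i: "0 < i" and q: "0 \<le> q" and copiq: "coprime i q"
    and xy: "x = - \<alpha> + l * q" "y = - r + l * i" and lam: "0 < i * \<alpha> - q * r" "i * \<alpha> - q * r \<le> r"
    and h: "- (i * x + - q * y) = i * \<alpha> - q * r"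
    by (rule left_edge[OF c e \<alpha>(1) top(1)]) (use top(2) r H in linarith)
  have l0: "0 < l" using lattice_edgeD[OF left] by simp
  have xyL: "(x, y) \<in> L" using lattice_edgeD[OF left] by simp
  have Lge: "- i * \<alpha> + q * r \<le> i * X - q * Y" if "(X, Y) \<in> L" for X Y
    using lattice_edge_ge[OF left that] h by simp
  \<comment> \<open>The left edge must not reach the line \<open>X = \<beta>\<close> below the height \<open>r\<close>.\<close>
  have iq: "2 * q \<le> i"
  proof -
    have "i * Xt \<le> i * \<beta>" using Xle[OF top(1)] i by simp
    moreover have "q * r \<le> q * Yt" using top(2) q by (rule mult_left_mono)
    ultimately have "2 * q * r \<le> i * r" using Lge[OF top(1)] by (simp add: \<beta>_def algebra_simps)
    then show ?thesis using r H by simp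
  qed
  have Xge: "- \<alpha> \<le> X" if "(X, Y) \<in> L" for X Y
  proof -
    have "q * - r \<le> q * Y" using Yge[OF that] q by (rule mult_left_mono)
    then have "i * - \<alpha> \<le> i * X" using Lge[OF that] by (simp add: algebra_simps)
    then show ?thesis using i by (simp only: mult_le_cancel_left_pos)
  qed
  have \<beta>long: "\<beta> \<le> \<alpha>" if "H < \<beta>"
  proof -
    have "\<exists>X Y. (X, Y) \<in> L \<and> \<beta> \<le> - X" using minimal_config_long(3)[OF c right] that by auto
    then obtain X Y where "(X, Y) \<in> L" "\<beta> \<le> - X" by blast
    then show ?thesis using Xge[of X Y] by linarith
  qed
  have "i = 1 \<or> i = 2 \<and> q = 1 \<or> 3 \<le> i \<and> 1 \<le> q"
  proof (cases "q = 0")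
    case True
    then show ?thesis using copiq i by simp
  next
    case False
    then show ?thesis using iq q by presburger
  qed
  then consider "i = 1" | "i = 2" "q = 1" | "3 \<le> i" "1 \<le> q" by blast
  then show False
  proof cases
    \<comment> \<open>Both sides are vertical, with heights \<alpha> and \<beta> of sum
      \<open>r\<close>. A height above \<open>H\<close> is at most the other one, so both are equal,
      and r = 2 \<alpha> contradicts primitivity of the vertex.\<close>
    case 1
    then have q0: "q = 0" using iq q by linarith
    have h': "- (i * x + - q * y) = \<alpha>" using h 1 q0 by simp
    have \<alpha>long: "\<alpha> \<le> \<beta>" if "H < \<alpha>"
    proof -
      have "H < - (i * x + - q * y)" using that h' by simp
      from minimal_config_long(3)[OF c left this] obtain X Y where "(X, Y) \<in> L" "\<alpha> \<le> X" using h' 1 q0 by auto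
      then show ?thesis using Xle[of X Y] by linarith
    qed
    have "\<alpha> = \<beta>" using \<alpha>long \<beta>long r H by (cases "H < \<alpha>"; cases "H < \<beta>") (auto simp: \<beta>_def)
    then have "2 * \<alpha> = r" by (simp add: \<beta>_def)
    then show False using coprime_double_le[OF cop\<alpha>] \<alpha> r H by simp
  next
    \<comment> \<open>The line of the left edge meets \<open>X = \<beta>\<close> exactly at height
      \<open>r\<close>, so the polygon is a triangle whose sides have lengths 2 r and r.
      Divisibility on the right makes \<beta> small; on the left it makes r - 2 \<beta> a divisor of
      r, hence of 2 \<beta>, which is too small for that.\<close>
    case 2
    have tX: "Xt = \<beta>" and tY: "Yt = r"
      using Lge[OF top(1)] Xle[OF top(1)] top(2) unfolding 2 \<beta>_def by linarith+
    have Yle: "Y \<le> r" if "(X, Y) \<in> L" for X Y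
      using Lge[OF that] Xle[OF that] unfolding 2 \<beta>_def by linarith
    have tL: "(\<beta>, r) \<in> L" using top tX tY by simp
    have "- 1 * \<beta> + 0 * r = - 1 * \<beta> + 0 * - r" by simp
    then obtain s where s: "0 \<le> s" "s \<le> k" "\<beta> = \<beta> + s * 0" "r = - r - s * - 1" by (rule lattice_edge_eq[OF right tL])
    have "- r - k * - 1 \<le> r" by (rule Yle[OF lattice_edgeD(4)[OF right]])
    then have k: "k = 2 * r" using s by simp
    have \<beta>le: "\<beta> \<le> H + 2"
    proof (cases "H < \<beta>")
      case True
      then have "\<beta> dvd 2 * r" using minimal_config_long(1)[OF c right] k by simp
      then have "\<beta> \<le> 2" using coprime_dvd_double[OF cop\<beta>] \<beta> by simp
      then show ?thesis using H by simp
    qed (use H in simp)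
    have "i * \<beta> + - q * r = i * x + - q * y" using h unfolding 2 \<beta>_def by simp
    then obtain s where s: "0 \<le> s" "s \<le> l" "\<beta> = x + s * - q" "r = y - s * i" by (rule lattice_edge_eq[OF left tL])
    have "x \<le> \<beta>" using Xle[OF xyL] .
    then have "x = \<beta>" using s 2 by simp
    then have l: "l = r" using xy 2 by (simp add: \<beta>_def)
    have "H < - (i * x + - q * y)" using h \<beta>le r H unfolding 2 \<beta>_def by simp
    from minimal_config_long(1)[OF c left this] have "r - 2 * \<beta> dvd r" using h 2 l by (simp add: \<beta>_def)
    then have "r - 2 * \<beta> dvd r - (r - 2 * \<beta>)" by (intro dvd_diff dvd_refl)
    moreover have "r - (r - 2 * \<beta>) = 2 * \<beta>" by simp
    ultimately have "r - 2 * \<beta> dvd 2 * \<beta>" by (simp only:)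
    then have "r - 2 * \<beta> \<le> 2 * \<beta>" by (rule zdvd_imp_le) (use \<beta> in simp)
    then show False using \<beta>le r H by linarith
  next
    \<comment> \<open>If \<beta> were at most \<open>H\<close>, then \<alpha> would be close to
      \<open>r\<close> and the left height would exceed \<open>r\<close>. So 2 \<alpha> > r, and the
      bound on the left height leaves only \<open>i = 2 * q + 1\<close>.\<close>
    case 3
    have \<beta>H: "H < \<beta>"
    proof (rule ccontr)
      assume "\<not> H < \<beta>"
      then have "i * (r - H) \<le> i * \<alpha>" using i by (simp add: \<beta>_def)
      then have "2 * (i * (r - H)) \<le> 2 * r + 2 * q * r" using lam(2) by (simp add: algebra_simps)
      also have "2 * q * r \<le> i * r" using iq r H by (intro mult_right_mono) auto
      finally have 1: "i * (r - 2 * H) \<le> 2 * r" by (simp add: algebra_simps)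
      have "3 * (r - 2 * H) \<le> i * (r - 2 * H)" using 3 r H by (intro mult_right_mono) auto
      from order_trans[OF this 1] show False using r H by simp
    qed
    then have \<beta>\<alpha>: "\<beta> \<le> \<alpha>" by (rule \<beta>long)
    then have r2: "r \<le> 2 * \<alpha>" by (simp add: \<beta>_def)
    have r2': "r \<noteq> 2 * \<alpha>" using coprime_double_le[OF cop\<alpha>] \<alpha> r H by auto
    have a1: "i * r \<le> i * (2 * \<alpha>)" using r2 i by (intro mult_left_mono) auto
    have a2: "i * (2 * \<alpha>) \<le> (2 * q + 2) * r" using lam(2) by (simp add: algebra_simps)
    have "i \<le> 2 * q + 2" using order_trans[OF a1 a2] r H by simp
    moreover have "i \<noteq> 2 * q + 2"
    proof
      assume "i = 2 * q + 2"
      then have "i * (2 * \<alpha>) \<le> i * r" using a2 by simp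
      then have "2 * \<alpha> \<le> r" using i by (simp only: mult_le_cancel_left_pos)
      then show False using r2 r2' by simp
    qed
    moreover have "i \<noteq> 2 * q"
    proof
      assume "i = 2 * q"
      then have "is_unit q" using copiq by (metis coprime_common_divisor dvd_refl dvd_triv_right)
      then show False using 3 q \<open>i = 2 * q\<close> by simp
    qed
    ultimately have i2q: "i = 2 * q + 1" using iq by linarith
    define \<mu> where "\<mu> = i * \<alpha> - q * r"
    have h\<mu>: "- (i * x + - q * y) = \<mu>" using h by (simp add: \<mu>_def)
    have "(2 * q + 1) * r < (2 * q + 1) * (2 * \<alpha>)" using r2 r2' q by (intro mult_strict_left_mono) auto
    then have \<mu>r: "r < 2 * \<mu>" by (simp add: \<mu>_def i2q algebra_simps)
    \<comment> \<open>The left height exceeds r / 2, so the edge is at least that long. It moves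
      \<open>q\<close> to the right per unit of length within a strip of width \<open>r\<close>,
      which leaves room for \<open>q = 1\<close> and a length of exactly one height.\<close>
    have "H < - (i * x + - q * y)" using \<mu>r r H h\<mu> by linarith
    note long = minimal_config_long(1,2)[OF c left this, unfolded h\<mu>]
    have lq: "l * q \<le> r" using Xle[OF xyL] xy by (simp add: \<beta>_def)
    have "\<mu> * q \<le> l * q" using long(2) q by (intro mult_right_mono) auto
    then have "\<mu> * q \<le> r" using lq by simp
    have q1: "q = 1"
    proof (rule ccontr)
      assume "q \<noteq> 1"
      then have "\<mu> * 2 \<le> \<mu> * q" using 3 \<mu>r r H by (intro mult_left_mono) auto
      then show False using \<open>\<mu> * q \<le> r\<close> \<mu>r by linarith
    qed
    have i3: "i = 3" using q1 i2q by simp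
    have \<mu>eq: "\<mu> = 3 * \<alpha> - r" by (simp add: \<mu>_def q1 i3)
    obtain m where m: "l = \<mu> * m" using long(1) ..
    have "m = 1"
    proof (rule ccontr)
      assume "m \<noteq> 1"
      moreover have "0 < m" using m l0 \<mu>r r H by (simp add: zero_less_mult_iff)
      ultimately have "\<mu> * 2 \<le> \<mu> * m" using \<mu>r r H by (intro mult_left_mono) auto
      then show False using m lq q1 \<mu>r by simp
    qed
    then have x: "x = 2 * \<alpha> - r" and y: "y = 9 * \<alpha> - 4 * r" using xy m \<mu>eq q1 i3 by auto
    have \<alpha>3: "3 * \<alpha> < 2 * r"
    proof -
      have "3 * \<alpha> \<noteq> 2 * r"
      proof
        assume "3 * \<alpha> = 2 * r"
        then have "\<alpha> dvd 2 * r" by (metis dvd_triv_right)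
        then have "\<alpha> \<le> 2" using coprime_dvd_double[OF cop\<alpha>] \<alpha> by simp
        then show False using r2 r H by simp
      qed
      then show ?thesis using lam(2) by (simp add: q1 i3)
    qed
    \<comment> \<open>The only case left has normal \<open>(3, - 1)\<close>; the edge that ends at the top of the left edge is too
      long to fit under \<open>X \<le> \<beta>\<close>.\<close>
    have "finite L" using c by (simp add: minimal_config_def)
    moreover have "i * x + - q * y < i * \<beta> + - q * - r"
      using \<alpha> \<alpha>3 by (simp add: q1 i3 x y \<beta>_def)
    ultimately obtain a b x2 y2 k2 where f: "lattice_edge L a b x2 y2 k2"
      and det: "0 < a * - q - b * i" and xy2: "x = x2 + k2 * b" "y = y2 - k2 * a"
      by (rule lattice_edge_predecessor[OF _ left lattice_edgeD(3)[OF right]])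
    have det: "3 * b + a < 0" using det by (simp add: q1 i3)
    define q2 where "q2 = - b"
    have aq2: "a \<le> 3 * q2 - 1" using det by (simp add: q2_def)
    have eqh: "a * x2 + b * y2 = a * x + b * y" unfolding xy2 by (simp add: algebra_simps)
    have q2pos: "1 \<le> q2"
    proof (rule ccontr)
      assume n: "\<not> 1 \<le> q2"
      then have "a < 0" using aq2 by simp
      have "a * x2 + b * y2 \<le> a * \<beta> + b * - r" using lattice_edge_ge[OF f lattice_edgeD(3)[OF right]] .
      then have "a * x + b * y \<le> a * \<beta> + b * - r" unfolding eqh .
      then have "0 \<le> a * (\<beta> - x) + q2 * (y + r)" by (simp add: q2_def algebra_simps)
      moreover have "a * (\<beta> - x) < 0" using \<open>a < 0\<close> \<alpha>3 by (intro mult_neg_pos) (auto simp: x \<beta>_def)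
      moreover have "q2 * (y + r) \<le> 0" using n \<mu>r \<mu>eq r H by (intro mult_nonpos_nonneg) (auto simp: y)
      ultimately show False by linarith
    qed
    define h2 where "h2 = - (a * x2 + b * y2)"
    have h2: "h2 = q2 * (9 * \<alpha> - 4 * r) - a * (2 * \<alpha> - r)"
      unfolding h2_def eqh x y by (simp add: q2_def algebra_simps)
    have h2r: "h2 \<le> r" unfolding h2_def by (rule minimal_configD(4)[OF c f])
    have ar: "a * (2 * \<alpha> - r) \<le> (3 * q2 - 1) * (2 * \<alpha> - r)" using aq2 r2 by (intro mult_right_mono) auto
    have "q2 * \<mu> \<le> h2" using ar r2 unfolding h2 \<mu>eq by (simp add: algebra_simps)
    have q2: "q2 = 1"
    proof (rule ccontr)
      assume "q2 \<noteq> 1"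
      then have "2 * \<mu> \<le> q2 * \<mu>" using q2pos \<mu>r r H by (intro mult_right_mono) auto
      then show False using \<open>q2 * \<mu> \<le> h2\<close> h2r \<mu>r by linarith
    qed
    have "H < h2" using \<open>q2 * \<mu> \<le> h2\<close> q2 \<mu>r r H by simp
    then have "h2 \<le> k2" using minimal_config_long(2)[OF c f] by (simp add: h2_def)
    moreover have "x2 \<le> \<beta>" by (rule Xle[OF lattice_edgeD(3)[OF f]])
    ultimately have "h2 \<le> 2 * r - 3 * \<alpha>" using xy2(1) x q2 by (simp add: q2_def \<beta>_def)
    moreover have "5 * \<alpha> - 2 * r \<le> h2" using ar unfolding h2 q2 by simp
    ultimately show False using r2 r2' by linarith
  qed
qed

text \<open>The sides have normals (i, - q) and (- p, - t), and the bottom has width n r. Divided by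
  i p, fact \<open>1\<close> reads 2 (q/i + t/p) \<le> n and comes from a point at height
  \<open>r\<close>, while fact \<open>2\<close> reads n \<le> q/i + t/p + 1/i + 1/p and comes from
  the height bound on both sides. Together they give n \<le> 2/i + 2/p.\<close>

lemma bottom_edge_False:
  assumes c: "minimal_config H r L" and H: "0 \<le> H" and r: "8 * H + 8 < r"
    and e: "lattice_edge L 0 1 (- \<alpha>) (- r) k" and \<alpha>: "0 < \<alpha>" "\<alpha> < r"
  shows False
proof -
  have "H < - (0 * - \<alpha> + 1 * - r)" using r H by simp
  from minimal_config_long[OF c e this]
  have rk: "r dvd k" "r \<le> k" and "\<exists>X Y. (X, Y) \<in> L \<and> r \<le> Y" by auto
  then obtain Xt Yt where top: "(Xt, Yt) \<in> L" "r \<le> Yt" by blast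
  have top': "- r < Yt" using top(2) r H by linarith
  obtain n where n: "k = r * n" using rk(1) ..
  have n1: "1 \<le> n" using n rk(2) r H by (simp add: mult_le_cancel_left1)
  define \<beta> where "\<beta> = k - \<alpha>"
  have \<beta>n: "\<beta> = n * r - \<alpha>" by (simp add: \<beta>_def n mult.commute)
  have \<beta>: "0 < \<beta>" using \<alpha> rk(2) by (simp add: \<beta>_def)
  have cop\<alpha>: "coprime \<alpha> r" using minimal_configD(1)[OF c e] by simp
  have cop\<beta>: "coprime \<beta> r" using minimal_configD(2)[OF c e] by (simp add: \<beta>_def)
  obtain i q x y l where left: "lattice_edge L i (- q) x y l" and i: "0 < i" and q: "0 \<le> q" and copiq: "coprime i q"
    and xy: "x = - \<alpha> + l * q" "y = - r + l * i" and lam: "0 < i * \<alpha> - q * r" "i * \<alpha> - q * r \<le> r"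
    and h: "- (i * x + - q * y) = i * \<alpha> - q * r"
    by (rule left_edge[OF c e \<alpha>(1) top(1) top'])
  have e': "lattice_edge L 0 1 (\<beta> - k) (- r) k" using e by (simp add: \<beta>_def)
  obtain p t l' where right: "lattice_edge L (- p) (- t) \<beta> (- r) l'" and p: "0 < p" and t: "0 \<le> t" and coppt: "coprime p t"
    and rho: "0 < p * \<beta> - t * r" "p * \<beta> - t * r \<le> r"
    by (rule right_edge[OF c e' \<beta> top(1) top'])
  have Lge: "- i * \<alpha> + q * r \<le> i * X - q * Y" if "(X, Y) \<in> L" for X Y
    using lattice_edge_ge[OF left that] h by simp
  have Rge: "p * X + t * Y \<le> p * \<beta> - t * r" if "(X, Y) \<in> L" for X Y
    using lattice_edge_ge[OF right that] by simp
  have r0: "0 < r" using r H by simp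
  \<comment> \<open>The lines through the left and the right edge still leave room for a point at height \<open>r\<close>.\<close>
  have 1: "2 * (p * q + i * t) \<le> i * p * n"
  proof -
    have "i * (p * Xt + t * Yt) \<le> i * (p * \<beta> - t * r)" using Rge[OF top(1)] i by simp
    moreover have "p * (- i * \<alpha> + q * r) \<le> p * (i * Xt - q * Yt)" using Lge[OF top(1)] p by simp
    ultimately have "(p * q + i * t) * (r + Yt) \<le> i * p * n * r" unfolding \<beta>n by (simp add: algebra_simps)
    moreover have "(p * q + i * t) * (r + r) \<le> (p * q + i * t) * (r + Yt)"
      using top(2) p i q t by (intro mult_left_mono) auto
    ultimately have "2 * (p * q + i * t) * r \<le> i * p * n * r" by (simp add: algebra_simps)
    then show ?thesis using r0 by simp
  qed
  have p\<beta>: "p * \<beta> \<le> (t + 1) * r" and i\<alpha>: "i * \<alpha> \<le> (q + 1) * r" using rho lam by (simp_all add: algebra_simps)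
  have a: "i * (p * \<beta>) \<le> i * ((t + 1) * r)" "p * (i * \<alpha>) \<le> p * ((q + 1) * r)" using p\<beta> i\<alpha> i p by auto
  have b: "i * (p * \<beta>) + p * (i * \<alpha>) = (i * p * n) * r" unfolding \<beta>n by (simp add: algebra_simps)
  have d: "i * ((t + 1) * r) + p * ((q + 1) * r) = (i * t + p * q + i + p) * r" by (simp add: algebra_simps)
  have "(i * p * n) * r \<le> (i * t + p * q + i + p) * r" using a b d by linarith
  then have 2: "i * p * n \<le> i * t + p * q + i + p" using r0 by simp
  \<comment> \<open>Equality in \<open>2\<close> is possible only if the height bounds are attained;
    here this says that the right height is exactly \<open>r\<close>.\<close>
  have two_eq: "p * \<beta> = (t + 1) * r" if "i * p * n = i * t + p * q + i + p"
  proof -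
    have "i * (p * \<beta>) + p * (i * \<alpha>) = i * ((t + 1) * r) + p * ((q + 1) * r)" unfolding b d that ..
    then have "i * (p * \<beta>) = i * ((t + 1) * r)" using a by linarith
    then show "p * \<beta> = (t + 1) * r" using i by simp
  qed
  have 3: "i * p * n \<le> 2 * (i + p)" using 1 2 by (simp add: algebra_simps)
  \<comment> \<open>The slopes force the triangle with vertices (- \<alpha>, - r), (2 r - \<alpha>,
    - r) and (- \<alpha>, r), all of whose edges have length 2 r. The heights \<alpha> and r -
    \<alpha> are coprime to r, so each one above \<open>H\<close> divides 2 and both are small,
    although their sum is r.\<close>
  have triangle: False if n2: "n = 2" and p1: "p = 1"
  proof -
    have tr: "t * r < 2 * r - \<alpha>" "2 * r - \<alpha> \<le> t * r + r"
      using rho p\<beta> unfolding \<beta>n n2 p1 by (simp_all add: algebra_simps)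
    have "t * r < 2 * r" "0 * r < t * r" using tr \<alpha> by linarith+
    then have "t < 2" "0 < t" using mult_right_less_imp_less[OF _ less_imp_le[OF r0]] by blast+
    then have t1: "t = 1" by simp
    have "q = 0" using 1 q unfolding n2 p1 t1 by simp
    then have i1: "i = 1" using copiq i by simp
    note [simp] = n2 p1 t1 i1 \<open>q = 0\<close>
    have L1: "- \<alpha> \<le> X" and L2: "X + Y \<le> r - \<alpha>" if "(X, Y) \<in> L" for X Y
      using Lge[OF that] Rge[OF that] by (simp_all add: \<beta>n)
    have "Xt = - \<alpha>" "Yt = r" using L1[OF top(1)] L2[OF top(1)] top(2) by linarith+
    then have tL: "(- \<alpha>, r) \<in> L" using top(1) by simp
    have Yle: "Y \<le> r" if "(X, Y) \<in> L" for X Y using L1[OF that] L2[OF that] by linarith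
    have xy': "x = - \<alpha>" "y = - r + l" using xy by simp_all
    have "i * - \<alpha> + - q * r = i * x + - q * y" by (simp add: xy')
    then obtain s where s: "0 \<le> s" "s \<le> l" "- \<alpha> = x + s * - q" "r = y - s * i" by (rule lattice_edge_eq[OF left tL])
    have "y \<le> r" by (rule Yle[OF lattice_edgeD(3)[OF left]])
    then have l: "l = 2 * r" using s(1,4) xy'(2) unfolding i1 by linarith
    have \<alpha>le: "\<alpha> \<le> H + 2"
    proof (cases "H < \<alpha>")
      case True
      have h': "- (i * x + - q * y) = \<alpha>" using h by simp
      have "\<alpha> dvd l" using minimal_config_long(1)[OF c left, unfolded h'] True .
      then have "\<alpha> dvd 2 * r" unfolding l .
      then have "\<alpha> \<le> 2" using coprime_dvd_double[OF cop\<alpha>] \<alpha> by simp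
      then show ?thesis using H by simp
    qed (use H in simp)
    have "- p * - \<alpha> + - t * r = - p * \<beta> + - t * - r" by (simp add: \<beta>n)
    then obtain s where s: "0 \<le> s" "s \<le> l'" "- \<alpha> = \<beta> + s * - t" "r = - r - s * - p" by (rule lattice_edge_eq[OF right tL])
    have "- \<alpha> \<le> \<beta> + l' * - t" by (rule L1[OF lattice_edgeD(4)[OF right]])
    then have l': "l' = 2 * r" using s(2,4) unfolding \<beta>n n2 p1 t1 mult_1_left by linarith
    have h': "- (- p * \<beta> + - t * - r) = r - \<alpha>" by (simp add: \<beta>n)
    have "H < r - \<alpha>" using \<alpha>le r H by linarith
    then have dv: "r - \<alpha> dvd 2 * r" using minimal_config_long(1)[OF c right, unfolded h'] unfolding l' by blast
    have "coprime (r - \<alpha>) r"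
    proof (rule coprimeI)
      fix d assume d: "d dvd r - \<alpha>" "d dvd r"
      then have "d dvd (r - \<alpha>) + r" by (rule dvd_add)
      then have "d dvd \<beta>" by (simp add: \<beta>n algebra_simps)
      then show "is_unit d" using cop\<beta> d(2) by (meson coprime_common_divisor)
    qed
    from coprime_dvd_double[OF this dv] have "r - \<alpha> \<le> 2" using \<alpha> by linarith
    then show False using \<alpha>le r H by linarith
  qed
  have q0: "q = 0" if "i = 1"
  proof (rule ccontr)
    assume "q \<noteq> 0"
    then have "1 * r \<le> q * r" using q r0 by (intro mult_right_mono) auto
    then show False using lam(1) \<alpha> unfolding that mult_1_left by linarith
  qed
  consider "3 \<le> n" | "n = 2" | "n = 1" using n1 by linarith
  then show False
  proof cases
    assume n3: "3 \<le> n"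
    have "i * p * 3 \<le> i * p * n" using n3 i p by (intro mult_left_mono) auto
    then have ip: "3 * (i * p) \<le> 2 * i + 2 * p" using 3 by simp
    have "i = 1 \<or> p = 1"
    proof (rule ccontr)
      assume "\<not> (i = 1 \<or> p = 1)"
      then have "i * 2 \<le> i * p" "2 * p \<le> i * p" "2 \<le> p" using i p by auto
      then show False using ip i by linarith
    qed
    then have "i = 1 \<and> p \<le> 2 \<or> p = 1 \<and> i \<le> 2" using ip by (elim disjE) simp_all
    then have "i = 1 \<and> p = 1 \<or> i = 1 \<and> p = 2 \<or> i = 2 \<and> p = 1" using i p by linarith
    then consider "i = 1" "p = 1" | "i = 1" "p = 2" | "i = 2" "p = 1" by blast
    then show False
    proof cases
      case 1
      have "(t + 2) * r = (t + 1) * r + r" by (simp add: algebra_simps)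
      then have "n * r < (t + 2) * r" using p\<beta> \<alpha> unfolding \<beta>n 1 mult_1_left by linarith
      then have "n < t + 2" by (rule mult_right_less_imp_less[OF _ less_imp_le[OF r0]])
      then have "n \<le> t + 1" by simp
      then show False using \<open>2 * (p * q + i * t) \<le> i * p * n\<close> q0 n3 unfolding 1 by simp
    next
      case 2
      have n3: "n = 3" using 3 n3 unfolding 2 by simp
      have "t \<le> 3" using \<open>2 * (p * q + i * t) \<le> i * p * n\<close> q unfolding 2 n3 by simp
      then have "(t + 1) * r \<le> 4 * r" using r0 by (intro mult_right_mono) auto
      from order_trans[OF p\<beta> this] have "2 * (3 * r - \<alpha>) \<le> 4 * r" unfolding \<beta>n 2 n3 .
      then show False using \<alpha> by simp
    next
      case 3
      have n3: "n = 3" using \<open>i * p * n \<le> 2 * (i + p)\<close> n3 unfolding 3 by simp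
      have "2 * r < 3 * r - \<alpha>" using \<alpha> by simp
      also have "\<dots> \<le> (t + 1) * r" using p\<beta> unfolding \<beta>n 3 n3 by simp
      finally have "2 * r < (t + 1) * r" .
      then have "2 < t + 1" by (rule mult_right_less_imp_less[OF _ less_imp_le[OF r0]])
      then show False using \<open>2 * (p * q + i * t) \<le> i * p * n\<close> q unfolding 3 n3 by simp
    qed
  next
    assume n2: "n = 2"
    have ip: "i * p \<le> i + p" using 3 unfolding n2 by simp
    consider "p = 1" | "i = 1" "p \<noteq> 1" | "i = 2" "p = 2"
    proof -
      have "p = 1 \<or> i = 1 \<or> (i = 2 \<and> p = 2)"
      proof (rule ccontr)
        assume n: "\<not> (p = 1 \<or> i = 1 \<or> (i = 2 \<and> p = 2))"
        have "i * 2 \<le> i * p" "2 * p \<le> i * p" using n i p by auto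
        then have "i = p" "i * p = i * 2" using ip by linarith+
        then show False using n i by auto
      qed
      then show ?thesis using that by blast
    qed
    then show False
    proof cases
      case 1
      then show False using triangle n2 by blast
    next
      case 2
      have "t \<le> p" using \<open>2 * (p * q + i * t) \<le> i * p * n\<close> q0 unfolding 2(1) n2 by simp
      moreover have "\<not> t \<le> p - 1"
      proof
        assume "t \<le> p - 1"
        then have "(t + 1) * r \<le> p * r" using r0 by (intro mult_right_mono) auto
        then have "p * \<beta> \<le> p * r" using p\<beta> by linarith
        then show False using p \<alpha> by (simp add: \<beta>n n2)
      qed
      ultimately have "t = p" by simp
      then show False using coppt p 2 by simp
    next
      case 3
      have "t \<noteq> 0" "q \<noteq> 0" using coppt copiq 3 by auto
      moreover have "q + t \<le> 2" using 1 unfolding 3 n2 by simp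
      ultimately have "q = 1" "t = 1" using q t by linarith+
      then show False using p\<beta> \<alpha> unfolding \<beta>n 3 n2 by simp
    qed
  next
    assume n1: "n = 1"
    then have k: "k = r" using n by simp
    have \<beta>r: "\<beta> < r" "r - \<alpha> = \<beta>" using \<alpha> by (auto simp: \<beta>_def k)
    consider "p = 1" | "i = 1" | "2 \<le> p" "2 \<le> i" using p i by linarith
    then show False
    proof cases
      case 1
      have "t = 0"
      proof (rule ccontr)
        assume "t \<noteq> 0"
        then have "1 * r \<le> t * r" using t r0 by (intro mult_right_mono) auto
        then show False using rho(1) \<beta>r unfolding 1 mult_1_left by linarith
      qed
      then have "lattice_edge L (- 1) 0 (r - \<alpha>) (- r) l'" using right 1 \<beta>r by simp
      then show False by (rule vertical_right_edge_False[OF c H r e[unfolded k] \<alpha>])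
    next
      case 2
      have "- (- \<alpha> + r * 1) = - \<beta>" "- r - r * 0 = - r" "- 0 = (0 :: int)" using \<beta>r(2) by auto
      then have "lattice_edge (reflect ` L) 0 1 (- \<beta>) (- r) r"
        using lattice_edge_reflect[OF e[unfolded k]] by (simp only:)
      moreover have "- (x + l * - q) = r - \<beta>" "y - l * i = - r" "- q = 0" using xy 2 q0 \<beta>r(2) by auto
      then have "lattice_edge (reflect ` L) (- 1) 0 (r - \<beta>) (- r) l"
        using lattice_edge_reflect[OF left] 2 by (simp only:)
      ultimately show False
        by (rule vertical_right_edge_False[OF minimal_config_reflect[OF c] H r _ \<beta> \<beta>r(1)])
    next
      case 3
      have "t \<noteq> 0" "q \<noteq> 0" using coppt copiq 3 by auto
      then have qt: "1 \<le> q" "1 \<le> t" using q t by auto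
      then have "p \<le> p * q" "i \<le> i * t" using p i by simp_all
      moreover have "2 * (p * q) + 2 * (i * t) \<le> i * p" "i * p \<le> 2 * i + 2 * p"
        using 1 \<open>i * p * n \<le> 2 * (i + p)\<close> by (simp_all add: n1)
      \<comment> \<open>The lower and the upper bound on \<open>i * p\<close> meet, so (i - 2) (p -
        2) = 4 keeps \<open>p\<close> small, while the right height, now equal to \<open>r\<close>,
        makes \<open>r\<close> a divisor of \<open>p\<close>.\<close>
      ultimately have eqs: "p * q = p" "i * t = i" "i * p = 2 * i + 2 * p" by linarith+
      have "i * p * n = i * t + p * q + i + p" unfolding n1 mult_1_right eqs by simp
      then have "p * \<beta> = (t + 1) * r" by (rule two_eq)
      then have "r dvd p * \<beta>" by simp
      then have "r dvd p" using cop\<beta> by (simp add: coprime_commute coprime_dvd_mult_left_iff)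
      then have "r \<le> p" using p by (simp add: zdvd_imp_le)
      then have "9 * (i - 2) \<le> p * (i - 2)" using 3 r H by (intro mult_right_mono) auto
      also have "p * (i - 2) = 2 * i" using eqs(3) by (simp add: algebra_simps)
      finally have "i = 2" using 3 by simp
      then show False using eqs(3) by simp
    qed
  qed
qed

lemma minimal_config_bound:
  assumes c: "minimal_config H r L" and H: "0 \<le> H" and e: "lattice_edge L a b x y k"
    and r: "- (a * x + b * y) = r"
  shows "r \<le> 8 * H + 8"
proof (rule ccontr)
  assume "\<not> r \<le> 8 * H + 8"
  then have rb: "8 * H + 8 < r" by simp
  have cop: "coprime a b" using lattice_edgeD[OF e] by simp
  obtain u v where uv: "u * a + v * b = 1" using bezout_int[of a b] cop by (metis coprime_imp_gcd_eq_1)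
  have det: "v * b - (- u) * a = 1" using uv by (simp add: algebra_simps)
  have e1: "lattice_edge (lmap v (- u) a b ` L) 0 1 (v * x - u * y) (- r) k"
  proof -
    have "b * a - a * b = 0" "v * b - - u * a = 1" "a * x + b * y = - r" "v * x + - u * y = v * x - u * y"
      using uv r by (simp_all add: algebra_simps)
    then show ?thesis using lattice_edge_lmap[OF det e] by (simp only:)
  qed
  note c1 = minimal_config_lmap[OF det c]
  define X where "X = v * x - u * y"
  \<comment> \<open>The extra 1 puts the start of the edge at \<open>X mod r - r\<close>, to the
    left of the vertical axis. Primitivity of this vertex excludes the boundary value - r.\<close>
  define m where "m = X div r + 1"
  define \<alpha> where "\<alpha> = r - X mod r"
  have r0: "1 < r" using rb H by simp
  have "coprime X r" using minimal_configD(1)[OF c1 e1] by (simp add: X_def)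
  have "X mod r \<noteq> 0"
  proof
    assume "X mod r = 0"
    then have "is_unit r" using \<open>coprime X r\<close> by (meson coprime_common_divisor dvd_eq_mod_eq_0 dvd_refl)
    then show False using r0 by simp
  qed
  moreover have "0 \<le> X mod r" "X mod r < r" using r0 by simp_all
  ultimately have \<alpha>: "0 < \<alpha>" "\<alpha> < r" by (auto simp: \<alpha>_def)
  have det2: "1 * 1 - m * 0 = (1::int)" by simp
  have "X - m * r = - \<alpha>"
    using div_mult_mod_eq[of X r] by (simp add: m_def \<alpha>_def algebra_simps)
  then have "lattice_edge (lmap 1 m 0 1 ` lmap v (- u) a b ` L) 0 1 (- \<alpha>) (- r) k"
    using lattice_edge_lmap[OF det2 e1] by (simp add: X_def)
  then show False by (rule bottom_edge_False[OF minimal_config_lmap[OF det2 c1] H rb _ \<alpha>])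
qed

section \<open>Normal forms of configurations with bounded heights\<close>

text \<open>For finite \<open>L\<close> this says that the origin is interior to the convex hull.
  The functionals are real because separation of convex sets provides real ones.\<close>

definition surrounds_origin :: "(int \<times> int) set \<Rightarrow> bool" where
  "surrounds_origin L \<longleftrightarrow> finite L \<and>
     (\<forall>a b :: real. (a, b) \<noteq> (0, 0) \<longrightarrow> (\<exists>X Y. (X, Y) \<in> L \<and> a * of_int X + b * of_int Y < 0))"

lemma surrounds_origin_int:
  fixes a b :: int
  assumes "surrounds_origin L" "a \<noteq> 0 \<or> b \<noteq> 0"
  obtains X Y where "(X, Y) \<in> L" "a * X + b * Y < 0"
proof -
  have "(real_of_int a, real_of_int b) \<noteq> (0, 0)" using assms(2) by auto
  then obtain X Y where 1: "(X, Y) \<in> L" and 2: "real_of_int a * of_int X + real_of_int b * of_int Y < 0"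
    using assms(1) unfolding surrounds_origin_def by blast
  have "real_of_int (a * X + b * Y) < 0" using 2 by simp
  then have "a * X + b * Y < 0" by linarith
  then show thesis using 1 that by blast
qed

lemma lattice_edge_normal_nonzero:
  assumes "lattice_edge L a b x y k"
  shows "a \<noteq> 0 \<or> b \<noteq> 0"
  using lattice_edgeD(1)[OF assms] by auto

lemma lattice_edge_height_pos:
  assumes "surrounds_origin L" "lattice_edge L a b x y k"
  shows "a * x + b * y < 0"
proof -
  obtain X Y where "(X, Y) \<in> L" "a * X + b * Y < 0"
    by (rule surrounds_origin_int[OF assms(1) lattice_edge_normal_nonzero[OF assms(2)]])
  then show ?thesis using lattice_edge_ge[OF assms(2)] by fastforce
qed

lemma surrounds_origin_predecessor:
  assumes L: "surrounds_origin L" and e: "lattice_edge L a b x y k"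
  obtains a' b' x' y' k' where "lattice_edge L a' b' x' y' k'" "0 < a' * b - b' * a"
    "x = x' + k' * b'" "y = y' - k' * a'"
proof -
  obtain X0 Y0 where X0: "(X0, Y0) \<in> L" "(- a) * X0 + (- b) * Y0 < 0"
    by (rule surrounds_origin_int[OF L, of "- a" "- b"]) (use lattice_edge_normal_nonzero[OF e] in auto)
  have "finite L" using L by (simp add: surrounds_origin_def)
  moreover have "a * x + b * y < a * X0 + b * Y0" using X0(2) lattice_edge_height_pos[OF L e] by simp
  ultimately show thesis using lattice_edge_predecessor[OF _ e X0(1)] that by blast
qed

text \<open>The ray in direction (u, v) has to leave the polygon. At a vertex extreme in this
  direction, the incoming and the outgoing edge cannot both have normals that are non-negative on
  (u, v): an identity between determinants would contradict the left turn from one edge to the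
  other.\<close>

lemma lattice_edge_facing:
  assumes L: "surrounds_origin L" and u: "u \<noteq> 0 \<or> v \<noteq> (0 :: int)"
  shows "\<exists>a b x y k. lattice_edge L a b x y k \<and> a * u + b * v < 0"
proof (rule ccontr)
  assume "\<not> ?thesis"
  then have all: "0 \<le> a * u + b * v" if "lattice_edge L a b x y k" for a b x y k
    using that not_less by blast
  have fin: "finite L" using L by (simp add: surrounds_origin_def)
  obtain X0 Y0 where "(X0, Y0) \<in> L" by (rule surrounds_origin_int[OF L u])
  then have ne: "L \<noteq> {}" by blast
  define f where "f = (\<lambda>(X, Y). u * X + v * Y)"
  define m where "m = Max (f ` L)"
  define F where "F = {p \<in> L. f p = m}"
  have "m \<in> f ` L" unfolding m_def using fin ne by (intro Max_in) auto
  then have F: "finite F" "F \<noteq> {}" using fin by (auto simp: F_def)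
  have fm: "u * X + v * Y \<le> m" if "(X, Y) \<in> L" for X Y
  proof -
    have "f (X, Y) \<le> m" unfolding m_def using fin that by (intro Max_ge) auto
    then show ?thesis by (simp add: f_def)
  qed
  \<comment> \<open>Among the points extreme in direction (u, v) the last one counterclockwise is
    chosen, so that the next edge leaves their face.\<close>
  define g where "g = (\<lambda>(X, Y). u * Y - v * X)"
  have "Max (g ` F) \<in> g ` F" using F by (intro Max_in) auto
  then obtain x y where xyF: "(x, y) \<in> F" and gm: "g (x, y) = Max (g ` F)" by auto
  have gmax: "u * Y - v * X \<le> u * y - v * x" if "(X, Y) \<in> F" for X Y
  proof -
    have "g (X, Y) \<le> g (x, y)" unfolding gm using F that by (intro Max_ge) auto
    then show ?thesis by (simp add: g_def)
  qed
  have xyL: "(x, y) \<in> L" and xym: "u * x + v * y = m" using xyF by (auto simp: F_def f_def)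
  obtain X1 Y1 where X1: "(X1, Y1) \<in> L" "u * X1 + v * Y1 < 0" by (rule surrounds_origin_int[OF L u])
  obtain X2 Y2 where X2: "(X2, Y2) \<in> L" "(- u) * X2 + (- v) * Y2 < 0"
    by (rule surrounds_origin_int[OF L, of "- u" "- v"]) (use u in auto)
  have m0: "0 < m" using fm[OF X2(1)] X2(2) by simp
  obtain a b k where e: "lattice_edge L a b x y k"
  proof (rule next_edge_int[OF fin xyL _ _ X1(1), of "- u" "- v"])
    fix X Y assume XY: "(X, Y) \<in> L"
    show "- u * x + - v * y \<le> - u * X + - v * Y" using fm[OF XY] xym by simp
    assume "- u * X + - v * Y = - u * x + - v * y"
    then have "(X, Y) \<in> F" using XY xym by (simp add: F_def f_def)
    then show "- v * X - - u * Y \<le> - v * x - - u * y" using gmax by simp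
  qed (use X1(2) m0 xym that in auto)
  obtain a' b' x' y' k' where e': "lattice_edge L a' b' x' y' k'" and d': "0 < a' * b - b' * a"
    and xy': "x = x' + k' * b'" "y = y' - k' * a'" by (rule surrounds_origin_predecessor[OF L e])
  have k: "0 < k" "0 < k'" using lattice_edgeD(2)[OF e] lattice_edgeD(2)[OF e'] .
  have "u * (x + k * b) + v * (y - k * a) \<le> m" using fm lattice_edgeD(4)[OF e] by blast
  then have "k * (u * b - v * a) \<le> 0" using xym by (simp add: algebra_simps)
  then have 1: "u * b - v * a \<le> 0" using k by (simp add: mult_le_0_iff)
  have "u * x' + v * y' \<le> m" using fm lattice_edgeD(3)[OF e'] by blast
  then have "0 \<le> k' * (u * b' - v * a')" using xym xy' by (simp add: algebra_simps)
  then have 2: "0 \<le> u * b' - v * a'" using k by (simp add: zero_le_mult_iff)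
  have "(u * u + v * v) * (a' * b - b' * a) = (u * b - v * a) * (a' * u + b' * v) - (u * b' - v * a') * (a * u + b * v)"
    by (simp add: algebra_simps)
  also have "\<dots> \<le> 0"
    using mult_nonpos_nonneg[OF 1 all[OF e']] mult_nonneg_nonneg[OF 2 all[OF e]] by linarith
  finally have "u * u + v * v \<le> 0" using d' by (simp add: mult_le_0_iff)
  moreover have "0 < u * u + v * v" using u by (metis sum_squares_gt_zero_iff)
  ultimately show False by linarith
qed

text \<open>Cramer's rule for the two edges through the vertex: their heights are at most
  \<open>C\<close>, and the determinant of their normals is a positive integer.\<close>

lemma lattice_edge_vertex_bound:
  assumes L: "surrounds_origin L" and e: "lattice_edge L a b x y k" and C: "0 \<le> C"
    and ht: "\<And>a b x y k. lattice_edge L a b x y k \<Longrightarrow> - (a * x + b * y) \<le> C"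
    and W: "\<And>a b x y k. lattice_edge L a b x y k \<Longrightarrow> \<bar>a\<bar> \<le> W \<and> \<bar>b\<bar> \<le> W"
  shows "\<bar>x\<bar> \<le> 2 * C * W" "\<bar>y\<bar> \<le> 2 * C * W"
proof -
  obtain a' b' x' y' k' where e': "lattice_edge L a' b' x' y' k'" and d: "0 < a' * b - b' * a"
    and xy: "x = x' + k' * b'" "y = y' - k' * a'" by (rule surrounds_origin_predecessor[OF L e])
  define h where "h = a * x + b * y"
  define h' where "h' = a' * x + b' * y"
  have h'eq: "h' = a' * x' + b' * y'" by (simp add: h'_def xy algebra_simps)
  have h: "\<bar>h\<bar> \<le> C" "\<bar>h'\<bar> \<le> C"
    using ht[OF e] ht[OF e'] lattice_edge_height_pos[OF L e] lattice_edge_height_pos[OF L e'] unfolding h_def h'eq by auto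
  have bnd: "\<bar>s * t - p * q\<bar> \<le> 2 * C * W" if "\<bar>s\<bar> \<le> C" "\<bar>p\<bar> \<le> C" "\<bar>t\<bar> \<le> W" "\<bar>q\<bar> \<le> W" for s t p q :: int
  proof -
    have "\<bar>s * t\<bar> \<le> C * W" "\<bar>p * q\<bar> \<le> C * W" unfolding abs_mult using that C by (auto intro!: mult_mono)
    then show ?thesis by linarith
  qed
  have abs_le: "\<bar>z\<bar> \<le> B" if "\<bar>z * (a' * b - b' * a)\<bar> \<le> B" for z B
  proof -
    have "\<bar>z\<bar> * 1 \<le> \<bar>z\<bar> * (a' * b - b' * a)" using d by (intro mult_left_mono) auto
    then show ?thesis using that d by (simp add: abs_mult)
  qed
  have x: "x * (a' * b - b' * a) = h' * b - h * b'" and y: "y * (a' * b - b' * a) = h * a' - h' * a"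
    by (simp_all add: h_def h'_def algebra_simps)
  note w = W[OF e, THEN conjunct1] W[OF e, THEN conjunct2] W[OF e', THEN conjunct1] W[OF e', THEN conjunct2]
  show "\<bar>x\<bar> \<le> 2 * C * W" by (rule abs_le, unfold x) (rule bnd[OF h(2) h(1) w(2) w(4)])
  show "\<bar>y\<bar> \<le> 2 * C * W" by (rule abs_le, unfold y) (rule bnd[OF h(1) h(2) w(3) w(1)])
qed

section \<open>Smooth fans\<close>

text \<open>The local property of a complete smooth fan: each ray is completed to a lattice basis on
  either side. Cones and adjacency do not appear, so a ray is contracted simply by removing it from
  the set.\<close>

definition smooth_fan :: "(int \<times> int) set \<Rightarrow> bool" where
  "smooth_fan S \<longleftrightarrow> (\<forall>x y. (x, y) \<in> S \<longrightarrow>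
     (\<exists>z w. (z, w) \<in> S \<and> x * w - y * z = 1) \<and> (\<exists>z w. (z, w) \<in> S \<and> x * w - y * z = - 1))"

lemma det_eq_shift:
  fixes v1 v2 :: int
  assumes "v1 * w2 - v2 * w1 = 1" "u1 * v2 - u2 * v1 = z1 * v2 - z2 * v1"
  obtains i where "u1 = z1 + i * v1" "u2 = z2 + i * v2"
proof -
  have "coprime v1 (- v2)"
  proof (rule coprimeI)
    fix d assume "d dvd v1" "d dvd - v2"
    then have "d dvd v1 * w2 - v2 * w1" by (intro dvd_diff dvd_mult2) auto
    then show "is_unit d" using assms(1) by simp
  qed
  then have "coprime (- v2) v1" by (simp add: coprime_commute)
  moreover have "- v2 * (u1 - z1) + v1 * (u2 - z2) = 0" using assms(2) by (simp add: algebra_simps)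
  ultimately obtain s where "u1 - z1 = s * v1" "u2 - z2 = - s * - v2" by (rule coprime_orthogonal_int)
  then show thesis by (intro that[of s]) auto
qed

text \<open>Contracting the longest ray, whenever it is the sum of its two neighbours, keeps the fan
  smooth; in a fan without such a ray the neighbours of the longest ray lie in a half-plane
  opposite to it.\<close>

lemma smooth_fan_opposite:
  assumes "finite S" "S \<noteq> {}" "smooth_fan S"
  shows "\<exists>v1 v2 b1 b2 c1 c2 s. (v1, v2) \<in> S \<and> (b1, b2) \<in> S \<and> (c1, c2) \<in> S \<and> s \<le> 0 \<and>
     v1 * b2 - v2 * b1 = 1 \<and> b1 + c1 = s * v1 \<and> b2 + c2 = s * v2"
  using assms
proof (induction "card S" arbitrary: S rule: less_induct)
  case less
  define n where "n = (\<lambda>(x :: int, y :: int). x * x + y * y)"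
  have "Max (n ` S) \<in> n ` S" using less.prems by (intro Max_in) auto
  then obtain v1 v2 where vS: "(v1, v2) \<in> S" and vm: "n (v1, v2) = Max (n ` S)" by auto
  have nmax: "x * x + y * y \<le> v1 * v1 + v2 * v2" if "(x, y) \<in> S" for x y
  proof -
    have "n (x, y) \<le> n (v1, v2)" unfolding vm using less.prems that by (intro Max_ge) auto
    then show ?thesis by (simp add: n_def)
  qed
  obtain b1 b2 where b: "(b1, b2) \<in> S" "v1 * b2 - v2 * b1 = 1"
    using less.prems(3) vS unfolding smooth_fan_def by blast
  obtain c1 c2 where c: "(c1, c2) \<in> S" "v1 * c2 - v2 * c1 = - 1"
    using less.prems(3) vS unfolding smooth_fan_def by blast
  have "(- b1) * v2 - (- b2) * v1 = c1 * v2 - c2 * v1" using b(2) c(2) by (simp add: algebra_simps)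
  then obtain t where "- b1 = c1 + t * v1" "- b2 = c2 + t * v2" by (rule det_eq_shift[OF b(2)])
  then have s: "b1 + c1 = (- t) * v1" "b2 + c2 = (- t) * v2" by auto
  define s where "s = - t"
  note s = s[folded s_def]
  have pos: "0 < v1 * v1 + v2 * v2" using b(2) by (metis sum_squares_gt_zero_iff mult_zero_left diff_0_right zero_neq_one)
  have less_v: "2 * (v1 * x + v2 * y) < 2 * (v1 * v1 + v2 * v2)" if "(x, y) \<in> S" "(x, y) \<noteq> (v1, v2)" for x y
  proof -
    have "0 < (v1 - x) * (v1 - x) + (v2 - y) * (v2 - y)" using that(2) by (auto simp: sum_squares_gt_zero_iff)
    then have "2 * (v1 * x + v2 * y) < (v1 * v1 + v2 * v2) + (x * x + y * y)" by (simp add: algebra_simps)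
    also have "\<dots> \<le> (v1 * v1 + v2 * v2) + (v1 * v1 + v2 * v2)" using nmax[OF that(1)] by simp
    finally show ?thesis by simp
  qed
  have bv: "(b1, b2) \<noteq> (v1, v2)" "(c1, c2) \<noteq> (v1, v2)" using b(2) c(2) by auto
  \<comment> \<open>Since v is longest, b and c have scalar product with v less than that of v with
    itself. So b + c = s v has s < 2, and the only case that asks for a contraction is s =
    1.\<close>
  have "2 * (v1 * (b1 + c1) + v2 * (b2 + c2)) < 4 * (v1 * v1 + v2 * v2)"
    using less_v[OF b(1) bv(1)] less_v[OF c(1) bv(2)] by (simp add: algebra_simps)
  then have "s * (v1 * v1 + v2 * v2) < 2 * (v1 * v1 + v2 * v2)" unfolding s by (simp add: algebra_simps)
  then have "s < 2" by (rule mult_right_less_imp_less) (use pos in simp)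
  show ?case
  proof (cases "s \<le> 0")
    case True
    then show ?thesis using vS b c(1) s by (intro exI conjI)
  next
    case False
    then have v: "v1 = b1 + c1" "v2 = b2 + c2" using s \<open>s < 2\<close> by auto
    define S' where "S' = S - {(v1, v2)}"
    have cb: "c1 * b2 - c2 * b1 = 1" using b(2) by (simp add: v algebra_simps)
    have bc_pos: "0 < v1 * b1 + v2 * b2" "0 < v1 * c1 + v2 * c2"
    proof -
      have "0 < b1 * b1 + b2 * b2" "0 < c1 * c1 + c2 * c2"
        using cb by (metis sum_squares_gt_zero_iff mult_zero_right mult_zero_left diff_0_right zero_neq_one)+
      then show "0 < v1 * b1 + v2 * b2" "0 < v1 * c1 + v2 * c2"
        using nmax[OF b(1)] nmax[OF c(1)] by (simp_all add: v algebra_simps)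
    qed
    \<comment> \<open>If z has positive scalar product with v, then z + i v with i \<ge> 1 is longer
      than v, so neither it nor its negative belongs to \<open>S\<close>.\<close>
    have no: "\<not> (1 \<le> i)" if "(z1 + i * v1, z2 + i * v2) \<in> S \<or> (- (z1 + i * v1), - (z2 + i * v2)) \<in> S"
      "0 < v1 * z1 + v2 * z2" for z1 z2 i
    proof
      assume i: "1 \<le> i"
      have "(z1 + i * v1) * (z1 + i * v1) + (z2 + i * v2) * (z2 + i * v2) \<le> v1 * v1 + v2 * v2"
        using that(1) nmax[of "z1 + i * v1" "z2 + i * v2"]
          nmax[of "- (z1 + i * v1)" "- (z2 + i * v2)", unfolded minus_mult_minus] by blast
      then have 1: "(z1 * z1 + z2 * z2) + 2 * (i * (v1 * z1 + v2 * z2)) + i * i * (v1 * v1 + v2 * v2) \<le> v1 * v1 + v2 * v2"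
        by (simp add: algebra_simps)
      have 2: "0 \<le> z1 * z1 + z2 * z2" by simp
      have 3: "0 < i * (v1 * z1 + v2 * z2)" using i that(2) by simp
      have "1 * 1 \<le> i * i" using i by (intro mult_mono) auto
      then have 4: "1 * (v1 * v1 + v2 * v2) \<le> i * i * (v1 * v1 + v2 * v2)"
        using pos by (intro mult_right_mono) auto
      have "False" if "Z + 2 * T + W \<le> V" "0 \<le> Z" "0 < T" "1 * V \<le> W" for Z T W V :: int
        using that by linarith
      from this[OF 1 2 3 4] show False .
    qed
    have bS': "(b1, b2) \<in> S'" and cS': "(c1, c2) \<in> S'" using b(1) c(1) bv by (auto simp: S'_def)
    \<comment> \<open>Removing v = p + q affects only those u whose partner was v. Such a u is q + i
      v, and maximality of v leaves u = q and u = - p; then p, respectively q, replaces v as a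
      partner.\<close>
    have step: "\<exists>z w. (z, w) \<in> S' \<and> u1 * w - u2 * z = \<sigma>"
      if u: "(u1, u2) \<in> S'" and p: "(p1, p2) \<in> S'" "0 < v1 * p1 + v2 * p2"
        and q: "(q1, q2) \<in> S'" "0 < v1 * q1 + v2 * q2" and pq: "v1 = p1 + q1" "v2 = p2 + q2" "q1 * p2 - q2 * p1 = \<sigma>"
        and ex: "\<exists>z w. (z, w) \<in> S \<and> u1 * w - u2 * z = \<sigma>" for u1 u2 p1 p2 q1 q2 \<sigma>
    proof (cases "u1 * v2 - u2 * v1 = \<sigma>")
      case False
      obtain z w where "(z, w) \<in> S" "u1 * w - u2 * z = \<sigma>" using ex by blast
      then show ?thesis using False by (intro exI[of _ z] exI[of _ w]) (auto simp: S'_def)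
    next
      case True
      have uS: "(u1, u2) \<in> S" using u by (simp add: S'_def)
      have "u1 * v2 - u2 * v1 = q1 * v2 - q2 * v1" unfolding True using pq by (simp add: algebra_simps)
      then obtain i where i: "u1 = q1 + i * v1" "u2 = q2 + i * v2" by (rule det_eq_shift[OF b(2)])
      have "(q1 + i * v1, q2 + i * v2) \<in> S" using uS unfolding i .
      from no[OF disjI1[OF this] q(2)] have "\<not> 1 \<le> i" .
      moreover have "\<not> 1 \<le> - i - 1"
      proof -
        have "u1 = - (p1 + (- i - 1) * v1)" "u2 = - (p2 + (- i - 1) * v2)" by (simp_all add: i pq algebra_simps)
        then have "(- (p1 + (- i - 1) * v1), - (p2 + (- i - 1) * v2)) \<in> S" using uS by (simp only:)
        from no[OF disjI2[OF this] p(2)] show ?thesis .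
      qed
      ultimately consider "i = 0" | "i = - 1" by linarith
      then show ?thesis
      proof cases
        case 1
        then have "u1 * p2 - u2 * p1 = \<sigma>" using pq(3) by (simp add: i)
        then show ?thesis using p(1) by blast
      next
        case 2
        have "u1 * q2 - u2 * q1 = \<sigma>" using pq(3) by (simp add: i 2 pq(1,2) algebra_simps)
        then show ?thesis using q(1) by blast
      qed
    qed
    have "smooth_fan S'"
      unfolding smooth_fan_def
    proof (intro allI impI conjI)
      fix u1 u2 assume u: "(u1, u2) \<in> S'"
      have ex: "\<exists>z w. (z, w) \<in> S \<and> u1 * w - u2 * z = 1" "\<exists>z w. (z, w) \<in> S \<and> u1 * w - u2 * z = - 1"
        using less.prems(3) u unfolding smooth_fan_def S'_def by blast+
      show "\<exists>z w. (z, w) \<in> S' \<and> u1 * w - u2 * z = 1"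
        by (rule step[OF u bS' bc_pos(1) cS' bc_pos(2) v cb ex(1)])
      show "\<exists>z w. (z, w) \<in> S' \<and> u1 * w - u2 * z = - 1"
        by (rule step[OF u cS' bc_pos(2) bS' bc_pos(1) _ _ _ ex(2)]) (use v cb in \<open>simp_all add: algebra_simps\<close>)
    qed
    moreover have "card S' < card S" unfolding S'_def using less.prems(1) vS by (rule card_Diff1_less)
    moreover have "finite S'" "S' \<noteq> {}" using less.prems(1) b(1) bv by (auto simp: S'_def)
    ultimately obtain v1 v2 b1 b2 c1 c2 s where "(v1, v2) \<in> S'" "(b1, b2) \<in> S'" "(c1, c2) \<in> S'" "s \<le> 0"
     "v1 * b2 - v2 * b1 = 1" "b1 + c1 = s * v1" "b2 + c2 = s * v2"
      using less.hyps[of S'] by blast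
    then show ?thesis unfolding S'_def by (intro exI conjI) (assumption | erule DiffD1)+
  qed
qed

text \<open>Each point of \<open>L\<close> bounds the normal from below by - C. The three given
  points surround the origin if s < 0, and for s = 0 the point (- 1, z) completes them, so the
  normal is bounded once s or z is. These are bounded by the same inequalities for an edge whose
  normal is negative on (- 1, 0), or on (0, 1) and (0, - 1).\<close>

lemma lattice_edge_normal_bound:
  assumes L: "surrounds_origin L" and C: "0 \<le> C"
    and ht: "\<And>a b x y k. lattice_edge L a b x y k \<Longrightarrow> - (a * x + b * y) \<le> C"
    and p: "(1, 0) \<in> L" "(0, 1) \<in> L" "(s, - 1) \<in> L" "s \<le> 0"
    and z: "s = 0 \<Longrightarrow> \<exists>z. (- 1, z) \<in> L"
    and e: "lattice_edge L a b x y k"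
  shows "\<bar>a\<bar> \<le> 2 * C * C + 2 * C \<and> \<bar>b\<bar> \<le> 2 * C * C + 2 * C"
proof -
  have low: "- C \<le> a * X + b * Y" if "lattice_edge L a b x y k" "(X, Y) \<in> L" for a b x y k X Y
    using lattice_edge_ge[OF that] ht[OF that(1)] by linarith
  have CC: "0 \<le> C * C" using C by simp
  have ab: "- C \<le> a" "- C \<le> b" "- C \<le> a * s - b" using low[OF e p(1)] low[OF e p(2)] low[OF e p(3)] by auto
  have quot: "t \<le> 2 * C" if "- (2 * C) \<le> t * c" "c < 0" for t c :: int
  proof (cases "t \<le> 0")
    case False
    then have "t * c \<le> t * - 1" using that by (intro mult_left_mono) auto
    then show ?thesis using that by simp
  qed (use C in simp)
  show ?thesis
  proof (cases "s = 0")
    case False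
    then have s: "s < 0" using p by simp
    obtain a0 b0 x0 y0 k0 where e0: "lattice_edge L a0 b0 x0 y0 k0" "a0 * (- 1) + b0 * 0 < 0"
      using lattice_edge_facing[OF L, of "- 1" 0] by auto
    have "- (2 * C) \<le> (- s) * (- a0)" using low[OF e0(1) p(2)] low[OF e0(1) p(3)] by (simp add: mult.commute)
    then have s2: "- s \<le> 2 * C" by (rule quot) (use e0(2) in simp)
    have "- (2 * C) \<le> a * s" using ab by linarith
    then have a2: "a \<le> 2 * C" by (rule quot) (use s in simp)
    have "a * s \<le> 2 * C * C"
    proof (cases "0 \<le> a")
      case True
      then have "a * s \<le> 0" using s by (simp add: mult_nonneg_nonpos)
      then show ?thesis using CC by linarith
    next
      case False
      then have "(- a) * (- s) \<le> C * (2 * C)" using ab s s2 C by (intro mult_mono) auto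
      then show ?thesis by simp
    qed
    moreover have "0 \<le> 2 * C * C" using CC by simp
    ultimately show ?thesis using a2 ab C by (intro conjI abs_leI) linarith+
  next
    case True
    then obtain z where zL: "(- 1, z) \<in> L" using z by blast
    have b: "\<bar>b\<bar> \<le> C" using ab True by (simp add: abs_le_iff)
    have z1: "z \<le> 2 * C"
    proof -
      obtain a0 b0 x0 y0 k0 where e0: "lattice_edge L a0 b0 x0 y0 k0" "a0 * 0 + b0 * 1 < 0"
        using lattice_edge_facing[OF L, of 0 1] by auto
      have "- (2 * C) \<le> z * b0" using low[OF e0(1) p(1)] low[OF e0(1) zL] by (simp add: mult.commute)
      then show ?thesis by (rule quot) (use e0(2) in simp)
    qed
    have z2: "- z \<le> 2 * C"
    proof -
      obtain a0 b0 x0 y0 k0 where e0: "lattice_edge L a0 b0 x0 y0 k0" "a0 * 0 + b0 * (- 1) < 0"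
        using lattice_edge_facing[OF L, of 0 "- 1"] by auto
      have "- (2 * C) \<le> (- z) * (- b0)" using low[OF e0(1) p(1)] low[OF e0(1) zL] by (simp add: mult.commute)
      then show ?thesis by (rule quot) (use e0(2) in simp)
    qed
    have "\<bar>b * z\<bar> \<le> C * (2 * C)" unfolding abs_mult using b z1 z2 C by (intro mult_mono) auto
    then have "b * z \<le> 2 * C * C" by (simp add: abs_le_iff)
    moreover have "- C \<le> - a + b * z" using low[OF e zL] by simp
    moreover have "0 \<le> 2 * C * C" using CC by simp
    moreover have "b \<le> C" "- b \<le> C" using b by (simp_all add: abs_le_iff)
    ultimately show ?thesis using ab(1) C by (intro conjI abs_leI) linarith+
  qed
qed

lemma surrounds_origin_lmap:
  assumes det: "m1 * m4 - m2 * m3 = 1" and L: "surrounds_origin L"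
  shows "surrounds_origin (lmap m1 m2 m3 m4 ` L)"
  unfolding surrounds_origin_def
proof (intro conjI allI impI)
  show "finite (lmap m1 m2 m3 m4 ` L)" using L by (simp add: surrounds_origin_def)
  fix a b :: real assume ab: "(a, b) \<noteq> (0, 0)"
  have rdet: "real_of_int m1 * m4 - real_of_int m2 * m3 = 1" using det by (metis of_int_1 of_int_diff of_int_mult)
  have "(a * m1 + b * m3, a * m2 + b * m4) \<noteq> (0, 0)"
  proof
    assume "(a * m1 + b * m3, a * m2 + b * m4) = (0, 0)"
    then have 0: "a * m1 + b * m3 = 0" "a * m2 + b * m4 = 0" by auto
    have "a * (real_of_int m1 * m4 - real_of_int m2 * m3) = m4 * (a * m1 + b * m3) - m3 * (a * m2 + b * m4)"
      "b * (real_of_int m1 * m4 - real_of_int m2 * m3) = m1 * (a * m2 + b * m4) - m2 * (a * m1 + b * m3)"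
      by (simp_all add: algebra_simps)
    then show False using ab unfolding rdet 0 by simp
  qed
  then obtain X Y where XY: "(X, Y) \<in> L" "(a * m1 + b * m3) * of_int X + (a * m2 + b * m4) * of_int Y < 0"
    using L unfolding surrounds_origin_def by blast
  have "(m1 * X + m2 * Y, m3 * X + m4 * Y) \<in> lmap m1 m2 m3 m4 ` L" by (rule image_eqI[OF _ XY(1)]) simp
  moreover have "a * of_int (m1 * X + m2 * Y) + b * of_int (m3 * X + m4 * Y) < 0"
    using XY(2) by (simp add: algebra_simps)
  ultimately show "\<exists>X Y. (X, Y) \<in> lmap m1 m2 m3 m4 ` L \<and> a * of_int X + b * of_int Y < 0" by blast
qed

lemma bounded_normal_form:
  assumes L: "surrounds_origin L" and C: "0 \<le> C"
    and ht: "\<And>a b x y k. lattice_edge L a b x y k \<Longrightarrow> - (a * x + b * y) \<le> C"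
    and S: "S \<subseteq> L" "S \<noteq> {}" "smooth_fan S"
  obtains m1 m2 m3 m4 where "m1 * m4 - m2 * m3 = 1"
    "\<And>a b x y k. lattice_edge (lmap m1 m2 m3 m4 ` L) a b x y k \<Longrightarrow>
       \<bar>x\<bar> \<le> 2 * C * (2 * C * C + 2 * C) \<and> \<bar>y\<bar> \<le> 2 * C * (2 * C * C + 2 * C)"
proof -
  have "finite S" using S(1) L by (auto simp: surrounds_origin_def intro: finite_subset)
  then obtain v1 v2 b1 b2 c1 c2 s where v: "(v1, v2) \<in> S" "(b1, b2) \<in> S" "(c1, c2) \<in> S" "s \<le> 0"
     "v1 * b2 - v2 * b1 = 1" "b1 + c1 = s * v1" "b2 + c2 = s * v2"
    using smooth_fan_opposite[OF _ S(2,3)] by blast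
  have det: "b2 * v1 - (- b1) * (- v2) = 1" using v(5) by (simp add: algebra_simps)
  \<comment> \<open>Coordinates in the basis v, b: they send v to (1, 0), b to (0, 1) and c to (s, -
    1). A partner of b with determinant 1 gets first coordinate - 1 and serves in the case s =
    0.\<close>
  define L' where "L' = lmap b2 (- b1) (- v2) v1 ` L"
  have inL': "(b2 * X - b1 * Y, v1 * Y - v2 * X) \<in> L'" if "(X, Y) \<in> S" for X Y
    unfolding L'_def by (rule image_eqI[of _ _ "(X, Y)"]) (use that S(1) in \<open>auto simp: algebra_simps\<close>)
  have L'surr: "surrounds_origin L'" unfolding L'_def by (rule surrounds_origin_lmap[OF det L])
  have ht': "- (a * x + b * y) \<le> C" if E: "lattice_edge L' a b x y k" for a b x y k
  proof -
    obtain a' b' x' y' where "lattice_edge L a' b' x' y' k" 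
      "a = v1 * a' - (- v2) * b'" "b = b2 * b' - (- b1) * a'" "x = b2 * x' + (- b1) * y'" "y = (- v2) * x' + v1 * y'"
      by (rule lattice_edge_lmapE[OF det E[unfolded L'_def]])
    then show ?thesis using lmap_height[OF det] ht by metis
  qed
  have 1: "(1, 0) \<in> L'" using inL'[OF v(1)] v(5) by (simp add: algebra_simps)
  have 2: "(0, 1) \<in> L'" using inL'[OF v(2)] v(5) by (simp add: algebra_simps)
  have c: "c1 = s * v1 - b1" "c2 = s * v2 - b2" using v(6,7) by auto
  have "b2 * c1 - b1 * c2 = s * (v1 * b2 - v2 * b1)" "v1 * c2 - v2 * c1 = - (v1 * b2 - v2 * b1)"
    by (simp_all add: c algebra_simps)
  then have 3: "(s, - 1) \<in> L'" using inL'[OF v(3)] v(5) by simp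
  have 4: "\<exists>z. (- 1, z) \<in> L'"
  proof -
    obtain d1 d2 where d: "(d1, d2) \<in> S" "b1 * d2 - b2 * d1 = 1" using S(3) v(2) unfolding smooth_fan_def by blast
    have "b2 * d1 - b1 * d2 = - 1" using d(2) by simp
    then show ?thesis using inL'[OF d(1)] by auto
  qed
  have W: "\<bar>a\<bar> \<le> 2 * C * C + 2 * C \<and> \<bar>b\<bar> \<le> 2 * C * C + 2 * C" if "lattice_edge L' a b x y k" for a b x y k
    by (rule lattice_edge_normal_bound[OF L'surr C ht' 1 2 3 v(4) 4 that])
  have "\<bar>x\<bar> \<le> 2 * C * (2 * C * C + 2 * C) \<and> \<bar>y\<bar> \<le> 2 * C * (2 * C * C + 2 * C)" if "lattice_edge L' a b x y k" for a b x y k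
    by (intro conjI; rule lattice_edge_vertex_bound[OF L'surr that C]; (rule ht' | rule W); assumption)
  then show thesis using that[OF det] unfolding L'_def by blast
qed

section \<open>Integer points in the real plane\<close>

definition pt :: "int \<times> int \<Rightarrow> plane" where
  "pt v = (of_int (fst v), of_int (snd v))"

lemma pt_Pair [simp]: "pt (x, y) = (of_int x, of_int y)"
  by (simp add: pt_def)

lemma pt_eq_iff [simp]: "pt u = pt v \<longleftrightarrow> u = v"
  by (cases u; cases v) simp

lemma range_pt: "range pt = lattice"
proof -
  have "(of_int x, of_int y) \<in> range pt" for x y by (metis pt_Pair rangeI)
  then show ?thesis by (auto simp: lattice_def pt_def elim!: Ints_cases)
qed

definition lat :: "plane set \<Rightarrow> (int \<times> int) set" where
  "lat P = {v. pt v \<in> P}"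

lemma lat_iff [simp]: "v \<in> lat P \<longleftrightarrow> pt v \<in> P"
  by (simp add: lat_def)

lemma pt_image_lat: "pt ` lat P = P \<inter> lattice"
  unfolding range_pt[symmetric] by auto

lemma finite_lat:
  assumes "bounded P"
  shows "finite (lat P)"
proof -
  obtain B where B: "\<And>p. p \<in> P \<Longrightarrow> norm p \<le> B" using assms by (auto simp: bounded_iff)
  define N where "N = \<lceil>B\<rceil>"
  have "lat P \<subseteq> {- N..N} \<times> {- N..N}"
  proof (rule subrelI)
    fix x y assume "(x, y) \<in> lat P"
    then have n: "norm (real_of_int x, real_of_int y) \<le> B" using B by fastforce
    have "\<bar>real_of_int x\<bar> \<le> B" using norm_fst_le[of "real_of_int x" "real_of_int y"] n by simp
    moreover have "\<bar>real_of_int y\<bar> \<le> B" using norm_snd_le[of "real_of_int y" "real_of_int x"] n by simp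
    ultimately show "(x, y) \<in> {- N..N} \<times> {- N..N}" unfolding N_def by (auto simp: abs_le_iff) linarith+
  qed
  then show ?thesis by (rule finite_subset) simp
qed

lemma surrounds_origin_iff_interior:
  assumes "finite L"
  shows "surrounds_origin L \<longleftrightarrow> 0 \<in> interior (convex hull (pt ` L))"
proof
  let ?P = "convex hull (pt ` L)"
  assume "surrounds_origin L"
  then have neg: "\<exists>p\<in>?P. w \<bullet> p < 0" if "w \<noteq> 0" for w
  proof -
    obtain a b where w: "w = (a, b)" by fastforce
    then have ab: "w = (a, b)" "(a, b) \<noteq> (0, 0)" using that by (simp_all add: zero_prod_def)
    obtain X Y where "(X, Y) \<in> L" "a * of_int X + b * of_int Y < 0"
      using \<open>surrounds_origin L\<close> ab(2) unfolding surrounds_origin_def by blast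
    then have "pt (X, Y) \<in> ?P" "w \<bullet> pt (X, Y) < 0" by (auto simp: ab(1) simp del: pt_Pair intro!: hull_inc) (simp add: pt_def)
    then show ?thesis by blast
  qed
  show "0 \<in> interior ?P"
  proof (rule ccontr)
    assume n0: "0 \<notin> interior ?P"
    have cv: "convex ?P" by simp
    show False
    proof (cases "interior ?P = {}")
      case True
      then obtain a c where a: "a \<noteq> 0" "?P \<subseteq> {x. a \<bullet> x = c}" using empty_interior_subset_hyperplane[OF cv] by blast
      obtain p where p: "p \<in> ?P" "a \<bullet> p < 0" using neg[OF a(1)] by blast
      obtain q where q: "q \<in> ?P" "(- a) \<bullet> q < 0" using neg[of "- a"] a(1) by auto
      have "a \<bullet> p = c" "a \<bullet> q = c" using a(2) p(1) q(1) by auto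
      then show False using p(2) q(2) by simp
    next
      case False
      have "convex (interior ?P)" using cv by (rule convex_interior)
      then obtain a c where a: "a \<noteq> 0" "\<forall>x\<in>{0}. a \<bullet> x \<le> c" "\<forall>x\<in>interior ?P. c \<le> a \<bullet> x"
        using separating_hyperplane_sets[of "{0}" "interior ?P"] n0 False by auto
      then have "interior ?P \<subseteq> {x. 0 \<le> a \<bullet> x}" by auto
      then have "closure (interior ?P) \<subseteq> {x. 0 \<le> a \<bullet> x}"
        by (rule closure_minimal) (simp add: closed_halfspace_ge)
      then have "?P \<subseteq> {x. 0 \<le> a \<bullet> x}"
        using convex_closure_interior[OF cv False] closure_subset by blast
      moreover obtain p where p: "p \<in> ?P" "a \<bullet> p < 0" using neg[OF a(1)] by blast
      ultimately have "0 \<le> a \<bullet> p" by auto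
      then show False using p(2) by simp
    qed
  qed
next
  let ?P = "convex hull (pt ` L)"
  assume int: "0 \<in> interior ?P"
  show "surrounds_origin L"
    unfolding surrounds_origin_def
  proof (intro conjI allI impI assms)
    fix a b :: real assume ab: "(a, b) \<noteq> (0, 0)"
    show "\<exists>X Y. (X, Y) \<in> L \<and> a * of_int X + b * of_int Y < 0"
    proof (rule ccontr)
      assume n: "\<not> ?thesis"
      have "pt ` L \<subseteq> {x. 0 \<le> (a, b) \<bullet> x}" using n by (auto simp: not_less)
      then have sub: "?P \<subseteq> {x. 0 \<le> (a, b) \<bullet> x}" by (rule hull_minimal) (simp add: convex_halfspace_ge)
      obtain e where e: "e > 0" "ball 0 e \<subseteq> ?P" using int by (auto simp: mem_interior)
      define p where "p = - (e / (2 * norm (a, b))) *\<^sub>R (a, b)"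
      have n0: "norm (a, b) > 0" using ab by (simp add: zero_prod_def)
      have "norm p = e / 2" using e(1) n0 by (simp add: p_def del: scaleR_Pair)
      then have "p \<in> ?P" using e by (intro subsetD[OF e(2)]) simp
      then have "0 \<le> (a, b) \<bullet> p" using sub by blast
      moreover have "(a, b) \<bullet> p = - (e / (2 * norm (a, b))) * (norm (a, b))\<^sup>2"
        unfolding p_def inner_scaleR_right power2_norm_eq_inner ..
      moreover have "0 < e / (2 * norm (a, b)) * (norm (a, b))\<^sup>2"
        using e(1) n0 by (intro mult_pos_pos divide_pos_pos zero_less_power) auto
      ultimately show False by linarith
    qed
  qed
qed

text \<open>The vertices are lattice points, so by Krein-Milman the polygon is the hull of the
  finite set \<open>lat P\<close>. This is the passage from real polygons to integer point
  sets.\<close>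

lemma fano_polygonD:
  assumes "fano_polygon P"
  shows "convex P" "compact P" "bounded P" "finite (lat P)"
    "convex hull (pt ` lat P) = P" "surrounds_origin (lat P)"
proof -
  have poly: "polytope P" and prim: "\<And>v. v extreme_point_of P \<Longrightarrow> primitive v" and int: "0 \<in> interior P"
    using assms by (auto simp: fano_polygon_def)
  show cv: "convex P" and cp: "compact P" and bd: "bounded P"
    using poly by (auto simp: polytope_imp_convex polytope_imp_compact polytope_imp_bounded)
  show fin: "finite (lat P)" by (rule finite_lat[OF bd])
  have ext: "{v. v extreme_point_of P} \<subseteq> pt ` lat P"
  proof
    fix v assume "v \<in> {v. v extreme_point_of P}"
    then have "primitive v" "v \<in> P" using prim by (auto simp: extreme_point_of_def)
    then obtain a b where "v = pt (a, b)" by (auto simp: primitive_def)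
    then show "v \<in> pt ` lat P" using \<open>v \<in> P\<close> by (intro image_eqI[of _ _ "(a, b)"]) auto
  qed
  show hull: "convex hull (pt ` lat P) = P"
  proof
    show "convex hull (pt ` lat P) \<subseteq> P" by (rule hull_minimal) (use cv in auto)
    show "P \<subseteq> convex hull (pt ` lat P)"
      using hull_mono[OF ext] Krein_Milman_Minkowski[OF cp cv] by blast
  qed
  show "surrounds_origin (lat P)" using int by (simp add: surrounds_origin_iff_interior[OF fin] hull)
qed

section \<open>Lattice edges and edges of Fano polygons\<close>

definition edge_segment :: "int \<Rightarrow> int \<Rightarrow> int \<Rightarrow> int \<Rightarrow> int \<Rightarrow> plane set" where
  "edge_segment a b x y k = closed_segment (pt (x, y)) (pt (x + k * b, y - k * a))"

lemma inner_pt: "pt (a, b) \<bullet> pt (x, y) = of_int (a * x + b * y)"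
  by simp

lemma edge_segment_param:
  "p \<in> edge_segment a b x y k \<longleftrightarrow>
     (\<exists>t. 0 \<le> t \<and> t \<le> 1 \<and> p = (of_int x + t * (of_int k * of_int b), of_int y - t * (of_int k * of_int a)))"
  unfolding edge_segment_def closed_segment_def by (auto simp: algebra_simps)

lemma edge_segment_inner:
  assumes "p \<in> edge_segment a b x y k"
  shows "pt (a, b) \<bullet> p = of_int (a * x + b * y)"
  using assms by (auto simp: edge_segment_param algebra_simps)

lemma pt_mem_edge_segment:
  assumes cop: "coprime a b" and k: "0 < k"
  shows "pt (X, Y) \<in> edge_segment a b x y k \<longleftrightarrow>
    (\<exists>s. 0 \<le> s \<and> s \<le> k \<and> X = x + s * b \<and> Y = y - s * a)"
proof
  assume "pt (X, Y) \<in> edge_segment a b x y k"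
  then obtain t where t: "0 \<le> t" "t \<le> 1" and
    XY: "real_of_int X = of_int x + t * (of_int k * of_int b)" "real_of_int Y = of_int y - t * (of_int k * of_int a)"
    by (auto simp: edge_segment_param)
  have "real_of_int (a * (X - x) + b * (Y - y)) = 0" by (simp add: XY algebra_simps)
  then have "a * (X - x) + b * (Y - y) = 0" by (simp only: of_int_eq_0_iff)
  then obtain s where s: "X - x = s * b" "Y - y = - s * a" by (rule coprime_orthogonal_int[OF cop])
  have "real_of_int (X - x) = t * k * b" "real_of_int (Y - y) = - (t * k * a)" using XY by simp_all
  then have "s * real_of_int b = t * k * b" "s * real_of_int a = t * k * a" unfolding s by simp_all
  moreover have "a \<noteq> 0 \<or> b \<noteq> 0" using cop by auto
  ultimately have st: "real_of_int s = t * k" by auto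
  then have "0 \<le> real_of_int s" "real_of_int s \<le> 1 * of_int k" using t k by (auto intro: mult_right_mono simp del: mult_1)
  then have "0 \<le> s" "s \<le> k" by simp_all
  then show "\<exists>s. 0 \<le> s \<and> s \<le> k \<and> X = x + s * b \<and> Y = y - s * a" using s by (intro exI[of _ s]) auto
next
  assume "\<exists>s. 0 \<le> s \<and> s \<le> k \<and> X = x + s * b \<and> Y = y - s * a"
  then obtain s where s: "0 \<le> s" "s \<le> k" "X = x + s * b" "Y = y - s * a" by blast
  show "pt (X, Y) \<in> edge_segment a b x y k"
    unfolding edge_segment_param using s k by (intro exI[of _ "of_int s / of_int k"]) (auto simp: field_simps)
qed

lemma lattice_edge_hull:
  assumes e: "lattice_edge L a b x y k" and p: "p \<in> convex hull (pt ` L)"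
  shows "of_int (a * x + b * y) \<le> pt (a, b) \<bullet> p"
    and "pt (a, b) \<bullet> p = of_int (a * x + b * y) \<Longrightarrow> p \<in> edge_segment a b x y k"
proof -
  define w where "w = pt (a, b)"
  define m where "m = real_of_int (a * x + b * y)"
  define E where "E = edge_segment a b x y k"
  \<comment> \<open>\<open>T\<close> is an open half-plane together with the segment on its boundary
    line. Its convexity carries both the inequality and the case of equality from \<open>L\<close>
    over to the hull.\<close>
  define T where "T = {p. m \<le> w \<bullet> p \<and> (w \<bullet> p = m \<longrightarrow> p \<in> E)}"
  have cE: "convex E" by (simp add: E_def edge_segment_def)
  have "convex T"
    unfolding convex_def
  proof (intro ballI allI impI)
    fix p q u v assume pq: "p \<in> T" "q \<in> T" and uv: "0 \<le> u" "0 \<le> v" "u + v = (1::real)"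
    have eq: "w \<bullet> (u *\<^sub>R p + v *\<^sub>R q) - m = u * (w \<bullet> p - m) + v * (w \<bullet> q - m)"
    proof -
      have "m = u * m + v * m" using uv by (metis distrib_right mult_1)
      then show ?thesis by (simp add: inner_add_right algebra_simps)
    qed
    have nn: "0 \<le> u * (w \<bullet> p - m)" "0 \<le> v * (w \<bullet> q - m)" using pq uv by (auto simp: T_def)
    show "u *\<^sub>R p + v *\<^sub>R q \<in> T"
      unfolding T_def
    proof (intro CollectI conjI impI)
      show "m \<le> w \<bullet> (u *\<^sub>R p + v *\<^sub>R q)" using eq nn by linarith
      assume "w \<bullet> (u *\<^sub>R p + v *\<^sub>R q) = m"
      then have "u * (w \<bullet> p - m) = 0" "v * (w \<bullet> q - m) = 0" using eq nn by linarith+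
      then have "u = 0 \<or> p \<in> E" "v = 0 \<or> q \<in> E" using pq by (auto simp: T_def)
      then show "u *\<^sub>R p + v *\<^sub>R q \<in> E"
        using uv convexD[OF cE _ _ uv] by (cases "u = 0"; cases "v = 0") auto
    qed
  qed
  moreover have "pt ` L \<subseteq> T"
  proof
    fix q assume "q \<in> pt ` L"
    then obtain X Y where q: "q = pt (X, Y)" "(X, Y) \<in> L" by force
    have "q \<in> E" if "w \<bullet> q = m"
    proof -
      have "a * X + b * Y = a * x + b * y" using that unfolding q w_def m_def inner_pt by (simp only: of_int_eq_iff)
      then show ?thesis unfolding q E_def pt_mem_edge_segment[OF lattice_edgeD(1,2)[OF e]]
        using lattice_edge_eq[OF e q(2)] by metis
    qed
    moreover have "m \<le> w \<bullet> q" unfolding q w_def m_def inner_pt using lattice_edge_ge[OF e q(2)] by (simp only: of_int_le_iff)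
    ultimately show "q \<in> T" by (simp add: T_def)
  qed
  ultimately have "p \<in> T" using p hull_minimal[of "pt ` L" T convex] by blast
  then show "of_int (a * x + b * y) \<le> pt (a, b) \<bullet> p"
    "pt (a, b) \<bullet> p = of_int (a * x + b * y) \<Longrightarrow> p \<in> edge_segment a b x y k"
    by (auto simp: T_def w_def m_def E_def)
qed

lemma edge_segment_eq_face:
  assumes e: "lattice_edge L a b x y k"
  shows "edge_segment a b x y k = convex hull (pt ` L) \<inter> {p. pt (a, b) \<bullet> p = of_int (a * x + b * y)}"
proof
  have "edge_segment a b x y k \<subseteq> convex hull (pt ` L)"
    unfolding edge_segment_def using lattice_edgeD[OF e]
    by (intro closed_segment_subset hull_inc imageI convex_convex_hull)
  then show "edge_segment a b x y k \<subseteq> convex hull (pt ` L) \<inter> {p. pt (a, b) \<bullet> p = of_int (a * x + b * y)}"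
    using edge_segment_inner by blast
  show "convex hull (pt ` L) \<inter> {p. pt (a, b) \<bullet> p = of_int (a * x + b * y)} \<subseteq> edge_segment a b x y k"
    using lattice_edge_hull(2)[OF e] by blast
qed

lemma edge_segment_face_of:
  assumes e: "lattice_edge L a b x y k"
  shows "edge_segment a b x y k face_of convex hull (pt ` L)"
  unfolding edge_segment_eq_face[OF e]
  by (rule face_of_Int_supporting_hyperplane_ge) (use lattice_edge_hull(1)[OF e] in auto)

lemma edge_segment_edge_of:
  assumes e: "lattice_edge L a b x y k"
  shows "edge_segment a b x y k edge_of convex hull (pt ` L)"
proof -
  have "(x, y) \<noteq> (x + k * b, y - k * a)" using lattice_edgeD(1,2)[OF e] by auto
  then have "pt (x, y) \<noteq> pt (x + k * b, y - k * a)" by (metis pt_eq_iff)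
  then have "aff_dim (edge_segment a b x y k) = 1"
    unfolding edge_segment_def segment_convex_hull aff_dim_convex_hull aff_dim_2 by (simp only: if_False)
  then show ?thesis using edge_segment_face_of[OF e] by (simp add: edge_of_def)
qed

lemma lattice_edge_endpoints_extreme:
  assumes e: "lattice_edge L a b x y k"
  shows "pt (x, y) extreme_point_of convex hull (pt ` L)"
    "pt (x + k * b, y - k * a) extreme_point_of convex hull (pt ` L)"
  using extreme_point_of_face[OF edge_segment_face_of[OF e]]
  unfolding edge_segment_def extreme_point_of_segment by blast+

text \<open>The end points of an edge are extreme points of the hull and so belong to every set that
  generates it. This links a mutated set to all lattice points of its hull.\<close>

lemma lattice_edge_cong_hull:
  assumes h: "convex hull (pt ` L) = convex hull (pt ` L')" and e: "lattice_edge L a b x y k"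
  shows "lattice_edge L' a b x y k"
proof (rule lattice_edgeI)
  show "coprime a b" "0 < k" using lattice_edgeD[OF e] by auto
  have in_L': "v \<in> L'" if "pt v extreme_point_of convex hull (pt ` L)" for v
  proof -
    have "pt v \<in> pt ` L'" using that unfolding h by (rule extreme_point_of_convex_hull)
    then show ?thesis by (metis imageE pt_eq_iff)
  qed
  show "(x, y) \<in> L'" "(x + k * b, y - k * a) \<in> L'"
    using lattice_edge_endpoints_extreme[OF e] in_L' by blast+
  fix X Y assume "(X, Y) \<in> L'"
  then have XY: "pt (X, Y) \<in> convex hull (pt ` L)" unfolding h by (intro hull_inc imageI)
  show "a * x + b * y \<le> a * X + b * Y"
    using lattice_edge_hull(1)[OF e XY] unfolding inner_pt by (simp only: of_int_le_iff)
  assume "a * X + b * Y = a * x + b * y"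
  then have "pt (X, Y) \<in> edge_segment a b x y k"
    using lattice_edge_hull(2)[OF e XY] unfolding inner_pt by (simp only: )
  then show "\<exists>s. 0 \<le> s \<and> s \<le> k \<and> X = x + s * b \<and> Y = y - s * a"
    unfolding pt_mem_edge_segment[OF lattice_edgeD(1,2)[OF e]] .
qed

text \<open>A vertex is strictly separated from the hull of the other points, so some functional has
  it as its only minimiser and an edge starts there. The separating functional is real, which is why
  \<open>next_edge\<close> admits real \<open>a0\<close> and \<open>b0\<close>.\<close>

lemma extreme_point_lattice_edge:
  assumes L: "surrounds_origin L" and v: "v extreme_point_of convex hull (pt ` L)"
  obtains a b x y k where "lattice_edge L a b x y k" "v = pt (x, y)"
proof -
  have fin: "finite L" using L by (simp add: surrounds_origin_def)
  have "v \<in> pt ` L" using v by (rule extreme_point_of_convex_hull)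
  then obtain x y where xy: "v = pt (x, y)" "(x, y) \<in> L" by force
  define K where "K = convex hull (pt ` (L - {(x, y)}))"
  have vK: "v \<notin> K"
  proof
    assume "v \<in> K"
    moreover have "K \<subseteq> convex hull (pt ` L)" unfolding K_def by (intro hull_mono) auto
    ultimately have "v extreme_point_of K" using v unfolding extreme_point_of_def by blast
    then have "v \<in> pt ` (L - {(x, y)})" unfolding K_def by (rule extreme_point_of_convex_hull)
    then show False unfolding xy by (auto simp del: pt_Pair)
  qed
  have "compact (pt ` (L - {(x, y)}))" using fin by (intro finite_imp_compact) auto
  then have "closed K" unfolding K_def by (intro compact_imp_closed compact_convex_hull)
  then obtain w c where wc: "w \<bullet> v < c" "\<forall>p\<in>K. c < w \<bullet> p"
    using separating_hyperplane_closed_point[OF _ _ vK] unfolding K_def by (metis convex_convex_hull)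
  obtain a0 b0 where w: "w = (a0, b0)" by fastforce
  have pos: "0 < a0 * (of_int X - of_int x) + b0 * (of_int Y - of_int y)" if "(X, Y) \<in> L" "(X, Y) \<noteq> (x, y)" for X Y
  proof -
    have "pt (X, Y) \<in> K" unfolding K_def using that by (intro hull_inc imageI) auto
    then have "w \<bullet> v < w \<bullet> pt (X, Y)" using wc by fastforce
    then show ?thesis unfolding xy w by (simp add: algebra_simps)
  qed
  obtain a b k where "lattice_edge L a b x y k"
  proof (rule next_edge[where L = L and x = x and y = y and ?a0.0 = a0 and ?b0.0 = b0])
    show "finite L" "(x, y) \<in> L" using fin xy by auto
    fix X Y assume XY: "(X, Y) \<in> L"
    show "0 \<le> a0 * (of_int X - of_int x) + b0 * (of_int Y - of_int y)"
      using pos[OF XY] by (cases "(X, Y) = (x, y)") auto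
    assume "a0 * (of_int X - of_int x) + b0 * (of_int Y - of_int y) = 0"
    then have "(X, Y) = (x, y)" using pos[OF XY] by fastforce
    then show "b0 * (of_int X - of_int x) - a0 * (of_int Y - of_int y) \<le> 0" by simp
  next
    have "\<exists>p\<in>L. p \<noteq> (x, y)"
    proof (rule ccontr)
      assume n: "\<not> ?thesis"
      obtain X Y where 1: "(X, Y) \<in> L" "1 * X + 0 * Y < 0" by (rule surrounds_origin_int[OF L, of 1 0]) auto
      obtain X' Y' where 2: "(X', Y') \<in> L" "(- 1) * X' + 0 * Y' < 0" by (rule surrounds_origin_int[OF L, of "- 1" 0]) auto
      have "(X, Y) = (x, y)" "(X', Y') = (x, y)" using n 1 2 by blast+
      then show False using 1 2 by simp
    qed
    then obtain X Y where "(X, Y) \<in> L" "(X, Y) \<noteq> (x, y)" by auto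
    then show "\<exists>X Y. (X, Y) \<in> L \<and> 0 < a0 * (of_int X - of_int x) + b0 * (of_int Y - of_int y)"
      using pos by blast
  qed (rule that)
  then show thesis using that xy by blast
qed

lemma fano_polygonI:
  assumes "surrounds_origin L" "\<And>a b x y k. lattice_edge L a b x y k \<Longrightarrow> coprime x y"
  shows "fano_polygon (convex hull (pt ` L))"
  unfolding fano_polygon_def
proof (intro conjI allI impI)
  have fin: "finite L" using assms by (simp add: surrounds_origin_def)
  show "polytope (convex hull (pt ` L))" unfolding polytope_def using fin by blast
  show "0 \<in> interior (convex hull (pt ` L))" using assms(1) surrounds_origin_iff_interior[OF fin] by blast
  fix v assume "v extreme_point_of convex hull (pt ` L)"
  then obtain a b x y k where "lattice_edge L a b x y k" "v = pt (x, y)" by (rule extreme_point_lattice_edge[OF assms(1)])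
  then show "primitive v" using assms(2) by (auto simp: primitive_def)
qed

lemma fano_polygon_coprime:
  assumes P: "fano_polygon P" and e: "lattice_edge (lat P) a b x y k"
  shows "coprime x y" "coprime (x + k * b) (y - k * a)"
proof -
  have *: "coprime X Y" if "pt (X, Y) extreme_point_of P" for X Y
  proof -
    have "primitive (pt (X, Y))" using P that by (simp add: fano_polygon_def)
    then show ?thesis by (auto simp: primitive_def)
  qed
  show "coprime x y" "coprime (x + k * b) (y - k * a)"
    using lattice_edge_endpoints_extreme[OF e] unfolding fano_polygonD(5)[OF P] by (auto intro: * simp del: pt_Pair)
qed

lemma h_min_lattice_edge:
  assumes P: "fano_polygon P" and e: "lattice_edge (lat P) a b x y k"
  shows "h_min P (pt (a, b)) = of_int (a * x + b * y)"
  unfolding h_min_def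
proof (rule cInf_eq_minimum)
  have "pt (x, y) \<in> P" using lattice_edgeD(3)[OF e] unfolding lat_iff .
  then show "of_int (a * x + b * y) \<in> (\<bullet>) (pt (a, b)) ` P" by (rule image_eqI[rotated]) (simp only: inner_pt)
  show "of_int (a * x + b * y) \<le> t" if "t \<in> (\<bullet>) (pt (a, b)) ` P" for t
    using that lattice_edge_hull(1)[OF e] unfolding fano_polygonD(5)[OF P] by auto
qed

lemma inner_normal_edge_segment:
  assumes P: "fano_polygon P" and e: "lattice_edge (lat P) a b x y k"
  shows "inner_normal P (edge_segment a b x y k) (pt (a, b))"
  unfolding inner_normal_def h_min_lattice_edge[OF P e]
proof
  show "primitive (pt (a, b))" using lattice_edgeD(1)[OF e] by (auto simp: primitive_def)
  show "edge_segment a b x y k = {v \<in> P. pt (a, b) \<bullet> v = of_int (a * x + b * y)}"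
    using edge_segment_eq_face[OF e] unfolding fano_polygonD(5)[OF P] by auto
qed

section \<open>Mutation along a horizontal edge\<close>

text \<open>The mutation along an edge with normal \<open>(0, 1)\<close>: a point at height \<open>Y < 0\<close> survives if
  \<open>(X, Y) + \<bar>Y\<bar> F \<subseteq> P\<close>, and one at height \<open>Y \<ge> 0\<close> is replaced by the end points of \<open>(X, Y) + Y F\<close>, where
  \<open>F\<close> is the segment from \<open>0\<close> to \<open>(1, 0)\<close>.\<close>

definition mutated :: "(int \<times> int) set \<Rightarrow> (int \<times> int) set" where
  "mutated L = {(X, Y). if Y < 0 then (X, Y) \<in> L \<and> (X - Y, Y) \<in> L else (X, Y) \<in> L \<or> (X - Y, Y) \<in> L}"

lemma mutated_iff:
  "(X, Y) \<in> mutated L \<longleftrightarrow>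
     (if Y < 0 then (X, Y) \<in> L \<and> (X - Y, Y) \<in> L else (X, Y) \<in> L \<or> (X - Y, Y) \<in> L)"
  by (simp add: mutated_def)

lemma shear_iff: "(X, Y) \<in> lmap 1 (- 1) 0 1 ` S \<longleftrightarrow> (X + Y, Y) \<in> S"
proof
  assume "(X + Y, Y) \<in> S"
  then show "(X, Y) \<in> lmap 1 (- 1) 0 1 ` S" by (rule image_eqI[rotated]) simp
qed (auto simp: lmap_def)

text \<open>Mutation fixes the left boundary and shears the right one. After shearing back the roles
  are exchanged, so statements about the left chain transfer to the right chain by
  reflection.\<close>

lemma mutated_reflect: "reflect ` lmap 1 (- 1) 0 1 ` mutated L = mutated (reflect ` L)"
proof (rule set_eqI)
  fix v :: "int \<times> int"
  obtain X Y where v: "v = (X, Y)" by fastforce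
  have "- X + Y = - (X - Y)" "- X + Y - Y = - X" by simp_all
  then show "v \<in> reflect ` lmap 1 (- 1) 0 1 ` mutated L \<longleftrightarrow> v \<in> mutated (reflect ` L)"
    unfolding v reflect_iff shear_iff mutated_iff by auto
qed

text \<open>Every lattice point that a functional increasing to the right minimises, that is every vertex of
  the left boundary chain, survives the mutation.\<close>

definition wide :: "(int \<times> int) set \<Rightarrow> bool" where
  "wide L \<longleftrightarrow> (\<forall>a b :: real. \<forall>X Y. 0 < a \<longrightarrow> (X, Y) \<in> L \<longrightarrow> Y < 0 \<longrightarrow>
     (\<forall>X' Y'. (X', Y') \<in> L \<longrightarrow> a * of_int X + b * of_int Y \<le> a * of_int X' + b * of_int Y') \<longrightarrow> (X - Y, Y) \<in> L)"

lemma wide_minimizer: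
  fixes a b :: real
  assumes "wide L" "0 < a" "(X, Y) \<in> L"
    "\<And>X' Y'. (X', Y') \<in> L \<Longrightarrow> a * of_int X + b * of_int Y \<le> a * of_int X' + b * of_int Y'"
  shows "(X, Y) \<in> mutated L"
proof (cases "Y < 0")
  case True
  then have "(X - Y, Y) \<in> L" using assms unfolding wide_def by blast
  then show ?thesis using True assms(3) by (simp add: mutated_iff)
qed (use assms(3) in \<open>simp add: mutated_iff\<close>)

lemma finite_minimizer:
  fixes a b :: real and L :: "(int \<times> int) set"
  assumes "finite L" "L \<noteq> {}"
  obtains X Y where "(X, Y) \<in> L"
    "\<And>X' Y'. (X', Y') \<in> L \<Longrightarrow> a * of_int X + b * of_int Y \<le> a * of_int X' + b * of_int Y'"
proof -
  define f where "f = (\<lambda>(X, Y). a * real_of_int X + b * real_of_int Y)"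
  have "Min (f ` L) \<in> f ` L" using assms by (intro Min_in) auto
  then obtain X Y where XY: "(X, Y) \<in> L" "f (X, Y) = Min (f ` L)" by auto
  have "f (X, Y) \<le> f (X', Y')" if "(X', Y') \<in> L" for X' Y'
    unfolding XY(2) using assms that by (intro Min_le) auto
  then show thesis using XY(1) that by (simp add: f_def)
qed

text \<open>For a functional that increases to the right, the points added at heights
  \<open>Y \<ge> 0\<close> are shifted copies that cannot lower the minimum, and the minimisers
  survive because \<open>L\<close> is wide. So \<open>L\<close> and the mutated set have the same
  face.\<close>

lemma lattice_edge_mutated_left:
  assumes fin: "finite L" and ne: "L \<noteq> {}" and w: "wide L" and a: "0 < a"
    and e: "lattice_edge (mutated L) a b x y k"
  shows "lattice_edge L a b x y k"
proof -
  obtain X0 Y0 where 0: "(X0, Y0) \<in> L" and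
    m: "\<And>X Y. (X, Y) \<in> L \<Longrightarrow> real_of_int a * of_int X0 + real_of_int b * of_int Y0 \<le> real_of_int a * of_int X + real_of_int b * of_int Y"
    using finite_minimizer[OF fin ne] by metis
  have a': "0 < real_of_int a" using a by simp
  have min0: "a * X0 + b * Y0 \<le> a * X + b * Y" if "(X, Y) \<in> L" for X Y
  proof -
    have "real_of_int (a * X0 + b * Y0) \<le> real_of_int (a * X + b * Y)" using m[OF that] by simp
    then show ?thesis by (simp only: of_int_le_iff)
  qed
  have inL': "(X, Y) \<in> mutated L" if "(X, Y) \<in> L" "a * X + b * Y = a * X0 + b * Y0" for X Y
  proof (rule wide_minimizer[OF w a' that(1)])
    fix X' Y' assume "(X', Y') \<in> L"
    then have "a * X + b * Y \<le> a * X' + b * Y'" using min0 that(2) by simp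
    then have "real_of_int (a * X + b * Y) \<le> real_of_int (a * X' + b * Y')" by (simp only: of_int_le_iff)
    then show "real_of_int a * of_int X + real_of_int b * of_int Y \<le> real_of_int a * of_int X' + real_of_int b * of_int Y'" by simp
  qed
  have dom: "a * X0 + b * Y0 \<le> a * X + b * Y" if "(X, Y) \<in> mutated L" for X Y
  proof (cases "(X, Y) \<in> L")
    case False
    then have "(X - Y, Y) \<in> L" "0 \<le> Y" using that by (auto simp: mutated_iff split: if_splits)
    moreover have "a * (X - Y) \<le> a * X" using a \<open>0 \<le> Y\<close> by (intro mult_left_mono) auto
    ultimately show ?thesis using min0 by fastforce
  qed (rule min0)
  have inL: "(X, Y) \<in> L" if "(X, Y) \<in> mutated L" "a * X + b * Y = a * X0 + b * Y0" for X Y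
  proof (rule ccontr)
    assume n: "(X, Y) \<notin> L"
    then have 1: "(X - Y, Y) \<in> L" "0 \<le> Y" using that by (auto simp: mutated_iff split: if_splits)
    have "0 \<le> a * - Y" using min0[OF 1(1)] that(2) by (simp add: algebra_simps)
    then have "Y = 0" using a 1(2) by (simp add: mult_le_0_iff)
    then show False using n 1 by simp
  qed
  have val: "a * x + b * y = a * X0 + b * Y0"
    using lattice_edge_ge[OF e inL'[OF 0 refl]] dom[OF lattice_edgeD(3)[OF e]] by simp
  show ?thesis
  proof (rule lattice_edgeI)
    show "coprime a b" "0 < k" using lattice_edgeD[OF e] by auto
    show "(x, y) \<in> L" by (rule inL[OF lattice_edgeD(3)[OF e] val])
    show "(x + k * b, y - k * a) \<in> L" by (rule inL[OF lattice_edgeD(4)[OF e]]) (use val in \<open>simp add: algebra_simps\<close>)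
    fix X Y assume XY: "(X, Y) \<in> L"
    show "a * x + b * y \<le> a * X + b * Y" unfolding val by (rule min0[OF XY])
    assume eq: "a * X + b * Y = a * x + b * y"
    show "\<exists>s. 0 \<le> s \<and> s \<le> k \<and> X = x + s * b \<and> Y = y - s * a"
      using lattice_edge_eq[OF e inL'[OF XY] eq] eq val by metis
  qed
qed

lemma lattice_edge_mutated_right:
  assumes fin: "finite L" and ne: "L \<noteq> {}" and w: "wide (reflect ` L)" and a: "a < 0"
    and e: "lattice_edge (mutated L) a b x y k"
  shows "lattice_edge L a (a + b) (x - y) y k"
proof -
  have det: "1 * 1 - (- 1) * 0 = (1 :: int)" by simp
  have "lattice_edge (lmap 1 (- 1) 0 1 ` mutated L) a (a + b) (x - y) y k"
    using lattice_edge_lmap[OF det e] by (simp add: add.commute)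
  note lattice_edge_reflect[OF this, unfolded mutated_reflect]
  then have "lattice_edge (reflect ` L) (- a) (a + b) (- (x - y + k * (a + b))) (y - k * a) k"
    by (rule lattice_edge_mutated_left[rotated -1]) (use fin ne w a in auto)
  from lattice_edge_reflect[OF this] show ?thesis by simp
qed

lemma surrounds_origin_mutated:
  assumes L: "surrounds_origin L" and w: "wide L" "wide (reflect ` L)"
    and bot: "(X0, Y0) \<in> mutated L" "Y0 < 0"
  shows "surrounds_origin (mutated L)"
  unfolding surrounds_origin_def
proof (intro conjI allI impI)
  have fin: "finite L" using L by (simp add: surrounds_origin_def)
  have "mutated L \<subseteq> L \<union> (\<lambda>(X, Y). (X + Y, Y)) ` L"
  proof
    fix v assume v: "v \<in> mutated L"
    obtain X Y where XY: "v = (X, Y)" by fastforce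
    have "(X, Y) \<in> L \<or> (X - Y, Y) \<in> L" using v unfolding XY mutated_iff by (auto split: if_splits)
    then show "v \<in> L \<union> (\<lambda>(X, Y). (X + Y, Y)) ` L" unfolding XY by force
  qed
  then show "finite (mutated L)" by (rule finite_subset) (use fin in auto)
  fix a b :: real assume ab: "(a, b) \<noteq> (0, 0)"
  have pos: "\<exists>X Y. (X, Y) \<in> mutated L' \<and> a * of_int X + b * of_int Y < 0"
    if a: "0 < a" and L': "surrounds_origin L'" "wide L'" for a b :: real and L'
  proof -
    have "(a, b) \<noteq> (0, 0)" using a by simp
    then obtain X Y where XY: "(X, Y) \<in> L'" "a * of_int X + b * of_int Y < 0" using L'(1) unfolding surrounds_origin_def by blast
    have "finite L'" "L' \<noteq> {}" using L'(1) XY by (auto simp: surrounds_origin_def)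
    then obtain X1 Y1 where 1: "(X1, Y1) \<in> L'"
      "\<And>X' Y'. (X', Y') \<in> L' \<Longrightarrow> a * of_int X1 + b * of_int Y1 \<le> a * of_int X' + b * of_int Y'"
      by (rule finite_minimizer[of L' a b]) blast
    have "(X1, Y1) \<in> mutated L'" by (rule wide_minimizer[OF L'(2) a 1])
    then show ?thesis using 1(2)[OF XY(1)] XY(2) by (intro exI[of _ X1] exI[of _ Y1]) simp
  qed
  consider "0 < a" | "a < 0" | "a = 0" "0 < b" | "a = 0" "b < 0" using ab by fastforce
  then show "\<exists>X Y. (X, Y) \<in> mutated L \<and> a * of_int X + b * of_int Y < 0"
  proof cases
    case 1
    then show ?thesis using pos L w by blast
  next
    case 2
    have "surrounds_origin (reflect ` L)"
      unfolding surrounds_origin_def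
    proof (intro conjI allI impI)
      fix a b :: real assume "(a, b) \<noteq> (0, 0)"
      then have "(- a, b) \<noteq> (0, 0)" by simp
      then obtain X Y where "(X, Y) \<in> L" "- a * of_int X + b * of_int Y < 0" using L unfolding surrounds_origin_def by blast
      then show "\<exists>X Y. (X, Y) \<in> reflect ` L \<and> a * of_int X + b * of_int Y < 0"
        by (intro exI[of _ "- X"] exI[of _ Y]) simp
    qed (use fin in simp)
    then obtain X Y where XY: "(X, Y) \<in> mutated (reflect ` L)" "- a * of_int X + (b + a) * of_int Y < 0"
      using pos[of "- a" "reflect ` L" "b + a"] 2 w by auto
    have "(- X + Y, Y) \<in> mutated L" using XY(1) unfolding mutated_reflect[symmetric] reflect_iff shear_iff .
    then show ?thesis using XY(2) by (intro exI[of _ "- X + Y"] exI[of _ Y]) (simp add: algebra_simps)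
  next
    case 3
    have "b * of_int Y0 < 0" using 3 bot(2) by (simp add: mult_pos_neg)
    then show ?thesis using bot(1) 3 by (intro exI[of _ X0] exI[of _ Y0]) simp
  next
    case 4
    obtain X Y where XY: "(X, Y) \<in> L" "a * of_int X + b * of_int Y < 0" using L ab unfolding surrounds_origin_def by blast
    have "0 < Y" using XY(2) 4 by (simp add: mult_less_0_iff)
    then have "(X, Y) \<in> mutated L" using XY by (simp add: mutated_iff)
    then show ?thesis using XY(2) by blast
  qed
qed

lemma convex_row:
  assumes "convex P" "(p, c) \<in> P" "(q, c) \<in> P" "p \<le> z" "z \<le> (q :: real)"
  shows "(z, c :: real) \<in> P"
proof (cases "p = q")
  case False
  then have pq: "p < q" using assms by simp
  define t where "t = (z - p) / (q - p)"
  have t: "0 \<le> t" "t \<le> 1" using assms pq by (auto simp: t_def)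
  have "(1 - t) *\<^sub>R (p, c) + t *\<^sub>R (q, c) \<in> P" using assms(1-3) t by (intro convexD) auto
  moreover have "t * (q - p) = z - p" using pq by (simp add: t_def)
  then have "(1 - t) *\<^sub>R (p, c) + t *\<^sub>R (q, c) = (z, c)" by (simp add: algebra_simps)
  ultimately show ?thesis by simp
qed (use assms in auto)

lemma convex_scale_row:
  assumes "convex P" "0 \<in> P" "pt (x, - r) \<in> P" "0 < r" "- r \<le> Y" "Y < 0"
  shows "(of_int (- Y * x) / of_int r, of_int Y) \<in> P"
proof -
  define t where "t = of_int (- Y) / real_of_int r"
  have "0 \<le> real_of_int (- Y)" "real_of_int (- Y) \<le> of_int r" "0 < real_of_int r" using assms(4-6) by simp_all
  then have t: "0 \<le> t" "t \<le> 1" unfolding t_def by (simp_all only: divide_le_eq_1_pos divide_nonneg_pos)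
  have "(1 - t) *\<^sub>R 0 + t *\<^sub>R pt (x, - r) \<in> P" using assms t by (intro convexD) auto
  then show ?thesis using assms(4) by (simp add: t_def)
qed

section \<open>Polygons with a long bottom edge\<close>

locale bottom_edge =
  fixes P :: "plane set" and x r k :: int
  assumes P: "fano_polygon P"
    and e: "lattice_edge (lat P) 0 1 x (- r) k"
    and long: "r \<le> k"
begin

lemma convex_P: "convex P" and zero_P: "0 \<in> P" and finite_lat_P: "finite (lat P)"
  using fano_polygonD[OF P] P interior_subset by (auto simp: fano_polygon_def)

lemma r_pos: "0 < r"
  using lattice_edge_height_pos[OF fano_polygonD(6)[OF P] e] by simp

lemma bottom_le: "p \<in> P \<Longrightarrow> - real_of_int r \<le> snd p"
  using lattice_edge_hull(1)[OF e, unfolded fano_polygonD(5)[OF P]] by (cases p) auto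

lemma bottom_le_int: "(X, Y) \<in> lat P \<Longrightarrow> - r \<le> Y"
  using lattice_edge_ge[OF e] by fastforce

lemma left_end: "- r \<le> Y \<Longrightarrow> Y < 0 \<Longrightarrow> (of_int (- Y * x) / of_int r, of_int Y) \<in> P"
  using convex_scale_row[OF convex_P zero_P _ r_pos] lattice_edgeD(3)[OF e] by (simp only: lat_iff)

lemma right_end: "- r \<le> Y \<Longrightarrow> Y < 0 \<Longrightarrow> (of_int (- Y * (x + k)) / of_int r, of_int Y) \<in> P"
  using convex_scale_row[OF convex_P zero_P _ r_pos, of "x + k"] lattice_edgeD(4)[OF e] by simp

text \<open>At height \<open>Y < 0\<close> the cone over the bottom edge has width - Y k / r, which
  is at least - Y because \<open>r \<le> k\<close>. Hence every lower row has room for the translate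
  that the mutation removes.\<close>

lemma row_length:
  assumes "Y < 0"
  shows "of_int (- Y * x) / of_int r - of_int Y \<le> real_of_int (- Y * (x + k)) / of_int r"
proof -
  have "- Y * r \<le> - Y * k" using assms long by (intro mult_left_mono) auto
  then have "- Y * x - Y * r \<le> - Y * (x + k)" by (simp add: algebra_simps)
  then have "real_of_int (- Y * x - Y * r) \<le> real_of_int (- Y * (x + k))" by (simp only: of_int_le_iff)
  then have "real_of_int (- Y * x - Y * r) / of_int r \<le> real_of_int (- Y * (x + k)) / of_int r"
    using r_pos by (intro divide_right_mono) auto
  moreover have "real_of_int (- Y * x - Y * r) / of_int r = of_int (- Y * x) / of_int r - of_int Y"
    using r_pos by (simp add: field_simps)
  ultimately show ?thesis by simp
qed

lemma shift_right:
  assumes "(X, Y) \<in> lat P" "Y < 0" "of_int X \<le> real_of_int (- Y * x) / of_int r"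
  shows "(X - Y, Y) \<in> lat P"
proof -
  note Y = bottom_le_int[OF assms(1)]
  have "(of_int X - of_int Y, of_int Y) \<in> P"
    by (rule convex_row[OF convex_P _ right_end[OF Y assms(2)]])
      (use assms row_length[OF assms(2)] in auto)
  then show ?thesis by simp
qed

lemma shift_left:
  assumes "(X, Y) \<in> lat P" "Y < 0" "real_of_int (- Y * (x + k)) / of_int r \<le> of_int X"
  shows "(X + Y, Y) \<in> lat P"
proof -
  note Y = bottom_le_int[OF assms(1)]
  have "(of_int X + of_int Y, of_int Y) \<in> P"
    by (rule convex_row[OF convex_P left_end[OF Y assms(2)]])
      (use assms row_length[OF assms(2)] in auto)
  then show ?thesis by simp
qed

lemma lat_minimizer:
  fixes a b :: real
  assumes "\<And>X' Y'. (X', Y') \<in> lat P \<Longrightarrow> m \<le> a * of_int X' + b * of_int Y'" "(p, q) \<in> P"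
  shows "m \<le> a * p + b * q"
proof -
  have "pt ` lat P \<subseteq> {z. m \<le> (a, b) \<bullet> z}" using assms(1) by auto
  then have "convex hull (pt ` lat P) \<subseteq> {z. m \<le> (a, b) \<bullet> z}"
    by (rule hull_minimal) (simp add: convex_halfspace_ge)
  then show ?thesis using assms(2) unfolding fano_polygonD(5)[OF P] by auto
qed

text \<open>A minimiser is not to the right of the left end of the cone in its row, so a step of
  length - Y to the right does not pass the right end.\<close>

lemma wide_lat: "wide (lat P)"
  unfolding wide_def
proof (intro allI impI)
  fix a b :: real and X Y
  assume a: "0 < a" and XY: "(X, Y) \<in> lat P" "Y < 0"
    and m: "\<forall>X' Y'. (X', Y') \<in> lat P \<longrightarrow> a * of_int X + b * of_int Y \<le> a * of_int X' + b * of_int Y'"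
  have "a * of_int X + b * of_int Y \<le> a * (of_int (- Y * x) / of_int r) + b * of_int Y"
    by (rule lat_minimizer[OF _ left_end[OF bottom_le_int[OF XY(1)] XY(2)]]) (use m in blast)
  then have "a * of_int X \<le> a * (real_of_int (- Y * x) / of_int r)" by (simp only: add_le_cancel_right)
  then have "of_int X \<le> real_of_int (- Y * x) / of_int r" using a by (simp only: mult_le_cancel_left_pos)
  then show "(X - Y, Y) \<in> lat P" by (rule shift_right[OF XY])
qed

lemma wide_reflect_lat: "wide (reflect ` lat P)"
  unfolding wide_def
proof (intro allI impI)
  fix a b :: real and X Y
  assume a: "0 < a" and XY: "(X, Y) \<in> reflect ` lat P" "Y < 0"
    and m: "\<forall>X' Y'. (X', Y') \<in> reflect ` lat P \<longrightarrow> a * of_int X + b * of_int Y \<le> a * of_int X' + b * of_int Y'"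
  have XY': "(- X, Y) \<in> lat P" using XY(1) by (simp only: reflect_iff)
  have "a * of_int X + b * of_int Y \<le> (- a) * (of_int (- Y * (x + k)) / of_int r) + b * of_int Y"
  proof (rule lat_minimizer[OF _ right_end[OF bottom_le_int[OF XY'] XY(2)]])
    fix X' Y' assume "(X', Y') \<in> lat P"
    then have "(- X', Y') \<in> reflect ` lat P" by (simp only: reflect_iff minus_minus)
    then have "a * of_int X + b * of_int Y \<le> a * of_int (- X') + b * of_int Y'" using m by blast
    then show "a * of_int X + b * of_int Y \<le> - a * of_int X' + b * of_int Y'" by simp
  qed
  then have "a * (real_of_int (- Y * (x + k)) / of_int r) \<le> a * of_int (- X)" by simp
  then have "real_of_int (- Y * (x + k)) / of_int r \<le> of_int (- X)" using a by (simp only: mult_le_cancel_left_pos)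
  then have "(- X + Y, Y) \<in> lat P" by (rule shift_left[OF XY' XY(2)])
  then show "(X - Y, Y) \<in> reflect ` lat P" unfolding reflect_iff by (simp only: minus_diff_eq uminus_add_conv_diff)
qed

lemma bottom_row: "(X, - r) \<in> lat P \<longleftrightarrow> x \<le> X \<and> X \<le> x + k"
proof
  assume "(X, - r) \<in> lat P"
  then obtain s where "0 \<le> s" "s \<le> k" "X = x + s * 1" "- r = - r - s * 0" by (rule lattice_edge_eq[OF e]) simp
  then show "x \<le> X \<and> X \<le> x + k" by simp
next
  assume X: "x \<le> X \<and> X \<le> x + k"
  have "(of_int X, real_of_int (- r)) \<in> P"
    by (rule convex_row[OF convex_P, of "of_int x" _ "of_int (x + k)"]) (use X lattice_edgeD(3,4)[OF e] in simp_all)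
  then show "(X, - r) \<in> lat P" by simp
qed

lemma mutated_bottom_row: "(X, - r) \<in> mutated (lat P) \<longleftrightarrow> x \<le> X \<and> X \<le> x + k - r"
  unfolding mutated_iff bottom_row using r_pos by (auto simp: bottom_row[of "X + r"] simp del: lat_iff)

lemma mutated_surrounds: "surrounds_origin (mutated (lat P))"
  by (rule surrounds_origin_mutated[OF fano_polygonD(6)[OF P] wide_lat wide_reflect_lat, of x "- r"])
    (use mutated_bottom_row[of x] r_pos long in auto)

lemma lat_ne: "lat P \<noteq> {}"
  using lattice_edgeD(3)[OF e] by blast

text \<open>An edge of the mutated set lies in the unchanged left chain, in the sheared right chain,
  at the bottom, shortened by \<open>r\<close>, or at the top, lengthened by its height. The old top
  may be a single vertex, \<open>X1 = X2\<close>, and then the top edge is new.\<close>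

lemma mutated_edge_cases:
  assumes f: "lattice_edge (mutated (lat P)) a b x' y' k'"
  obtains "0 < a" "lattice_edge (lat P) a b x' y' k'"
  | "a < 0" "lattice_edge (lat P) a (a + b) (x' - y') y' k'"
  | "a = 0" "b = 1" "x' = x" "y' = - r" "k' = k - r"
  | X1 X2 where "a = 0" "b = - 1" "0 < y'" "x' = X2 + y'" "k' = X2 - X1 + y'" "coprime X2 y'"
      "X1 = X2 \<or> lattice_edge (lat P) 0 (- 1) X2 y' (X2 - X1)"
proof -
  have "a = 0 \<Longrightarrow> b = 1 \<or> b = - 1" using lattice_edgeD(1)[OF f] by auto
  then consider "0 < a" | "a < 0" | "a = 0" "b = 1" | "a = 0" "b = - 1" by linarith
  then show thesis
  proof cases
    case 1
    then show thesis using lattice_edge_mutated_left[OF finite_lat_P lat_ne wide_lat 1 f] that(1) by blast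
  next
    case 2
    then show thesis using lattice_edge_mutated_right[OF finite_lat_P lat_ne wide_reflect_lat 2 f] that(2) by blast
  next
    case 3
    have lx: "(x, - r) \<in> mutated (lat P)" and rx: "(x + k - r, - r) \<in> mutated (lat P)"
      using mutated_bottom_row long by auto
    have "y' \<le> - r" using lattice_edge_ge[OF f lx] 3 by simp
    moreover have "- r \<le> y'"
    proof -
      have "(x', y') \<in> lat P \<or> (x' - y', y') \<in> lat P"
        using lattice_edgeD(3)[OF f] unfolding mutated_iff by (auto split: if_splits)
      then show ?thesis using bottom_le_int by blast
    qed
    ultimately have y: "y' = - r" by simp
    have "x \<le> x'" using lattice_edgeD(3)[OF f] unfolding y mutated_bottom_row by simp
    moreover have "x' + k' \<le> x + k - r" using lattice_edgeD(4)[OF f] 3 unfolding y mutated_bottom_row[of "x' + k'", symmetric] by (simp add: mutated_bottom_row)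
    moreover have "x' \<le> x"
      by (rule lattice_edge_eq[OF f lx]) (use 3 y in auto)
    moreover have "x + k - r \<le> x' + k'"
      by (rule lattice_edge_eq[OF f rx]) (use 3 y in auto)
    ultimately show thesis using that(3) 3 y by simp
  next
    case 4
    have top: "Y \<le> y'" if "(X, Y) \<in> lat P" for X Y
    proof (cases "Y < 0")
      case True
      obtain X0 Y0 where "(X0, Y0) \<in> mutated (lat P)" "0 * X0 + (- 1) * Y0 < 0"
        by (rule surrounds_origin_int[OF mutated_surrounds, of 0 "- 1"]) auto
      then show ?thesis using lattice_edge_ge[OF f, of X0 Y0] 4 True by simp
    next
      case False
      then have "(X, Y) \<in> mutated (lat P)" using that by (simp add: mutated_iff)
      then show ?thesis using lattice_edge_ge[OF f] 4 by fastforce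
    qed
    have y0: "0 < y'" using lattice_edge_height_pos[OF mutated_surrounds f] 4 by simp
    define T where "T = {X. (X, y') \<in> lat P}"
    have "T \<subseteq> fst ` lat P"
    proof
      fix X assume "X \<in> T"
      then have "(X, y') \<in> lat P" unfolding T_def by (rule CollectD)
      then show "X \<in> fst ` lat P" by (rule rev_image_eqI) simp
    qed
    then have finT: "finite T" using finite_lat_P by (rule finite_subset[OF _ finite_imageI])
    have "(x', y') \<in> mutated (lat P)" using lattice_edgeD(3)[OF f] .
    then have neT: "T \<noteq> {}" using y0 unfolding mutated_iff T_def by (auto split: if_splits simp del: lat_iff)
    define X1 where "X1 = Min T"
    define X2 where "X2 = Max T"
    have X12: "X1 \<in> T" "X2 \<in> T" "\<And>X. X \<in> T \<Longrightarrow> X1 \<le> X \<and> X \<le> X2"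
      unfolding X1_def X2_def using finT neT by auto
    have inT: "(X, y') \<in> mutated (lat P) \<longleftrightarrow> X \<in> T \<or> X - y' \<in> T" for X
      using y0 by (simp add: mutated_iff T_def)
    have 1: "x' \<le> X2 + y'" using lattice_edgeD(3)[OF f] y0 X12(3)[of x'] X12(3)[of "x' - y'"] unfolding inT by auto
    have "(x' + k' * b, y' - k' * a) = (x' - k', y')" unfolding 4 by simp
    then have "(x' - k', y') \<in> mutated (lat P)" using lattice_edgeD(4)[OF f] by (simp only:)
    then have 2: "X1 \<le> x' - k'" using y0 X12(3)[of "x' - k'"] X12(3)[of "x' - k' - y'"] unfolding inT by auto
    have i1: "(X1, y') \<in> mutated (lat P)" and i2: "(X2 + y', y') \<in> mutated (lat P)" using X12 unfolding inT by auto
    have 3: "X2 + y' \<le> x'" by (rule lattice_edge_eq[OF f i2]) (use 4 in auto)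
    have 5: "x' - k' \<le> X1" by (rule lattice_edge_eq[OF f i1]) (use 4 in auto)
    have edge: "X1 = X2 \<or> lattice_edge (lat P) 0 (- 1) X2 y' (X2 - X1)"
    proof (cases "X1 = X2")
      case False
      have "X1 < X2" using X12(3)[OF X12(2)] False by simp
      have "lattice_edge (lat P) 0 (- 1) X2 y' (X2 - X1)"
      proof (rule lattice_edgeI)
        show "(X2, y') \<in> lat P" "(X2 + (X2 - X1) * - 1, y' - (X2 - X1) * 0) \<in> lat P"
          using X12 by (simp_all add: T_def)
        fix X Y assume XY: "(X, Y) \<in> lat P"
        show "0 * X2 + - 1 * y' \<le> 0 * X + - 1 * Y" using top[OF XY] by simp
        assume "0 * X + - 1 * Y = 0 * X2 + - 1 * y'"
        then have "Y = y'" by simp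
        then show "\<exists>s. 0 \<le> s \<and> s \<le> X2 - X1 \<and> X = X2 + s * - 1 \<and> Y = y' - s * 0"
          using X12(3)[of X] XY by (intro exI[of _ "X2 - X"]) (auto simp: T_def)
      qed (use \<open>X1 < X2\<close> in auto)
      then show ?thesis ..
    qed simp
    \<comment> \<open>The top of \<open>P\<close> need not contain a horizontal edge, so primitivity
      of its right end is read off from the edge that ends there.\<close>
    have cop: "coprime X2 y'"
    proof -
      obtain a3 b3 x3 y3 k3 where e3: "lattice_edge (lat P) a3 b3 x3 y3 k3" "X2 = x3 + k3 * b3" "y' = y3 - k3 * a3"
      proof (rule prev_edge[OF finite_lat_P, of X2 y' 0 "- 1" x "- r"])
        fix X Y assume XY: "(X, Y) \<in> lat P"
        show "0 * X2 + - 1 * y' \<le> 0 * X + - 1 * Y" using top[OF XY] by simp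
        assume "0 * X + - 1 * Y = 0 * X2 + - 1 * y'"
        then show "- 1 * X2 - 0 * y' \<le> - 1 * X - 0 * Y" using X12(3)[of X] XY by (simp add: T_def)
      qed (use X12 lattice_edgeD(3)[OF e] r_pos y0 that in \<open>auto simp: T_def\<close>)
      then show ?thesis using fano_polygon_coprime(2)[OF P e3(1)] by simp
    qed
    show thesis by (rule that(4)[OF _ _ y0 _ _ cop edge]) (use 4 1 2 3 5 in auto)
  qed
qed

abbreviation mutant :: "plane set" where
  "mutant \<equiv> convex hull (pt ` mutated (lat P))"

lemma fano_polygon_mutated: "fano_polygon mutant"
proof (rule fano_polygonI[OF mutated_surrounds])
  fix a b x' y' k' assume f: "lattice_edge (mutated (lat P)) a b x' y' k'"
  show "coprime x' y'"
  proof (rule mutated_edge_cases[OF f])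
    assume "lattice_edge (lat P) a b x' y' k'"
    then show ?thesis by (rule fano_polygon_coprime(1)[OF P])
  next
    assume "lattice_edge (lat P) a (a + b) (x' - y') y' k'"
    then have "coprime (x' - y') y'" by (rule fano_polygon_coprime(1)[OF P])
    from coprime_lmap[OF _ this, of 1 1 1 0] show ?thesis by simp
  next
    assume "x' = x" "y' = - r"
    then show ?thesis using fano_polygon_coprime(1)[OF P e] by simp
  next
    fix X1 X2 assume "x' = X2 + y'" "coprime X2 y'"
    from coprime_lmap[OF _ this(2), of 1 1 1 0] this(1) show ?thesis by simp
  qed
qed

end

section \<open>Agreement with the geometric definition of mutation\<close>

lemma dilate_segment:
  assumes "0 \<le> c"
  shows "dilate c (convex hull {0, pt (1, 0)}) = convex hull {0, pt (c, 0)}"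
  unfolding dilate_def convex_hull_scaling[symmetric] by (simp add: zero_prod_def)

lemma slice_horizontal: "slice P (pt (0, 1)) h = convex hull (pt ` {v \<in> lat P. snd v = h})"
proof -
  have "{v \<in> P \<inter> lattice. pt (0, 1) \<bullet> v = of_int h} = pt ` {v \<in> lat P. snd v = h}"
    unfolding pt_image_lat[symmetric] by auto
  then show ?thesis unfolding slice_def by simp
qed

lemma pt_sum_segment:
  "pt ` A + {0, pt (c, 0)} = pt ` (A \<union> (\<lambda>(X, Y). (X + c, Y)) ` A)"
proof -
  have "pt v + pt (c, 0) = pt ((\<lambda>(X, Y). (X + c, Y)) v)" for v by (cases v) simp
  moreover have "B + {0, p} = B \<union> (\<lambda>q. q + p) ` B" for B :: "plane set" and p
    by (auto simp: set_plus_def)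
  ultimately show ?thesis by (simp add: image_image image_Un)
qed

text \<open>An edge whose length is divisible by its height has no residual segment; thus
  \<open>H\<close> bounds the heights of all residual cones.\<close>

definition residual_heights_le :: "int \<Rightarrow> (int \<times> int) set \<Rightarrow> bool" where
  "residual_heights_le H L \<longleftrightarrow> (\<forall>a b x y k. lattice_edge L a b x y k \<longrightarrow>
     - (a * x + b * y) \<le> H \<or> - (a * x + b * y) dvd k)"

context bottom_edge
begin

lemma bdd_image: "bdd_above ((\<bullet>) (pt (0, 1)) ` P)" "bdd_below ((\<bullet>) (pt (0, 1)) ` P)"
proof -
  have "bounded ((\<bullet>) (pt (0, 1)) ` P)"
    using fano_polygonD(3)[OF P] by (rule bounded_linear_image) (rule bounded_linear_inner_right)
  then show "bdd_above ((\<bullet>) (pt (0, 1)) ` P)" "bdd_below ((\<bullet>) (pt (0, 1)) ` P)"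
    by (auto intro: bounded_imp_bdd_above bounded_imp_bdd_below)
qed

lemma h_bounds:
  assumes "(X, Y) \<in> lat P"
  shows "h_min P (pt (0, 1)) \<le> of_int Y" "of_int Y \<le> h_max P (pt (0, 1))"
proof -
  have p: "pt (X, Y) \<in> P" and Y: "pt (0, 1) \<bullet> pt (X, Y) = of_int Y" using assms by auto
  show "h_min P (pt (0, 1)) \<le> of_int Y" unfolding h_min_def Y[symmetric] by (rule cINF_lower[OF bdd_image(2) p])
  show "of_int Y \<le> h_max P (pt (0, 1))" unfolding h_max_def Y[symmetric] by (rule cSUP_upper[OF p bdd_image(1)])
qed

text \<open>A vertex is never strictly inside the segment that the cone over the bottom edge cuts
  out of its row. From either side of this segment a step of length - Y towards it stays in the
  row.\<close>

lemma extreme_point_shift: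
  assumes ex: "pt (X, Y) extreme_point_of P" and Y: "Y < 0"
  shows "(X - Y, Y) \<in> lat P \<or> (X + Y, Y) \<in> lat P"
proof -
  have XY: "(X, Y) \<in> lat P" using ex by (simp add: extreme_point_of_def)
  note Yr = bottom_le_int[OF XY]
  define p where "p = real_of_int (- Y * x) / of_int r"
  define q where "q = real_of_int (- Y * (x + k)) / of_int r"
  consider "of_int X \<le> p" | "q \<le> of_int X" | "p < of_int X" "of_int X < q" by linarith
  then show ?thesis
  proof cases
    case 1 then show ?thesis using shift_right[OF XY Y] by (simp add: p_def)
  next
    case 2 then show ?thesis using shift_left[OF XY Y] by (simp add: q_def)
  next
    case 3
    define t where "t = (of_int X - p) / (q - p)"
    have t: "0 < t" "t < 1" using 3 by (simp_all add: t_def)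
    have "t * (q - p) = of_int X - p" using 3 by (simp add: t_def)
    then have "pt (X, Y) = (1 - t) *\<^sub>R (p, of_int Y) + t *\<^sub>R (q, of_int Y)" by (simp add: algebra_simps)
    then have "pt (X, Y) \<in> open_segment (p, of_int Y) (q, of_int Y)" using t 3 unfolding in_segment by auto
    moreover have "(p, of_int Y) \<in> P" "(q, of_int Y) \<in> P"
      unfolding p_def q_def using left_end[OF Yr Y] right_end[OF Yr Y] .
    ultimately show ?thesis using ex unfolding extreme_point_of_def by blast
  qed
qed

lemma mutation_mutated: "mutation P mutant"
proof -
  define w where "w = pt (0, 1)"
  define F where "F = convex hull {0, pt (1, 0)}"
  \<comment> \<open>The largest admissible choice: all lattice points from which the translate of
    \<bar>h\<bar> F fits into the row at height \<open>h\<close>.\<close>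
  define A where "A h = {v \<in> lat P. snd v = h \<and> (fst v - h, h) \<in> lat P}" for h
  define B where "B h = {v \<in> lat P. snd v = h}" for h
  define G where "G h = convex hull (pt ` A h)" for h
  have fin: "finite (A h)" for h
    by (rule finite_subset[OF _ finite_lat_P]) (auto simp: A_def)
  have GF: "G h + dilate \<bar>h\<bar> F = convex hull (pt ` (A h \<union> (\<lambda>(X, Y). (X - h, Y)) ` A h))" if "h < 0" for h
    unfolding G_def F_def dilate_segment[OF abs_ge_zero] convex_hull_set_plus[symmetric] pt_sum_segment using that by simp
  have BF: "slice P w h + dilate h F = convex hull (pt ` (B h \<union> (\<lambda>(X, Y). (X + h, Y)) ` B h))" if "0 \<le> h" for h
    unfolding w_def F_def slice_horizontal B_def[symmetric] dilate_segment[OF that] convex_hull_set_plus[symmetric] pt_sum_segment ..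
  let ?U = "(\<Union>h \<in> {h. h_min P w \<le> of_int h \<and> h < 0}. G h) \<union>
            (\<Union>h \<in> {h. 0 \<le> h \<and> of_int h \<le> h_max P w}. slice P w h + dilate h F)"
  have "is_mut P w F mutant"
    unfolding is_mut_def
  proof (intro exI[of _ G] conjI allI impI)
    fix h :: int assume "h_min P w \<le> of_int h \<and> h < 0"
    then have h: "h < 0" by simp
    show "lattice_polytope (G h)" unfolding lattice_polytope_def G_def
      using fin[of h] range_pt by (intro exI[of _ "pt ` A h"]) auto
    show "G h + dilate \<bar>h\<bar> F \<subseteq> slice P w h"
      unfolding GF[OF h] w_def slice_horizontal by (intro hull_mono image_mono) (auto simp: A_def)
    show "{v. v extreme_point_of P \<and> w \<bullet> v = of_int h} \<subseteq> G h + dilate \<bar>h\<bar> F"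
      unfolding GF[OF h]
    proof
      fix v assume "v \<in> {v. v extreme_point_of P \<and> w \<bullet> v = of_int h}"
      then have v: "v extreme_point_of P" "w \<bullet> v = of_int h" by auto
      then have "primitive v" using P unfolding fano_polygon_def by blast
      then obtain X Y where XY: "v = pt (X, Y)" by (auto simp: primitive_def)
      then have Y: "Y = h" using v(2) by (simp add: w_def)
      have "(X, h) \<in> lat P" using v(1) unfolding XY Y by (simp add: extreme_point_of_def)
      moreover have "(X - h, h) \<in> lat P \<or> (X + h, h) \<in> lat P"
        using extreme_point_shift v(1) h unfolding XY Y by blast
      \<comment> \<open>The vertex is the left end of a translate or the right end of one, so it
        lies in the Minkowski sum in both cases.\<close>
      ultimately have "(X, h) \<in> A h \<or> (X + h, h) \<in> A h" by (auto simp: A_def simp del: lat_iff)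
      then have "(X, h) \<in> A h \<union> (\<lambda>(X, Y). (X - h, Y)) ` A h" by force
      then show "v \<in> convex hull (pt ` (A h \<union> (\<lambda>(X, Y). (X - h, Y)) ` A h))"
        unfolding XY Y by (intro hull_inc imageI)
    qed
  next
    show "mutant = convex hull ?U"
    proof
      have "pt ` mutated (lat P) \<subseteq> ?U"
      proof
        fix p assume "p \<in> pt ` mutated (lat P)"
        then obtain X Y where p: "p = pt (X, Y)" and XY: "(X, Y) \<in> mutated (lat P)" by force
        show "p \<in> ?U"
        proof (cases "Y < 0")
          case True
          then have A: "(X, Y) \<in> A Y" "(X, Y) \<in> lat P" using XY by (simp_all add: mutated_iff A_def)
          have "p \<in> G Y" unfolding p G_def by (intro hull_inc imageI A)
          then show ?thesis using True h_bounds(1)[OF A(2)] unfolding w_def by blast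
        next
          case False
          then have or: "(X, Y) \<in> lat P \<or> (X - Y, Y) \<in> lat P" using XY unfolding mutated_iff by presburger
          then have hm: "of_int Y \<le> h_max P w" unfolding w_def using h_bounds(2) by blast
          have "(X, Y) \<in> B Y \<or> (X - Y, Y) \<in> B Y" using or unfolding B_def by simp
          then have "(X, Y) \<in> B Y \<union> (\<lambda>(X', Y'). (X' + Y, Y')) ` B Y" by force
          then have "p \<in> slice P w Y + dilate Y F"
            unfolding BF[OF False[unfolded not_less]] p by (intro hull_inc imageI)
          then show ?thesis using False hm by auto
        qed
      qed
      then show "mutant \<subseteq> convex hull ?U" by (rule hull_mono)
      have "?U \<subseteq> mutant"
      proof (intro Un_least UN_least)
        fix h :: int assume "h \<in> {h. h_min P w \<le> of_int h \<and> h < 0}"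
        then show "G h \<subseteq> mutant"
          unfolding G_def by (intro hull_mono image_mono) (auto simp: A_def mutated_iff)
      next
        fix h :: int assume "h \<in> {h. 0 \<le> h \<and> of_int h \<le> h_max P w}"
        then have h: "0 \<le> h" by simp
        show "slice P w h + dilate h F \<subseteq> mutant"
          unfolding BF[OF h] using h by (intro hull_mono image_mono) (auto simp: B_def mutated_iff)
      qed
      then show "convex hull ?U \<subseteq> mutant"
        by (rule hull_minimal) simp
    qed
  qed
  moreover have "edge_segment 0 1 x (- r) k edge_of P"
    using edge_segment_edge_of[OF e] unfolding fano_polygonD(5)[OF P] .
  moreover have "inner_normal P (edge_segment 0 1 x (- r) k) w"
    unfolding w_def by (rule inner_normal_edge_segment[OF P e])
  moreover have "primitive (pt (1, 0))" by (auto simp: primitive_def intro: exI[of _ 1] exI[of _ 0])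
  moreover have "w \<bullet> pt (1, 0) = 0" by (simp add: w_def)
  ultimately show ?thesis unfolding mutation_def F_def by blast
qed

text \<open>Edges of the two side chains keep height and length. The bottom loses and the top gains
  exactly its own height in length, and a new top edge is as long as it is high, so divisibility is
  never lost.\<close>

lemma residual_heights_le_mutated:
  assumes "residual_heights_le H (lat P)"
  shows "residual_heights_le H (lat mutant)"
  unfolding residual_heights_le_def
proof (intro allI impI)
  note good = assms[unfolded residual_heights_le_def, rule_format]
  fix a b x' y' k' assume "lattice_edge (lat mutant) a b x' y' k'"
  then have f: "lattice_edge (mutated (lat P)) a b x' y' k'"
    by (rule lattice_edge_cong_hull[rotated]) (rule fano_polygonD(5)[OF fano_polygon_mutated])
  show "- (a * x' + b * y') \<le> H \<or> - (a * x' + b * y') dvd k'"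
  proof (rule mutated_edge_cases[OF f])
    assume "lattice_edge (lat P) a b x' y' k'"
    then show ?thesis by (rule good)
  next
    assume "lattice_edge (lat P) a (a + b) (x' - y') y' k'"
    from good[OF this] show ?thesis by (simp add: algebra_simps)
  next
    assume "a = 0" "b = 1" "x' = x" "y' = - r" "k' = k - r"
    then show ?thesis using good[OF e] by auto
  next
    fix X1 X2 assume *: "a = 0" "b = - 1" "k' = X2 - X1 + y'"
      "X1 = X2 \<or> lattice_edge (lat P) 0 (- 1) X2 y' (X2 - X1)"
    have "y' \<le> H \<or> y' dvd X2 - X1" using *(4) good[of 0 "- 1" X2 y' "X2 - X1"] by auto
    then show ?thesis using * by auto
  qed
qed

end

section \<open>Descent to minimal polygons\<close>

lemma card_int_interval:
  fixes l u :: real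
  assumes "l \<le> u"
  shows "int (card {X :: int. l \<le> of_int X \<and> of_int X \<le> u}) = \<lfloor>u\<rfloor> - \<lceil>l\<rceil> + 1"
proof -
  have "{X :: int. l \<le> of_int X \<and> of_int X \<le> u} = {\<lceil>l\<rceil>..\<lfloor>u\<rfloor>}"
    by (auto simp: ceiling_le_iff le_floor_iff)
  moreover have "\<lceil>l\<rceil> \<le> \<lfloor>u\<rfloor> + 1" using assms by linarith
  ultimately show ?thesis by simp
qed

lemma convex_compact_row:
  fixes P :: "plane set"
  assumes "convex P" "compact P" "(t0, c) \<in> P"
  obtains l u where "l \<le> u" "\<And>t. (t, c) \<in> P \<longleftrightarrow> l \<le> t \<and> t \<le> u"
proof -
  define T where "T = fst ` (P \<inter> {p. snd p = c})"
  have T: "t \<in> T \<longleftrightarrow> (t, c) \<in> P" for t unfolding T_def by force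
  have "closed {p :: plane. snd p = c}" by (intro closed_Collect_eq continuous_intros)
  then have "compact T" unfolding T_def
    using assms(2) by (intro compact_continuous_image continuous_intros compact_Int_closed)
  moreover have "T \<noteq> {}" using assms(3) T by blast
  ultimately obtain l u where lu: "l \<in> T" "u \<in> T" "\<forall>t\<in>T. l \<le> t" "\<forall>t\<in>T. t \<le> u"
    using compact_attains_inf[of T] compact_attains_sup[of T] by blast
  show thesis
  proof (rule that)
    show "l \<le> u" using lu by blast
    show "(t, c) \<in> P \<longleftrightarrow> l \<le> t \<and> t \<le> u" for t
      using lu convex_row[OF assms(1), of l c u t] T by blast
  qed
qed

text \<open>The set is the preimage under \<open>f\<close> of the sum of \<open>P\<close> and the
  ray in direction - v. It describes being on one side of the boundary of \<open>P\<close>, row by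
  row.\<close>

lemma convex_ray_sum:
  fixes P :: "plane set" and f :: "plane \<Rightarrow> plane"
  assumes "convex P" "linear f"
  shows "convex {p. \<exists>s\<ge>0. f p + s *\<^sub>R v \<in> P}"
  unfolding convex_def
proof (intro ballI allI impI CollectI)
  fix p q and a b :: real assume pq: "p \<in> {p. \<exists>s\<ge>0. f p + s *\<^sub>R v \<in> P}" "q \<in> {p. \<exists>s\<ge>0. f p + s *\<^sub>R v \<in> P}"
    and ab: "0 \<le> a" "0 \<le> b" "a + b = 1"
  then obtain s t where s: "0 \<le> s" "f p + s *\<^sub>R v \<in> P" and t: "0 \<le> t" "f q + t *\<^sub>R v \<in> P" by blast
  have "a *\<^sub>R (f p + s *\<^sub>R v) + b *\<^sub>R (f q + t *\<^sub>R v) \<in> P" by (rule convexD[OF assms(1) s(2) t(2) ab])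
  moreover have "a *\<^sub>R (f p + s *\<^sub>R v) + b *\<^sub>R (f q + t *\<^sub>R v) = f (a *\<^sub>R p + b *\<^sub>R q) + (a * s + b * t) *\<^sub>R v"
    by (simp add: linear_add[OF assms(2)] linear_scale[OF assms(2)] algebra_simps)
  ultimately show "\<exists>s\<ge>0. f (a *\<^sub>R p + b *\<^sub>R q) + s *\<^sub>R v \<in> P"
    using s t ab by (intro exI[of _ "a * s + b * t"]) auto
qed

text \<open>The rows h and - h cancel except for - r, whose partner r is left out. This deficit is
  the gain of the descent.\<close>

lemma sum_symmetric_interval: "(\<Sum>h\<in>{- r..<r}. h) = - r" if "0 \<le> r" for r :: int
proof -
  have "(\<Sum>h\<in>{- r..<r}. h) = (\<Sum>h\<in>{- r..<r}. - 1 - h)"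
    by (rule sum.reindex_bij_witness[of _ "\<lambda>h. - 1 - h" "\<lambda>h. - 1 - h"]) auto
  also have "\<dots> = - int (card {- r..<r}) - (\<Sum>h\<in>{- r..<r}. h)" by (simp add: sum_subtractf sum_negf)
  finally show ?thesis using that by simp
qed

lemma card_rows:
  fixes L :: "(int \<times> int) set"
  assumes "finite L" "finite I" "snd ` L \<subseteq> I"
  shows "card L = (\<Sum>h\<in>I. card {X. (X, h) \<in> L})"
proof -
  have "finite {X. (X, h) \<in> L}" for h
  proof -
    have "(\<lambda>X. (X, h)) ` {X. (X, h) \<in> L} \<subseteq> L" by auto
    then have "finite ((\<lambda>X. (X, h)) ` {X. (X, h) \<in> L})" using assms(1) finite_subset by blast
    then show ?thesis by (rule finite_imageD) (auto simp: inj_on_def)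
  qed
  then have "card (SIGMA h:I. {X. (X, h) \<in> L}) = (\<Sum>h\<in>I. card {X. (X, h) \<in> L})"
    using assms(2) by (intro card_SigmaI) auto
  moreover have "bij_betw prod.swap (SIGMA h:I. {X. (X, h) \<in> L}) L"
    using assms(3) by (intro bij_betw_byWitness[where f' = prod.swap]) auto
  ultimately show ?thesis using bij_betw_same_card by fastforce
qed

context bottom_edge
begin

text \<open>If [l, u] is the row of \<open>P\<close> at height \<open>q\<close>, the row of the
  mutant lies in [l, u + q]. The formulation by rays describes convex sets, so it has to be checked
  on the generating points only.\<close>

lemma mutated_hull_subset:
  assumes "(p, q) \<in> mutant"
  shows "\<exists>s\<ge>0. (p - s, q) \<in> P" "\<exists>s\<ge>0. (p - q + s, q) \<in> P"
proof -
  let ?A = "{p. \<exists>s\<ge>0. p + s *\<^sub>R (- 1, 0) \<in> P}"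
  let ?B = "{p. \<exists>s\<ge>0. (fst p - snd p, snd p) + s *\<^sub>R (1, 0) \<in> P}"
  have "convex ?A" by (rule convex_ray_sum[OF convex_P linear_ident])
  moreover have "linear (\<lambda>p :: plane. (fst p - snd p, snd p))" by (rule linearI) (auto simp: algebra_simps)
  then have "convex ?B" by (rule convex_ray_sum[OF convex_P])
  ultimately have cv: "convex (?A \<inter> ?B)" by (rule convex_Int)
  have "pt ` mutated (lat P) \<subseteq> ?A \<inter> ?B"
  proof
    fix z assume "z \<in> pt ` mutated (lat P)"
    then obtain X Y where z: "z = pt (X, Y)" and XY: "(X, Y) \<in> mutated (lat P)" by force
    show "z \<in> ?A \<inter> ?B"
    proof (cases "Y < 0")
      case True
      then show ?thesis using XY unfolding z mutated_iff by (auto intro!: exI[of _ "0 :: real"])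
    next
      case False
      then have "0 \<le> real_of_int Y" by simp
      then show ?thesis using XY False unfolding z mutated_iff
        by (auto intro: exI[of _ "0 :: real"] exI[of _ "real_of_int Y"])
    qed
  qed
  then have "mutant \<subseteq> ?A \<inter> ?B" using cv by (rule hull_minimal)
  then have "(p, q) \<in> ?A" "(p, q) \<in> ?B" using assms by blast+
  then show "\<exists>s\<ge>0. (p - s, q) \<in> P" "\<exists>s\<ge>0. (p - q + s, q) \<in> P" by auto
qed

lemma mutated_row_card:
  assumes h: "- r \<le> h"
  shows "int (card {X. (X, h) \<in> lat mutant}) \<le> int (card {X. (X, h) \<in> lat P}) + h"
proof (cases "\<exists>t. (t, real_of_int h) \<in> P")
  case False
  then have "\<not> h < 0" using left_end[OF h] by blast
  moreover have "{X. (X, h) \<in> lat mutant} = {}"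
    using False mutated_hull_subset(1)[of _ "real_of_int h"] by auto
  ultimately show ?thesis by simp
next
  case True
  then obtain l u where lu: "l \<le> u" and row: "\<And>t. (t, of_int h) \<in> P \<longleftrightarrow> l \<le> t \<and> t \<le> u"
    using convex_compact_row[OF convex_P fano_polygonD(2)[OF P]] by blast
  \<comment> \<open>The counting formula for integers requires a non-empty interval; in the lower
    rows this is the room provided by the cone over the bottom edge.\<close>
  have lu': "l \<le> u + of_int h"
  proof (cases "h < 0")
    case True
    have "l \<le> of_int (- h * x) / of_int r" using left_end[OF h True] unfolding row by blast
    moreover have "real_of_int (- h * (x + k)) / of_int r \<le> u" using right_end[OF h True] unfolding row by blast
    ultimately show ?thesis using row_length[OF True] by linarith
  qed (use lu in simp)
  have "{X. (X, h) \<in> lat mutant} \<subseteq> {X. l \<le> of_int X \<and> of_int X \<le> u + of_int h}"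
  proof
    fix X assume "X \<in> {X. (X, h) \<in> lat mutant}"
    then have "(of_int X, of_int h) \<in> mutant" by simp
    from mutated_hull_subset[OF this] show "X \<in> {X. l \<le> of_int X \<and> of_int X \<le> u + of_int h}"
      unfolding row by auto
  qed
  moreover have "finite {X :: int. l \<le> of_int X \<and> of_int X \<le> u + of_int h}"
    by (rule finite_subset[of _ "{\<lceil>l\<rceil>..\<lfloor>u + of_int h\<rfloor>}"])
      (simp_all only: subset_iff mem_Collect_eq atLeastAtMost_iff ceiling_le_iff le_floor_iff finite_atLeastAtMost_int simp_thms)
  ultimately have "card {X. (X, h) \<in> lat mutant} \<le> card {X :: int. l \<le> of_int X \<and> of_int X \<le> u + of_int h}"
    by (rule card_mono[rotated])
  moreover have "int (card {X :: int. l \<le> of_int X \<and> of_int X \<le> u + of_int h}) = \<lfloor>u\<rfloor> + h - \<lceil>l\<rceil> + 1"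
    using card_int_interval[OF lu'] by simp
  moreover have "{X. (X, h) \<in> lat P} = {X. l \<le> of_int X \<and> of_int X \<le> u}" using row by simp
  then have "int (card {X. (X, h) \<in> lat P}) = \<lfloor>u\<rfloor> - \<lceil>l\<rceil> + 1" using card_int_interval[OF lu] by simp
  ultimately show ?thesis by linarith
qed

lemma card_mutated_less:
  assumes top: "\<And>X Y. (X, Y) \<in> lat P \<Longrightarrow> Y < r"
  shows "card (lat mutant) < card (lat P)"
proof -
  have LI: "snd ` lat P \<subseteq> {- r..<r}" using top bottom_le_int by auto
  have QI: "snd ` lat mutant \<subseteq> {- r..<r}"
  proof
    fix h assume "h \<in> snd ` lat mutant"
    then obtain X where "(of_int X, of_int h) \<in> mutant" by auto
    then obtain t where t: "(t, real_of_int h) \<in> P" using mutated_hull_subset(1) by blast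
    have "- real_of_int (r - 1) \<le> 0 * t + (- 1) * of_int h"
    proof (rule lat_minimizer[OF _ t])
      fix X' Y' assume "(X', Y') \<in> lat P"
      then have "Y' \<le> r - 1" using top by fastforce
      then have "real_of_int Y' \<le> of_int (r - 1)" by (simp only: of_int_le_iff)
      then show "- real_of_int (r - 1) \<le> 0 * of_int X' + (- 1) * of_int Y'" by simp
    qed
    then have "real_of_int h \<le> of_int (r - 1)" by simp
    then have "h \<le> r - 1" by (simp only: of_int_le_iff)
    moreover have "- real_of_int r \<le> of_int h" using bottom_le[OF t] by simp
    then have "- r \<le> h" by linarith
    ultimately show "h \<in> {- r..<r}" by simp
  qed
  have finQ: "finite (lat mutant)" by (rule fano_polygonD(4)[OF fano_polygon_mutated])
  have "int (card (lat mutant)) = (\<Sum>h\<in>{- r..<r}. int (card {X. (X, h) \<in> lat mutant}))"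
    using card_rows[OF finQ _ QI] by simp
  also have "\<dots> \<le> (\<Sum>h\<in>{- r..<r}. int (card {X. (X, h) \<in> lat P}) + h)"
    by (rule sum_mono) (rule mutated_row_card, simp)
  also have "\<dots> = int (card (lat P)) - r"
    using card_rows[OF finite_lat_P _ LI] sum_symmetric_interval[of r] r_pos by (simp add: sum.distrib)
  finally show ?thesis using r_pos by simp
qed

end

section \<open>Unimodular equivalence and the descent\<close>

definition rmap :: "int \<Rightarrow> int \<Rightarrow> int \<Rightarrow> int \<Rightarrow> plane \<Rightarrow> plane" where
  "rmap a b c d = (\<lambda>(p, q). (a * p + b * q, c * p + d * q))"

lemma linear_rmap: "linear (rmap a b c d)"
  by (rule linearI) (auto simp: rmap_def algebra_simps)

lemma rmap_pt: "rmap a b c d (pt v) = pt (lmap a b c d v)"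
  by (cases v) (simp add: rmap_def)

lemma lmap_surj:
  assumes "a * d - b * c = 1"
  shows "lmap a b c d (lmap d (- b) (- c) a v) = v"
  using lmap_inverse[of d a "- b" "- c" v] assms by (simp add: mult.commute)

lemma gl_equivalent_rmap:
  assumes P: "fano_polygon P" and det: "a * d - b * c = 1"
  shows "lat (rmap a b c d ` P) = lmap a b c d ` lat P" "fano_polygon (rmap a b c d ` P)"
    "gl_equivalent P (rmap a b c d ` P)"
proof -
  have hull: "rmap a b c d ` P = convex hull (pt ` lmap a b c d ` lat P)"
  proof -
    have "rmap a b c d ` (convex hull (pt ` lat P)) = convex hull (rmap a b c d ` pt ` lat P)"
      by (rule convex_hull_linear_image[OF linear_rmap])
    then show ?thesis unfolding fano_polygonD(5)[OF P] by (simp add: image_image rmap_pt)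
  qed
  have det': "real_of_int a * d - real_of_int b * c = 1" using det by (metis of_int_1 of_int_diff of_int_mult)
  have inj: "p = q" if "rmap a b c d p = rmap a b c d q" for p q
  proof -
    obtain p1 p2 q1 q2 where pq: "p = (p1, p2)" "q = (q1, q2)" by fastforce
    have e: "a * p1 + b * p2 = a * q1 + b * q2" "c * p1 + d * p2 = c * q1 + d * q2" using that by (auto simp: pq rmap_def)
    have "(real_of_int a * d - real_of_int b * c) * (p1 - q1) = d * ((a * p1 + b * p2) - (a * q1 + b * q2)) - b * ((c * p1 + d * p2) - (c * q1 + d * q2))"
      "(real_of_int a * d - real_of_int b * c) * (p2 - q2) = a * ((c * p1 + d * p2) - (c * q1 + d * q2)) - c * ((a * p1 + b * p2) - (a * q1 + b * q2))"
      by (simp_all add: algebra_simps)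
    then show ?thesis unfolding det' e by (simp add: pq)
  qed
  show lat: "lat (rmap a b c d ` P) = lmap a b c d ` lat P"
  proof
    show "lmap a b c d ` lat P \<subseteq> lat (rmap a b c d ` P)"
      by (rule image_subsetI) (simp only: lat_iff rmap_pt[symmetric] imageI)
    show "lat (rmap a b c d ` P) \<subseteq> lmap a b c d ` lat P"
    proof
      fix v assume "v \<in> lat (rmap a b c d ` P)"
      then obtain p where p: "p \<in> P" "pt v = rmap a b c d p" by auto
      have "pt v = rmap a b c d (pt (lmap d (- b) (- c) a v))" unfolding rmap_pt lmap_surj[OF det] ..
      then have "p = pt (lmap d (- b) (- c) a v)" using p(2) inj by metis
      then have "lmap d (- b) (- c) a v \<in> lat P" using p(1) by simp
      then show "v \<in> lmap a b c d ` lat P" by (rule rev_image_eqI) (simp only: lmap_surj[OF det])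
    qed
  qed
  show "fano_polygon (rmap a b c d ` P)"
    unfolding hull
  proof (rule fano_polygonI[OF surrounds_origin_lmap[OF det fano_polygonD(6)[OF P]]])
    fix a' b' x y k assume "lattice_edge (lmap a b c d ` lat P) a' b' x y k"
    then obtain a'' b'' x' y' where e: "lattice_edge (lat P) a'' b'' x' y' k" and "x = a * x' + b * y'" "y = c * x' + d * y'"
      by (rule lattice_edge_lmapE[OF det])
    then show "coprime x y" using coprime_lmap[OF det fano_polygon_coprime(1)[OF P e]] by simp
  qed
  have "rmap a b c d ` lattice = lattice"
  proof -
    have "range (lmap a b c d) = UNIV" using lmap_surj[OF det] by (metis surjI)
    then show ?thesis unfolding range_pt[symmetric] image_image rmap_pt by (metis image_image)
  qed
  then show "gl_equivalent P (rmap a b c d ` P)" unfolding gl_equivalent_def using linear_rmap by blast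
qed

lemma residual_heights_le_lmap:
  assumes det: "a * d - b * c = 1" and "residual_heights_le H L"
  shows "residual_heights_le H (lmap a b c d ` L)"
  unfolding residual_heights_le_def
proof (intro allI impI)
  fix a' b' x y k assume "lattice_edge (lmap a b c d ` L) a' b' x y k"
  then obtain a'' b'' x' y' where e: "lattice_edge L a'' b'' x' y' k"
    "a' = d * a'' - c * b''" "b' = a * b'' - b * a''" "x = a * x' + b * y'" "y = c * x' + d * y'"
    by (rule lattice_edge_lmapE[OF det])
  have "a' * x + b' * y = a'' * x' + b'' * y'" unfolding e(2-) by (rule lmap_height[OF det])
  then show "- (a' * x + b' * y) \<le> H \<or> - (a' * x + b' * y) dvd k"
    using assms(2) e(1) unfolding residual_heights_le_def by simp
qed

lemma mutation_descent:
  assumes fP: "fano_polygon P" and good: "residual_heights_le H (lat P)" and e: "lattice_edge (lat P) a b x y k"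
    and long: "- (a * x + b * y) \<le> k"
    and small: "\<And>X Y. (X, Y) \<in> lat P \<Longrightarrow> a * X + b * Y < - (a * x + b * y)"
  obtains Q where "fano_polygon Q" "residual_heights_le H (lat Q)" "card (lat Q) < card (lat P)"
    "equivclp mutation_step P Q"
proof -
  define r where "r = - (a * x + b * y)"
  obtain u v where uv: "u * a + v * b = 1"
    using bezout_int[of a b] lattice_edgeD(1)[OF e] by (metis coprime_imp_gcd_eq_1)
  have det: "v * b - (- u) * a = 1" using uv by (simp add: algebra_simps)
  define P' where "P' = rmap v (- u) a b ` P"
  note gl = gl_equivalent_rmap[OF fP det, folded P'_def]
  have "b * a - a * b = 0" "v * b - - u * a = 1" "a * x + b * y = - r"
    using uv by (simp_all add: algebra_simps r_def)
  then have e': "lattice_edge (lat P') 0 1 (v * x + - u * y) (- r) k"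
    using lattice_edge_lmap[OF det e] unfolding gl(1) by (simp only:)
  interpret bottom_edge P' "v * x + - u * y" r k
    using gl(2) e' long by unfold_locales (auto simp: r_def)
  define Q where "Q = convex hull (pt ` mutated (lat P'))"
  have "Y < r" if "(X, Y) \<in> lat P'" for X Y
  proof -
    obtain X' Y' where "(X', Y') \<in> lat P" "(X, Y) = lmap v (- u) a b (X', Y')" using \<open>(X, Y) \<in> lat P'\<close> unfolding gl(1) by force
    then show ?thesis using small unfolding r_def by simp
  qed
  then have "card (lat Q) < card (lat P')" unfolding Q_def by (rule card_mutated_less)
  moreover have "card (lat P') = card (lat P)"
    unfolding gl(1) by (rule card_image) (metis lmap_inverse[OF det] inj_onI)
  moreover have "residual_heights_le H (lat Q)"
    unfolding Q_def by (rule residual_heights_le_mutated) (unfold gl(1), rule residual_heights_le_lmap[OF det good])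
  moreover have fQ: "fano_polygon Q" unfolding Q_def by (rule fano_polygon_mutated)
  moreover have "mutation_step P P'" using fP gl by (simp add: mutation_step_def)
  moreover have "mutation_step P' Q" using gl(2) fQ mutation_mutated by (simp add: mutation_step_def Q_def)
  then have "equivclp mutation_step P Q"
    using \<open>mutation_step P P'\<close> by (meson equivclp_into_equivclp r_into_equivclp)
  ultimately show thesis using that by simp
qed

definition mutation_minimal :: "(int \<times> int) set \<Rightarrow> bool" where
  "mutation_minimal L \<longleftrightarrow> (\<forall>a b x y k. lattice_edge L a b x y k \<longrightarrow> - (a * x + b * y) \<le> k \<longrightarrow>
     (\<exists>X Y. (X, Y) \<in> L \<and> - (a * x + b * y) \<le> a * X + b * Y))"

lemma exists_minimal_polygon:
  assumes "fano_polygon P" "residual_heights_le H (lat P)"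
  shows "\<exists>Q. fano_polygon Q \<and> residual_heights_le H (lat Q) \<and> mutation_minimal (lat Q) \<and> equivclp mutation_step P Q"
  using assms
proof (induction "card (lat P)" arbitrary: P rule: less_induct)
  case less
  show ?case
  proof (cases "mutation_minimal (lat P)")
    case True
    then show ?thesis using less.prems by auto
  next
    case False
    then obtain a b x y k where e: "lattice_edge (lat P) a b x y k" "- (a * x + b * y) \<le> k"
      and n: "\<not> (\<exists>X Y. (X, Y) \<in> lat P \<and> - (a * x + b * y) \<le> a * X + b * Y)"
      unfolding mutation_minimal_def by blast
    have small: "a * X + b * Y < - (a * x + b * y)" if "(X, Y) \<in> lat P" for X Y using n that not_less by blast
    obtain Q where Q: "fano_polygon Q" "residual_heights_le H (lat Q)" "card (lat Q) < card (lat P)" "equivclp mutation_step P Q"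
      by (rule mutation_descent[OF less.prems e small])
    obtain R where "fano_polygon R" "residual_heights_le H (lat R)" "mutation_minimal (lat R)" "equivclp mutation_step Q R"
      using less.hyps[OF Q(3,1,2)] by blast
    then show ?thesis using equivclp_trans[OF Q(4)] by blast
  qed
qed

text \<open>Height times length is the determinant of the two end points, so the height is bounded
  by such a determinant. This makes a largest height available.\<close>

lemma finite_heights:
  assumes L: "surrounds_origin L"
  shows "finite {h. \<exists>a b x y k. lattice_edge L a b x y k \<and> h = - (a * x + b * y)}"
proof (rule finite_subset)
  let ?D = "\<lambda>(u, v). {0..fst u * snd v - snd u * fst v}"
  show "finite (\<Union> (?D ` (L \<times> L)))" using L by (auto simp: surrounds_origin_def)
  show "{h. \<exists>a b x y k. lattice_edge L a b x y k \<and> h = - (a * x + b * y)} \<subseteq> \<Union> (?D ` (L \<times> L))"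
  proof
    fix h assume "h \<in> {h. \<exists>a b x y k. lattice_edge L a b x y k \<and> h = - (a * x + b * y)}"
    then obtain a b x y k where e: "lattice_edge L a b x y k" and h: "h = - (a * x + b * y)" by blast
    note d = lattice_edgeD[OF e]
    have h0: "0 < h" using lattice_edge_height_pos[OF L e] h by simp
    then have "1 * h \<le> k * h" using d(2) by (intro mult_right_mono) auto
    also have "k * h = x * (y - k * a) - y * (x + k * b)" by (simp add: h algebra_simps)
    finally have "h \<in> ?D ((x, y), (x + k * b, y - k * a))" using h0 by simp
    then show "h \<in> \<Union> (?D ` (L \<times> L))" using d(3,4) by blast
  qed
qed

lemma minimal_polygon_heights:
  assumes Q: "fano_polygon Q" and good: "residual_heights_le H (lat Q)" and free: "mutation_minimal (lat Q)" and H: "0 \<le> H"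
    and e: "lattice_edge (lat Q) a b x y k"
  shows "- (a * x + b * y) \<le> 8 * H + 8"
proof -
  define S where "S = {h. \<exists>a b x y k. lattice_edge (lat Q) a b x y k \<and> h = - (a * x + b * y)}"
  have S: "finite S" unfolding S_def by (rule finite_heights[OF fano_polygonD(6)[OF Q]])
  define r where "r = Max S"
  have eS: "- (a * x + b * y) \<in> S" using e unfolding S_def by blast
  then have "r \<in> S" unfolding r_def using S by (intro Max_in) auto
  then obtain a0 b0 x0 y0 k0 where e0: "lattice_edge (lat Q) a0 b0 x0 y0 k0" "- (a0 * x0 + b0 * y0) = r" unfolding S_def by blast
  have le: "- (a * x + b * y) \<le> r" if "lattice_edge (lat Q) a b x y k" for a b x y k
  proof -
    have "- (a * x + b * y) \<in> S" using that unfolding S_def by blast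
    then show ?thesis unfolding r_def using S by simp
  qed
  have "minimal_config H r (lat Q)"
    unfolding minimal_config_def
  proof (intro conjI allI impI)
    show "finite (lat Q)" by (rule fano_polygonD(4)[OF Q])
    fix a b x y k assume f: "lattice_edge (lat Q) a b x y k"
    show "coprime x y" "coprime (x + k * b) (y - k * a)" by (rule fano_polygon_coprime[OF Q f])+
    show "0 < - (a * x + b * y)" using lattice_edge_height_pos[OF fano_polygonD(6)[OF Q] f] by simp
    show "- (a * x + b * y) \<le> r" by (rule le[OF f])
    show "- (a * x + b * y) \<le> H \<or> - (a * x + b * y) dvd k" using good f unfolding residual_heights_le_def by blast
    show "\<exists>X Y. (X, Y) \<in> lat Q \<and> - (a * x + b * y) \<le> a * X + b * Y" if "- (a * x + b * y) \<le> k"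
      using free f that unfolding mutation_minimal_def by blast
  qed
  then have "r \<le> 8 * H + 8" by (rule minimal_config_bound[OF _ H e0])
  then show ?thesis using le[OF e] by simp
qed

section \<open>Heights of residual cones\<close>

lemma fano_polygon_bdd_below:
  assumes "fano_polygon P"
  shows "bdd_below ((\<bullet>) w ` P)"
  using fano_polygonD(3)[OF assms]
  by (intro bounded_imp_bdd_below bounded_linear_image bounded_linear_inner_right)

lemma edge_normal_edge_segment:
  assumes P: "fano_polygon P" and e: "lattice_edge (lat P) a b x y k"
  shows "edge_normal P (edge_segment a b x y k) = pt (a, b)"
  unfolding edge_normal_def
proof (rule the_equality)
  let ?E = "edge_segment a b x y k"
  note ed = lattice_edgeD[OF e]
  show "inner_normal P ?E (pt (a, b))" by (rule inner_normal_edge_segment[OF P e])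
  fix w assume w: "inner_normal P ?E w"
  then obtain c d where cd: "w = pt (c, d)" "coprime c d" by (auto simp: inner_normal_def primitive_def)
  have inE: "pt (x, y) \<in> ?E" "pt (x + k * b, y - k * a) \<in> ?E" by (simp_all add: edge_segment_def)
  have val: "w \<bullet> p = h_min P w" if "p \<in> ?E" for p using w that unfolding inner_normal_def by blast
  have "real_of_int (c * x + d * y) = of_int (c * (x + k * b) + d * (y - k * a))"
    using val[OF inE(1)] val[OF inE(2)] unfolding cd inner_pt by simp
  then have "c * x + d * y = c * (x + k * b) + d * (y - k * a)" by (simp only: of_int_eq_iff)
  then have "k * (b * c + (- a) * d) = 0" by (auto simp: algebra_simps)
  then have "b * c + (- a) * d = 0" using ed(2) by simp
  moreover have "coprime b (- a)" using ed(1) by (simp add: coprime_commute)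
  ultimately obtain s where s: "c = s * - a" "d = - s * b" using coprime_orthogonal_int by metis
  have "s dvd c" "s dvd d" by (simp_all add: s)
  then have "is_unit s" using cd(2) by (meson coprime_common_divisor)
  then have "s = 1 \<or> s = - 1" by auto
  \<comment> \<open>Because of the sign in \<open>c = s * - a\<close>, the value 1 stands for the
    opposite normal. Its minimum on \<open>P\<close> would be positive, although \<open>P\<close>
    contains the origin.\<close>
  moreover have "s \<noteq> 1"
  proof
    assume "s = 1"
    then have "h_min P w = - of_int (a * x + b * y)" using val[OF inE(1)] unfolding cd inner_pt s by simp
    moreover have "0 \<in> P" using P interior_subset by (auto simp: fano_polygon_def)
    then have "h_min P w \<le> w \<bullet> 0" unfolding h_min_def by (rule cINF_lower[OF fano_polygon_bdd_below[OF P]])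
    ultimately have "0 \<le> real_of_int (a * x + b * y)" by simp
    then show False using lattice_edge_height_pos[OF fano_polygonD(6)[OF P] e] by (simp only: of_int_0_le_iff)
  qed
  ultimately show "w = pt (a, b)" unfolding cd by (simp add: s)
qed

lemma height_edge_segment:
  assumes P: "fano_polygon P" and e: "lattice_edge (lat P) a b x y k"
  shows "height P (edge_segment a b x y k) = nat (- (a * x + b * y))"
  unfolding height_def edge_normal_edge_segment[OF P e]
proof (rule the_equality)
  have pos: "a * x + b * y < 0" by (rule lattice_edge_height_pos[OF fano_polygonD(6)[OF P] e])
  then show "\<forall>v\<in>edge_segment a b x y k. pt (a, b) \<bullet> v = - real (nat (- (a * x + b * y)))"
    using edge_segment_inner by simp
  fix n assume n: "\<forall>v\<in>edge_segment a b x y k. pt (a, b) \<bullet> v = - real n"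
  have "pt (x, y) \<in> edge_segment a b x y k" by (simp add: edge_segment_def)
  then have "real_of_int (a * x + b * y) = - real n" using n edge_segment_inner by metis
  then show "n = nat (- (a * x + b * y))" by linarith
qed

lemma width_edge_segment:
  assumes "coprime a b" "0 < k"
  shows "width (edge_segment a b x y k) = nat k"
proof -
  have "edge_segment a b x y k \<inter> lattice = (\<lambda>s. pt (x + s * b, y - s * a)) ` {0..k}"
  proof -
    have "v \<in> edge_segment a b x y k \<inter> lattice \<longleftrightarrow>
        (\<exists>X Y. v = pt (X, Y) \<and> (\<exists>s. 0 \<le> s \<and> s \<le> k \<and> X = x + s * b \<and> Y = y - s * a))" for v
      unfolding range_pt[symmetric] pt_mem_edge_segment[OF assms, symmetric] by (auto simp del: pt_Pair)
    then show ?thesis unfolding set_eq_iff image_iff Bex_def atLeastAtMost_iff by blast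
  qed
  moreover have "a \<noteq> 0 \<or> b \<noteq> 0" using assms(1) by auto
  then have "inj_on (\<lambda>s. pt (x + s * b, y - s * a)) {0..k}" by (intro inj_onI) auto
  ultimately show ?thesis unfolding width_def using assms(2) by (simp only: card_image) simp
qed

section \<open>Lattice points in residual cones\<close>

lemma cone_hull_segment_interior:
  fixes A B p :: plane
  assumes pos: "0 < fst A * snd B - snd A * fst B"
    and p: "0 < fst p * snd B - snd p * fst B" "0 < fst A * snd p - snd A * fst p"
  shows "p \<in> interior (cone hull (closed_segment A B))"
proof -
  define \<Delta> where "\<Delta> = fst A * snd B - snd A * fst B"
  define U where "U = {p :: plane. 0 < fst p * snd B - snd p * fst B \<and> 0 < fst A * snd p - snd A * fst p}"
  have "U = {p. 0 < fst p * snd B - snd p * fst B} \<inter> {p. 0 < fst A * snd p - snd A * fst p}"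
    unfolding U_def by blast
  moreover have "open {p :: plane. 0 < fst p * snd B - snd p * fst B}" "open {p :: plane. 0 < fst A * snd p - snd A * fst p}"
    by (intro open_Collect_less continuous_intros)+
  ultimately have "open U" by (simp add: open_Int)
  moreover have "U \<subseteq> cone hull (closed_segment A B)"
  proof
    fix q assume "q \<in> U"
    then have q: "0 < fst q * snd B - snd q * fst B" "0 < fst A * snd q - snd A * fst q" by (auto simp: U_def)
    define s where "s = (fst q * snd B - snd q * fst B) / \<Delta>"
    define t where "t = (fst A * snd q - snd A * fst q) / \<Delta>"
    have st: "0 < s" "0 < t" using q pos by (simp_all add: s_def t_def \<Delta>_def)
    have "\<Delta> *\<^sub>R q = (fst q * snd B - snd q * fst B) *\<^sub>R A + (fst A * snd q - snd A * fst q) *\<^sub>R B"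
      unfolding \<Delta>_def by (cases A; cases B; cases q) (simp add: algebra_simps)
    then have "(1 / \<Delta>) *\<^sub>R (\<Delta> *\<^sub>R q) = s *\<^sub>R A + t *\<^sub>R B" by (simp add: s_def t_def scaleR_add_right)
    then have qst: "q = s *\<^sub>R A + t *\<^sub>R B" using pos by (simp add: \<Delta>_def)
    define x where "x = (1 - t / (s + t)) *\<^sub>R A + (t / (s + t)) *\<^sub>R B"
    have "x \<in> closed_segment A B" unfolding in_segment x_def using st by (intro exI[of _ "t / (s + t)"]) auto
    moreover have "(s + t) *\<^sub>R x = q"
    proof -
      have "(s + t) * (1 - t / (s + t)) = s" "(s + t) * (t / (s + t)) = t" using st by (simp_all add: field_simps)
      then show ?thesis unfolding x_def scaleR_add_right scaleR_scaleR qst by (simp only:)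
    qed
    ultimately show "q \<in> cone hull (closed_segment A B)"
      unfolding cone_hull_expl using st by (intro CollectI exI[of _ "s + t"] exI[of _ x]) auto
  qed
  moreover have "p \<in> U" using p by (simp add: U_def)
  ultimately show ?thesis by (meson interiorI)
qed

text \<open>Reflection in the centre of the parallelogram spanned by two lattice points at height \<open>r\<close> exchanges
  the heights \<open>j\<close> and \<open>r - j\<close>, and the row at height \<open>j\<close> of that parallelogram contains a lattice point.\<close>

lemma cone_point_dichotomy:
  fixes \<xi> m r j :: int
  assumes cop: "coprime \<xi> r" "coprime (\<xi> + m) r" and m: "1 \<le> m" and j: "0 < j" "j < r"
  shows "(\<exists>z. j * \<xi> < z * r \<and> z * r < j * (\<xi> + m)) \<or> (\<exists>z. (r - j) * \<xi> < z * r \<and> z * r < (r - j) * (\<xi> + m))"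
proof -
  have strict: "\<exists>z. i * \<xi> < z * r \<and> z * r < i * (\<xi> + m)"
    if i: "0 < i" "i < r" and z: "i * \<xi> < z * r" "z * r \<le> i * (\<xi> + 1)" for i z
  proof -
    have "i * (\<xi> + 1) \<le> i * (\<xi> + m)" using i m by (intro mult_left_mono) auto
    moreover have "z * r \<noteq> i * (\<xi> + m)"
    proof
      assume "z * r = i * (\<xi> + m)"
      then have "r dvd i * (\<xi> + m)" by (metis dvd_triv_right)
      then have "r dvd i" using cop(2) by (simp add: coprime_commute coprime_dvd_mult_left_iff)
      then show False using i zdvd_imp_le by fastforce
    qed
    ultimately show ?thesis using z by (intro exI[of _ z]) linarith
  qed
  define q where "q = (j * \<xi>) div r"
  have nd: "(j * \<xi>) mod r \<noteq> 0"
  proof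
    assume "(j * \<xi>) mod r = 0"
    then have "r dvd j * \<xi>" by blast
    then have "r dvd j" using cop(1) by (simp add: coprime_commute coprime_dvd_mult_left_iff)
    then show False using j zdvd_imp_le by fastforce
  qed
  have r: "0 < r" using j by simp
  have dm: "q * r + (j * \<xi>) mod r = j * \<xi>" unfolding q_def by (rule div_mult_mod_eq)
  have "0 \<le> (j * \<xi>) mod r" "(j * \<xi>) mod r < r" using r by simp_all
  then have q: "q * r < j * \<xi>" "j * \<xi> < (q + 1) * r" using dm nd by (auto simp: algebra_simps)
  show ?thesis
  proof (cases "(q + 1) * r \<le> j * (\<xi> + 1)")
    case True
    then show ?thesis using strict[OF j q(2)] by blast
  next
    case False
    \<comment> \<open>Here q lies in the other half of the parallelogram, and \<xi> - q is its
      mirror image at height r - j.\<close>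
    have "(r - j) * \<xi> < (\<xi> - q) * r" "(\<xi> - q) * r \<le> (r - j) * (\<xi> + 1)"
      using q False by (simp_all add: algebra_simps)
    then show ?thesis using strict[of "r - j"] j by simp
  qed
qed

text \<open>In the basis formed by the edge direction (b, - a) and a vector f at depth 1, the
  segment runs from \<xi> to \<xi> + m at depth \<open>r\<close>. The set \<open>J\<close> of depths
  with an interior lattice point and its image under j to r - j cover all depths from 1 to r - 1.
  Distinct depths give distinct points, so r - 1 is at most twice their number.\<close>

lemma residual_cone_points:
  assumes P: "fano_polygon P" and cop: "coprime a b" and A: "coprime A1 A2" "pt (A1, A2) \<in> P"
    and B: "coprime (A1 + m * b) (A2 - m * a)" "pt (A1 + m * b, A2 - m * a) \<in> P" and m: "1 \<le> m"
    and r: "a * A1 + b * A2 = - r" "0 < r"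
    and sub: "\<And>v. v \<in> P \<inter> lattice \<Longrightarrow>
      v \<in> interior (cone hull (closed_segment (pt (A1, A2)) (pt (A1 + m * b, A2 - m * a)))) \<Longrightarrow> v \<in> R"
    and R: "finite R"
  shows "r \<le> 2 * int (card R) + 1"
proof -
  let ?A = "pt (A1, A2)" and ?B = "pt (A1 + m * b, A2 - m * a)"
  obtain u v where "u * a + v * b = 1" using bezout_int[of a b] cop by (metis coprime_imp_gcd_eq_1)
  then have f: "a * (- u) + b * (- v) = - 1" by (simp add: algebra_simps)
  define f1 where "f1 = - u"
  define f2 where "f2 = - v"
  have f: "a * f1 + b * f2 = - 1" using f by (simp add: f1_def f2_def)
  have "a * (A1 - r * f1) + b * (A2 - r * f2) = a * A1 + b * A2 - r * (a * f1 + b * f2)" by (simp add: algebra_simps)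
  also have "\<dots> = 0" unfolding f r(1) by simp
  finally obtain \<xi> where "A1 - r * f1 = \<xi> * b" "A2 - r * f2 = - \<xi> * a" by (rule coprime_orthogonal_int[OF cop])
  then have Aeq: "A1 = \<xi> * b + r * f1" "A2 = - \<xi> * a + r * f2" by auto
  have Beq: "A1 + m * b = (\<xi> + m) * b + r * f1" "A2 - m * a = - (\<xi> + m) * a + r * f2"
    by (simp_all add: Aeq algebra_simps)
  have cop': "coprime \<zeta> r" if "coprime (\<zeta> * b + r * f1) (- \<zeta> * a + r * f2)" for \<zeta>
  proof (rule coprimeI)
    fix d assume "d dvd \<zeta>" "d dvd r"
    then have "d dvd \<zeta> * b + r * f1" "d dvd - \<zeta> * a + r * f2" by (auto intro: dvd_add dvd_mult2)
    then show "is_unit d" using that by (meson coprime_common_divisor)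
  qed
  have cops: "coprime \<xi> r" "coprime (\<xi> + m) r"
    by (rule cop'[OF A(1)[unfolded Aeq]], rule cop'[OF B(1)[unfolded Beq]])
  define J where "J = {j. 0 < j \<and> j < r \<and> (\<exists>z. j * \<xi> < z * r \<and> z * r < j * (\<xi> + m))}"
  have finJ: "finite J" by (rule finite_subset[of _ "{0..r}"]) (auto simp: J_def)
  have "real_of_int ` J \<subseteq> (\<lambda>p. - (pt (a, b) \<bullet> p)) ` R"
  proof
    fix t assume "t \<in> real_of_int ` J"
    then obtain j z where j: "t = of_int j" "0 < j" "j < r" and z: "j * \<xi> < z * r" "z * r < j * (\<xi> + m)"
      by (auto simp: J_def)
    define V1 where "V1 = z * b + j * f1"
    define V2 where "V2 = - z * a + j * f2"
    have fb: "b * f2 + a * f1 = - 1" using f by (simp add: algebra_simps)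
    have "A1 * (A2 - m * a) - A2 * (A1 + m * b) = - m * (a * A1 + b * A2)" by (simp add: algebra_simps)
    then have detAB: "A1 * (A2 - m * a) - A2 * (A1 + m * b) = m * r" unfolding r(1) by simp
    have "V1 * (A2 - m * a) - V2 * (A1 + m * b) = (b * f2 + a * f1) * (z * r - j * (\<xi> + m))"
      unfolding V1_def V2_def Beq by (simp add: algebra_simps)
    then have det1: "V1 * (A2 - m * a) - V2 * (A1 + m * b) = j * (\<xi> + m) - z * r" unfolding fb by simp
    have "A1 * V2 - A2 * V1 = (b * f2 + a * f1) * (\<xi> * j - z * r)"
      unfolding V1_def V2_def Aeq by (simp add: algebra_simps)
    then have det2: "A1 * V2 - A2 * V1 = z * r - j * \<xi>" unfolding fb by (simp add: mult.commute)
    let ?V = "pt (V1, V2)"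
    have pos: "0 < real_of_int (m * r)" "0 < real_of_int (j * (\<xi> + m) - z * r)" "0 < real_of_int (z * r - j * \<xi>)"
      unfolding of_int_0_less_iff using m r(2) z by simp_all
    have rd: "fst ?A * snd ?B - snd ?A * fst ?B = of_int (m * r)"
      "fst ?V * snd ?B - snd ?V * fst ?B = of_int (j * (\<xi> + m) - z * r)"
      "fst ?A * snd ?V - snd ?A * fst ?V = of_int (z * r - j * \<xi>)"
      unfolding detAB[symmetric] det1[symmetric] det2[symmetric] by simp_all
    have "?V \<in> interior (cone hull (closed_segment ?A ?B))"
      by (rule cone_hull_segment_interior) (simp_all only: rd pos)
    moreover have "?V \<in> P"
    proof -
      define \<alpha> where "\<alpha> = real_of_int (j * (\<xi> + m) - z * r) / of_int (m * r)"
      define \<beta> where "\<beta> = real_of_int (z * r - j * \<xi>) / of_int (m * r)"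
      have "\<alpha> + \<beta> = real_of_int (m * j) / of_int (m * r)"
        unfolding \<alpha>_def \<beta>_def add_divide_distrib[symmetric] of_int_add[symmetric] by (simp add: algebra_simps)
      then have sum: "\<alpha> + \<beta> = of_int j / of_int r" using m by simp
      have le1: "\<alpha> + \<beta> \<le> 1" unfolding sum using j r(2) by simp
      have nn: "0 \<le> \<alpha>" "0 \<le> \<beta>" using pos by (simp_all add: \<alpha>_def \<beta>_def del: of_int_mult of_int_diff of_int_add)
      have "of_int (m * r) *\<^sub>R ?V = (fst ?V * snd ?B - snd ?V * fst ?B) *\<^sub>R ?A + (fst ?A * snd ?V - snd ?A * fst ?V) *\<^sub>R ?B"
        unfolding rd(1)[symmetric] by (simp add: algebra_simps)
      then have "(1 / of_int (m * r)) *\<^sub>R (of_int (m * r) *\<^sub>R ?V) = \<alpha> *\<^sub>R ?A + \<beta> *\<^sub>R ?B"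
        unfolding rd \<alpha>_def \<beta>_def by (simp only: scaleR_add_right scaleR_scaleR times_divide_eq_left mult_1)
      then have V: "?V = (1 - \<alpha> - \<beta>) *\<^sub>R 0 + \<alpha> *\<^sub>R ?A + \<beta> *\<^sub>R ?B" using m r(2) by (auto simp del: pt_Pair)
      have "?V \<in> convex hull {0, ?A, ?B}" unfolding convex_hull_3
        using nn le1 V by (intro CollectI exI[of _ "1 - \<alpha> - \<beta>"] exI[of _ \<alpha>] exI[of _ \<beta>]) auto
      moreover have "0 \<in> P" using P interior_subset by (auto simp: fano_polygon_def)
      then have "convex hull {0, ?A, ?B} \<subseteq> P" using A B fano_polygonD(1)[OF P] by (intro hull_minimal) auto
      ultimately show ?thesis by blast
    qed
    moreover have "?V \<in> lattice" unfolding range_pt[symmetric] by (rule rangeI)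
    ultimately have VR: "?V \<in> R" using sub by blast
    have teq: "t = - (pt (a, b) \<bullet> ?V)"
    proof -
      have "a * V1 + b * V2 = j * (b * f2 + a * f1)" unfolding V1_def V2_def by (simp add: algebra_simps)
      then have "a * V1 + b * V2 = - j" unfolding fb by simp
      then show ?thesis unfolding inner_pt j(1) by simp
    qed
    show "t \<in> (\<lambda>p. - (pt (a, b) \<bullet> p)) ` R" unfolding teq using VR by (rule imageI)
  qed
  then have "card (real_of_int ` J) \<le> card R" using R by (meson card_image_le card_mono finite_imageI order_trans)
  then have "card J \<le> card R" by (simp add: card_image inj_on_def)
  have "{1..r - 1} \<subseteq> J \<union> (\<lambda>j. r - j) ` J"
  proof
    fix j assume "j \<in> {1..r - 1}"
    then have j: "0 < j" "j < r" by auto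
    from cone_point_dichotomy[OF cops m j] show "j \<in> J \<union> (\<lambda>j. r - j) ` J"
    proof
      assume "\<exists>z. j * \<xi> < z * r \<and> z * r < j * (\<xi> + m)"
      then show ?thesis using j by (simp add: J_def)
    next
      assume "\<exists>z. (r - j) * \<xi> < z * r \<and> z * r < (r - j) * (\<xi> + m)"
      then have "r - j \<in> J" using j by (simp add: J_def)
      then show ?thesis by (intro UnI2 image_eqI[of _ _ "r - j"]) auto
    qed
  qed
  then have "card {1..r - 1} \<le> card (J \<union> (\<lambda>j. r - j) ` J)" using finJ by (intro card_mono) auto
  also have "\<dots> \<le> card J + card ((\<lambda>j. r - j) ` J)" by (rule card_Un_le)
  also have "\<dots> \<le> card J + card J" using card_image_le[OF finJ] by simp
  finally show ?thesis using \<open>card J \<le> card R\<close> r(2) by simp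
qed

text \<open>If the height does not divide the length, the decomposition of the edge contains exactly
  one residual segment, and all lattice points of \<open>P\<close> interior to its cone are counted
  by \<nu>.\<close>

lemma residual_heights_le_residual_points:
  assumes P: "fano_polygon P" and res: "has_residual_points P \<nu>"
  shows "residual_heights_le (2 * int \<nu> + 1) (lat P)"
  unfolding residual_heights_le_def
proof (intro allI impI)
  fix a b x y k assume e: "lattice_edge (lat P) a b x y k"
  define r where "r = - (a * x + b * y)"
  define E where "E = edge_segment a b x y k"
  note ed = lattice_edgeD[OF e]
  have r0: "0 < r" using lattice_edge_height_pos[OF fano_polygonD(6)[OF P] e] by (simp add: r_def)
  obtain D where D: "\<And>E. E edge_of P \<Longrightarrow> edge_decomposition P E (D E)" and \<nu>: "card (residual_points P D) = \<nu>"
    using res unfolding has_residual_points_def by blast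
  have Eedge: "E edge_of P" using edge_segment_edge_of[OF e] unfolding fano_polygonD(5)[OF P] E_def .
  have hE: "height P E = nat r" unfolding E_def r_def by (rule height_edge_segment[OF P e])
  have wE: "width E = nat k" unfolding E_def by (rule width_edge_segment[OF ed(1,2)])
  show "- (a * x + b * y) \<le> 2 * int \<nu> + 1 \<or> - (a * x + b * y) dvd k"
    unfolding r_def[symmetric]
  proof (cases "r dvd k")
    case False
    define k0 where "k0 = width E mod height P E"
    have "k0 = nat (k mod r)" unfolding k0_def hE wE using ed(2) r0 by (simp add: nat_mod_distrib)
    moreover have "k mod r \<noteq> 0" "0 \<le> k mod r" using False r0 by (auto simp: dvd_eq_mod_eq_0)
    ultimately have k0: "k0 \<noteq> 0" by simp
    note dec = D[OF Eedge, unfolded edge_decomposition_def Let_def, folded k0_def]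
    have "card {S \<in> D E. width S = k0} = 1" using dec k0 by simp
    then obtain S where S: "S \<in> D E" "width S = k0" by (metis (mono_tags, lifting) card_1_singletonE insertI1 mem_Collect_eq)
    have "S \<subseteq> E" "primitive_segment S" using dec S by auto
    then obtain p q where pq: "primitive p" "primitive q" "p \<noteq> q" "S = closed_segment p q"
      unfolding primitive_segment_def by blast
    have "p \<in> E" "q \<in> E" using \<open>S \<subseteq> E\<close> unfolding pq(4) by auto
    have on_edge: "\<exists>s. p = pt (x + s * b, y - s * a) \<and> coprime (x + s * b) (y - s * a)" if "primitive p" "p \<in> E" for p
    proof -
      obtain X Y where XY: "p = pt (X, Y)" "coprime X Y" using \<open>primitive p\<close> by (auto simp: primitive_def)
      then show ?thesis using \<open>p \<in> E\<close> pt_mem_edge_segment[OF ed(1,2), of X Y x y] unfolding E_def by blast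
    qed
    obtain s where s: "p = pt (x + s * b, y - s * a)" "coprime (x + s * b) (y - s * a)"
      using on_edge[OF pq(1) \<open>p \<in> E\<close>] by blast
    obtain t where t: "q = pt (x + t * b, y - t * a)" "coprime (x + t * b) (y - t * a)"
      using on_edge[OF pq(2) \<open>q \<in> E\<close>] by blast
    have EP: "E \<subseteq> P" using Eedge by (simp add: edge_of_def face_of_imp_subset)
    have fin: "finite (residual_points P D)"
      by (rule finite_subset[OF _ finite_imageI[OF fano_polygonD(4)[OF P], of pt]])
        (auto simp: residual_points_def pt_image_lat)
    have *: "r \<le> 2 * int \<nu> + 1"
      if "S = closed_segment (pt (x + s * b, y - s * a)) (pt (x + t * b, y - t * a))" "s < t"
        "coprime (x + s * b) (y - s * a)" "coprime (x + t * b) (y - t * a)"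
        "pt (x + s * b, y - s * a) \<in> P" "pt (x + t * b, y - t * a) \<in> P" for s t
    proof -
      have tm: "x + s * b + (t - s) * b = x + t * b" "y - s * a - (t - s) * a = y - t * a"
        by (simp_all add: algebra_simps)
      show ?thesis unfolding \<nu>[symmetric]
      proof (rule residual_cone_points[OF P ed(1) that(3,5), of "t - s"], unfold tm)
        show "a * (x + s * b) + b * (y - s * a) = - r" by (simp add: r_def algebra_simps)
        fix v assume "v \<in> P \<inter> lattice"
          "v \<in> interior (cone hull closed_segment (pt (x + s * b, y - s * a)) (pt (x + t * b, y - t * a)))"
        then show "v \<in> residual_points P D"
          unfolding residual_points_def using S Eedge that(1) unfolding k0_def by blast
      qed (use that r0 fin in auto)
    qed
    have "s \<noteq> t" using pq(3) s t by auto
    then consider "s < t" | "t < s" by linarith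
    then have "r \<le> 2 * int \<nu> + 1"
    proof cases
      case 1
      then show ?thesis using *[of s t] pq(4) s t \<open>p \<in> E\<close> \<open>q \<in> E\<close> EP by blast
    next
      case 2
      have "S = closed_segment q p" unfolding pq(4) by (rule closed_segment_commute)
      then show ?thesis using *[of t s] 2 s t \<open>p \<in> E\<close> \<open>q \<in> E\<close> EP by blast
    qed
    then show "r \<le> 2 * int \<nu> + 1 \<or> r dvd k" ..
  qed simp
qed

section \<open>Finiteness\<close>

text \<open>Let d be the absolute determinant of a and v. The triangle 0, a, v meets the lattice
  line at determinant \<sigma> in a segment of length 1 - 1/d, measured in units of a, whose end
  points are multiples of 1/d. Such a segment contains a lattice point.\<close>

lemma convex_triangle_lattice_point:
  assumes cv: "convex P" "0 \<in> P" and a: "coprime a1 a2" "(a1, a2) \<in> lat P"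
    and v: "(X, Y) \<in> lat P" "0 < \<sigma> * (a1 * Y - a2 * X)" and \<sigma>: "\<sigma> = 1 \<or> \<sigma> = (- 1 :: int)"
  obtains b1 b2 where "(b1, b2) \<in> lat P" "a1 * b2 - a2 * b1 = \<sigma>"
proof -
  obtain u w where "u * a1 + w * a2 = 1" using bezout_int[of a1 a2] a(1) by (metis coprime_imp_gcd_eq_1)
  then have uw: "a1 * (\<sigma> * u) - a2 * (- \<sigma> * w) = \<sigma>" using \<sigma> by (auto simp: algebra_simps)
  define c1 where "c1 = - \<sigma> * w"
  define c2 where "c2 = \<sigma> * u"
  have det: "a1 * c2 - a2 * c1 = \<sigma>" using uw by (simp add: c1_def c2_def)
  define d where "d = \<sigma> * (a1 * Y - a2 * X)"
  have d: "0 < d" using v(2) by (simp add: d_def)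
  define x where "x = \<sigma> * (X * c2 - Y * c1)"
  have \<sigma>2: "\<sigma> * \<sigma> = 1" using \<sigma> by auto
  have "x * a1 + d * c1 = \<sigma> * (a1 * c2 - a2 * c1) * X" "x * a2 + d * c2 = \<sigma> * (a1 * c2 - a2 * c1) * Y"
    by (simp_all add: x_def d_def algebra_simps)
  then have XY: "X = x * a1 + d * c1" "Y = x * a2 + d * c2" unfolding det \<sigma>2 by simp_all
  \<comment> \<open>This is the ceiling of x / d. The sharp bound d - 1 on \<open>c * d - x\<close>
    is what keeps the point inside the triangle.\<close>
  define c where "c = - ((- x) div d)"
  have "(- x) div d * d + (- x) mod d = - x" by (rule div_mult_mod_eq)
  then have "c * d - x = (- x) mod d" unfolding c_def minus_mult_left[symmetric] by linarith
  moreover have "0 \<le> (- x) mod d" "(- x) mod d < d" using d by simp_all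
  ultimately have c: "0 \<le> c * d - x" "c * d - x \<le> d - 1" by linarith+
  define s where "s = 1 / real_of_int d"
  define t where "t = real_of_int (c * d - x) / of_int d"
  have st: "0 \<le> s" "0 \<le> t" "s + t \<le> 1"
  proof -
    show "0 \<le> s" "0 \<le> t" using c(1) d by (simp_all add: s_def t_def del: of_int_diff of_int_mult)
    have "s + t = real_of_int (1 + (c * d - x)) / of_int d" by (simp add: s_def t_def add_divide_distrib)
    moreover have "real_of_int (1 + (c * d - x)) \<le> of_int d" using c(2) by (simp only: of_int_le_iff)
    ultimately show "s + t \<le> 1" using d by (simp only: divide_le_eq_1_pos of_int_0_less_iff)
  qed
  define b1 where "b1 = c * a1 + c1"
  define b2 where "b2 = c * a2 + c2"
  have "of_int d *\<^sub>R pt (b1, b2) = pt (X, Y) + of_int (c * d - x) *\<^sub>R pt (a1, a2)"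
    unfolding XY b1_def b2_def by (simp add: algebra_simps)
  then have "(1 / of_int d) *\<^sub>R (of_int d *\<^sub>R pt (b1, b2)) = s *\<^sub>R pt (X, Y) + t *\<^sub>R pt (a1, a2)"
    by (simp only: scaleR_add_right scaleR_scaleR s_def t_def times_divide_eq_left mult_1)
  then have b: "pt (b1, b2) = (1 - s - t) *\<^sub>R 0 + s *\<^sub>R pt (X, Y) + t *\<^sub>R pt (a1, a2)" using d by (simp del: pt_Pair)
  have "pt (b1, b2) \<in> convex hull {0, pt (X, Y), pt (a1, a2)}" unfolding convex_hull_3
    using st b by (intro CollectI exI[of _ "1 - s - t"] exI[of _ s] exI[of _ t]) auto
  moreover have "convex hull {0, pt (X, Y), pt (a1, a2)} \<subseteq> P" using cv a(2) v(1) by (intro hull_minimal) auto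
  ultimately have "(b1, b2) \<in> lat P" by (auto simp del: pt_Pair)
  moreover have "a1 * b2 - a2 * b1 = \<sigma>" using det by (simp add: b1_def b2_def algebra_simps)
  ultimately show thesis by (rule that)
qed

text \<open>As the origin is interior, there are lattice points of \<open>P\<close> on both sides of
  the line through any primitive point, and the triangle they span with it contains one at
  determinant 1, respectively - 1.\<close>

lemma smooth_fan_primitive_points:
  assumes P: "fano_polygon P"
  shows "smooth_fan {(x, y) \<in> lat P. coprime x y}"
  unfolding smooth_fan_def
proof (intro allI impI)
  fix x y assume "(x, y) \<in> {(x, y) \<in> lat P. coprime x y}"
  then have xy: "(x, y) \<in> lat P" "coprime x y" by auto
  have zero: "0 \<in> P" using P interior_subset by (auto simp: fano_polygon_def)
  have *: "\<exists>z w. (z, w) \<in> {(x, y) \<in> lat P. coprime x y} \<and> x * w - y * z = \<sigma>" if \<sigma>: "\<sigma> = 1 \<or> \<sigma> = (- 1 :: int)" for \<sigma>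
  proof -
    have "\<sigma> * y \<noteq> 0 \<or> - \<sigma> * x \<noteq> 0" using xy(2) \<sigma> by auto
    then obtain X Y where XY: "(X, Y) \<in> lat P" "\<sigma> * y * X + - \<sigma> * x * Y < 0"
      by (rule surrounds_origin_int[OF fano_polygonD(6)[OF P]])
    have "0 < \<sigma> * (x * Y - y * X)" using XY(2) by (simp add: algebra_simps)
    then obtain b1 b2 where b: "(b1, b2) \<in> lat P" "x * b2 - y * b1 = \<sigma>"
      by (rule convex_triangle_lattice_point[OF fano_polygonD(1)[OF P] zero xy(2,1) XY(1) _ \<sigma>])
    have "coprime b1 b2"
    proof (rule coprimeI)
      fix d assume "d dvd b1" "d dvd b2"
      then have "d dvd x * b2 - y * b1" by (intro dvd_diff dvd_mult)
      then show "is_unit d" unfolding b(2) using \<sigma> by auto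
    qed
    then show ?thesis using b by blast
  qed
  show "(\<exists>z w. (z, w) \<in> {(x, y) \<in> lat P. coprime x y} \<and> x * w - y * z = 1) \<and>
    (\<exists>z w. (z, w) \<in> {(x, y) \<in> lat P. coprime x y} \<and> x * w - y * z = - 1)" using * by blast
qed

lemma finite_representatives:
  fixes \<nu> :: nat
  shows "\<exists>R. finite R \<and> (\<forall>P. fano_polygon P \<longrightarrow> has_residual_points P \<nu> \<longrightarrow>
    (\<exists>Q\<in>R. fano_polygon Q \<and> equivclp mutation_step P Q))"
proof (intro exI conjI allI impI)
  define H where "H = 2 * int \<nu> + 1"
  define C where "C = 8 * H + 8"
  define N where "N = 2 * C * (2 * C * C + 2 * C)"
  \<comment> \<open>A normalised polygon is the hull of its vertices, which lie in one box that
    depends on \<nu> alone.\<close>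
  let ?R = "(\<lambda>S. convex hull (pt ` S)) ` Pow ({- N..N} \<times> {- N..N})"
  show "finite ?R" by simp
  have H0: "0 \<le> H" and C0: "0 \<le> C" by (simp_all add: H_def C_def)
  fix P assume P: "fano_polygon P" and res: "has_residual_points P \<nu>"
  obtain Q where Q: "fano_polygon Q" "residual_heights_le H (lat Q)" "mutation_minimal (lat Q)" "equivclp mutation_step P Q"
    using exists_minimal_polygon[OF P residual_heights_le_residual_points[OF P res]] unfolding H_def by blast
  have ht: "- (a * x + b * y) \<le> C" if "lattice_edge (lat Q) a b x y k" for a b x y k
    unfolding C_def by (rule minimal_polygon_heights[OF Q(1-3) H0 that])
  let ?S = "{(x, y) \<in> lat Q. coprime x y}"
  have "Q \<noteq> {}" using Q(1) interior_subset unfolding fano_polygon_def by blast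
  then obtain u where u: "u extreme_point_of Q"
    using extreme_point_exists_convex[OF fano_polygonD(2,1)[OF Q(1)]] by blast
  have "primitive u" using Q(1) u unfolding fano_polygon_def by blast
  moreover have "u \<in> Q" using u unfolding extreme_point_of_def by blast
  ultimately obtain x0 y0 where "(x0, y0) \<in> ?S" by (auto simp: primitive_def)
  then have ne: "?S \<noteq> {}" by blast
  obtain m1 m2 m3 m4 where det: "m1 * m4 - m2 * m3 = 1" and
    N: "\<And>a b x y k. lattice_edge (lmap m1 m2 m3 m4 ` lat Q) a b x y k \<Longrightarrow> \<bar>x\<bar> \<le> N \<and> \<bar>y\<bar> \<le> N"
    unfolding N_def
    by (rule bounded_normal_form[OF fano_polygonD(6)[OF Q(1)] C0 ht _ ne smooth_fan_primitive_points[OF Q(1)]]) auto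
  let ?Q' = "rmap m1 m2 m3 m4 ` Q"
  note gl = gl_equivalent_rmap[OF Q(1) det]
  note Q' = fano_polygonD[OF gl(2)]
  define S where "S = {v. pt v extreme_point_of ?Q'}"
  have box: "S \<subseteq> {- N..N} \<times> {- N..N}"
  proof
    fix v assume "v \<in> S"
    then have "pt v extreme_point_of convex hull (pt ` lat ?Q')" unfolding S_def Q'(5) by simp
    then obtain a b x y k where e: "lattice_edge (lat ?Q') a b x y k" and "pt v = pt (x, y)"
      by (rule extreme_point_lattice_edge[OF Q'(6)])
    then have "v = (x, y)" by (simp only: pt_eq_iff)
    then show "v \<in> {- N..N} \<times> {- N..N}" using N[OF e[unfolded gl(1)]] by (simp add: abs_le_iff minus_le_iff)
  qed
  have "{p. p extreme_point_of ?Q'} = pt ` S"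
  proof
    show "pt ` S \<subseteq> {p. p extreme_point_of ?Q'}" by (auto simp: S_def)
    show "{p. p extreme_point_of ?Q'} \<subseteq> pt ` S"
    proof
      fix p assume p: "p \<in> {p. p extreme_point_of ?Q'}"
      then have "primitive p" using gl(2) unfolding fano_polygon_def by blast
      then obtain x y where "p = pt (x, y)" by (auto simp: primitive_def)
      then show "p \<in> pt ` S" using p unfolding S_def by blast
    qed
  qed
  then have "?Q' = convex hull (pt ` S)" using Krein_Milman_Minkowski[OF Q'(2,1)] by simp
  then have "?Q' \<in> ?R" using box by blast
  moreover have "mutation_step Q ?Q'" using Q(1) gl by (simp add: mutation_step_def)
  then have "equivclp mutation_step P ?Q'" using Q(4) by (meson equivclp_into_equivclp)
  ultimately show "\<exists>Q\<in>?R. fano_polygon Q \<and> equivclp mutation_step P Q" using gl(2) by blast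
qed

theorem theorem1p8:
  fixes \<nu> :: nat
  shows "finite ({P. fano_polygon P \<and> has_residual_points P \<nu>} // mutation_equivalence)"
proof -
  obtain R where R: "finite R" and rep: "\<And>P. fano_polygon P \<Longrightarrow> has_residual_points P \<nu> \<Longrightarrow>
       \<exists>Q\<in>R. fano_polygon Q \<and> equivclp mutation_step P Q" using finite_representatives by metis
  have "{P. fano_polygon P \<and> has_residual_points P \<nu>} // mutation_equivalence \<subseteq> (\<lambda>Q. mutation_equivalence `` {Q}) ` R"
  proof
    fix c assume "c \<in> {P. fano_polygon P \<and> has_residual_points P \<nu>} // mutation_equivalence"
    then obtain P where P: "fano_polygon P" "has_residual_points P \<nu>" "c = mutation_equivalence `` {P}"
      by (auto elim: quotientE)
    obtain Q where Q: "Q \<in> R" "fano_polygon Q" "equivclp mutation_step P Q" using rep[OF P(1,2)] by blast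
    have "equivclp mutation_step P X \<longleftrightarrow> equivclp mutation_step Q X" for X
      using Q(3) by (meson equivclp_sym equivclp_trans)
    then have "c = mutation_equivalence `` {Q}" unfolding P(3) mutation_equivalence_def using P(1) Q(2) by auto
    then show "c \<in> (\<lambda>Q. mutation_equivalence `` {Q}) ` R" using Q(1) by blast
  qed
  then show ?thesis using R finite_subset by blast
qed

end
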